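(* Let $p>1$ and let $\Omega_1,\Omega_2\subset\mathbb{H}^n$ be bounded open sets with $C^1$ boundaries, strictly starshaped with respect to the origin $O\in\mathbb{H}^n$, and such that $\Omega_1\Subset\Omega_2$. Assume that $\Omega_1$ satisfies a uniform exterior gauge ball condition and that $\Omega_2$ satisfies a uniform interior gauge ball condition. Let $u$ be a weak solution to the problem $$\Delta_p^{\mathbb{H}^n}u=0\ \text{ in }\Omega_2\setminus\overline{\Omega}_1,\qquad u=1\ \text{ on }\overline{\Omega}_1,\qquad u=0\ \text{ on }\partial\Omega_2 .$$ Then there exists a positive constant $M$ such that $$\langle\nabla u,Z\rangle<-M<0$$ at any point of $\Omega_2\setminus\overline{\Omega}_1$ where the classical gradient $\nabla u$ exists.
   Context: Heisenberg group. For $n\ge1$, $\mathbb{H}^n$ is the Lie group $(\mathbb{R}^{2n+1},\cdot)$ with points $z=(x_1,\dots,x_n,y_1,\dots,y_n,t)$ and product $$z\cdot\tilde z=\Big(x_1+\tilde x_1,\dots,x_n+\tilde x_n,\;y_1+\tilde y_1,\dots,y_n+\tilde y_n,\;t+\tilde t-2\sum_{i=1}^n(x_i\tilde y_i-\tilde x_iy_i)\Big);$$ $z^{-1}$ is the group inverse and $O$ is the origin. The horizontal vector fields are $X_i=\partial_{x_i}+2y_i\partial_t$ and $Y_i=\partial_{y_i}-2x_i\partial_t$, $i=1,\dots,n$. The horizontal gradient is $\nabla_{\mathbb{H}^n}f=(X_1f,\dots,X_nf,Y_1f,\dots,Y_nf)$, while $\nabla$ is the classical gradient of $\mathbb{R}^{2n+1}$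 (existing at points of standard differentiability); $\langle\cdot,\cdot\rangle$ and $|\cdot|$ are the Euclidean scalar product and norm. Gauge balls. $\rho(z)=\big[\big(\sum_{i=1}^n (x_i^2+y_i^2)\big)^2+t^2\big]^{1/4}$ and $B_\rho(z,R)=\{w\in\mathbb{H}^n:\rho(w^{-1}\cdot z)<R\}$ for $R>0$. Gauge ball conditions. An open bounded set $\Omega\subset\mathbb{H}^n$ satisfies the exterior gauge ball condition at $z\in\partial\Omega$ if there exist $z_1\in\mathbb{H}^n\setminus\overline{\Omega}$ and $R>0$ such that $B_\rho(z_1,R)\subset\mathbb{H}^n\setminus\overline{\Omega}$ and $\overline{B}_\rho(z_1,R)\cap\partial\Omega=\{z\}$. It satisfies the interior gauge ball condition at $z\in\partial\Omega$ if there exist $z_2\in\Omega$ and $R>0$ such that $B_\rho(z_2,R)\subset\Omega$ and $\overline{B}_\rho(z_2,R)\cap\partial\Omega=\{z\}$. Either condition is uniform if it holds at every $z\in\partial\Omega$ with the same $R$. Starshapedness. Let $Z(z)=(x_1,\dots,x_n,y_1,\dots,y_n,2t)$ (the dilation-generating vector field). An open bounded set $\Omega\subset\mathbb{H}^n$ with $C^1$ boundary is strictly starshaped with respect to the origin if it contains the origin and $\langle\nu,Z\rangle(z)>0$ for every $z\in\partial\Omega$, where $\nu$ is the Euclidean exterior unit normal to $\partial\Omega$. Weak solutions. $\Delta_p^{\mathbb{H}^n}f=\sum_{i=1}^n X_i(|\nabla_{\mathbb{H}^n}f|^{p-2}X_if)+Y_i(|\nabla_{\mathbb{H}^n}f|^{p-2}Y_if)$.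 For an open set $U$, $HW^{1,p}(U)$ is the completion of $C^1(U)$ with respect to the norm determined by $\int_U|f|^p+|\nabla_{\mathbb{H}^n}f|^p\,dz$, i.e. the $p$-th root of this integral (over functions for which it is finite), and $HW^{1,p}_0(U)$ is the completion of $C^1_0(U)$ ($C^1$ functions with compact support in $U$) in the same norm. A function $f\in HW^{1,p}(U)$ is horizontally weakly $p$-harmonic if $\sum_{i=1}^n\int_U|\nabla_{\mathbb{H}^n}f|^{p-2}(X_if\,X_i\phi+Y_if\,Y_i\phi)\,dz=0$ for all $\phi\in C^1_0(U)$; such functions are identified with their continuous representatives. A weak solution of the boundary value problem is a horizontally weakly $p$-harmonic $u\in HW^{1,p}(\Omega_2\setminus\overline{\Omega}_1)$ such that $u-\theta\in HW^{1,p}_0(\Omega_2\setminus\overline{\Omega}_1)$, where $\theta\in C^\infty_0(\Omega_2)$ satisfies $\theta\equiv1$ on $\overline{\Omega}_1$ (the notion does not depend on the choice of $\theta$). *)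

theory Defs
  imports "HOL-Analysis.Analysis"
begin

section \<open>The Heisenberg group\<close>

text \<open>
  The index type \<open>'n\<close> has \<open>n\<close> elements, so \<open>'n heis\<close> is
  \<open>\<real>\<^sup>n \<times> \<real>\<^sup>n \<times> \<real>\<close>, with points \<open>(x, y, t)\<close>.  Its library structure as a Euclidean space
  (inner product, norm, topology, Lebesgue measure) is that of \<open>\<real>\<^sup>2\<^sup>n\<^sup>+\<^sup>1\<close>.
\<close>

type_synonym 'n heis = "(real ^ 'n) \<times> (real ^ 'n) \<times> real"

fun hmul :: "'n::finite heis \<Rightarrow> 'n heis \<Rightarrow> 'n heis" where
  "hmul (x, y, t) (x', y', t') =
     (x + x', y + y', t + t' - 2 * (\<Sum>i\<in>UNIV. x $ i * y' $ i - x' $ i * y $ i))"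

fun hinv :: "'n::finite heis \<Rightarrow> 'n heis" where
  "hinv (x, y, t) = (- x, - y, - t)"

lemma hmul_assoc: "hmul (hmul a b) c = hmul a (hmul b c)"
  by (cases a; cases b; cases c)
     (simp add: algebra_simps sum.distrib sum_subtractf)

lemma hmul_0: "hmul 0 a = a" "hmul a 0 = a"
  by (cases a; simp add: zero_prod_def)+

lemma hmul_hinv: "hmul (hinv a) a = 0" "hmul a (hinv a) = 0"
  by (cases a; simp add: zero_prod_def algebra_simps)+

fun hrho :: "'n::finite heis \<Rightarrow> real" where
  "hrho (x, y, t) = root 4 ((\<Sum>i\<in>UNIV. (x $ i)\<^sup>2 + (y $ i)\<^sup>2)\<^sup>2 + t\<^sup>2)"

definition hball :: "'n::finite heis \<Rightarrow> real \<Rightarrow> 'n heis set" where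
  "hball z R = {w. hrho (hmul (hinv w) z) < R}"

fun dilation_field :: "'n::finite heis \<Rightarrow> 'n heis" where
  "dilation_field (x, y, t) = (x, y, 2 * t)"


section \<open>Uniform gauge ball conditions\<close>

definition uniform_exterior_hball :: "'n::finite heis set \<Rightarrow> bool" where
  "uniform_exterior_hball \<Omega> \<longleftrightarrow>
     (\<exists>R>0. \<forall>z\<in>frontier \<Omega>. \<exists>z1\<in>- closure \<Omega>.
        hball z1 R \<subseteq> - closure \<Omega> \<and> closure (hball z1 R) \<inter> frontier \<Omega> = {z})"

definition uniform_interior_hball :: "'n::finite heis set \<Rightarrow> bool" where
  "uniform_interior_hball \<Omega> \<longleftrightarrow>
     (\<exists>R>0. \<forall>z\<in>frontier \<Omega>. \<exists>z2\<in>\<Omega>.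
        hball z2 R \<subseteq> \<Omega> \<and> closure (hball z2 R) \<inter> frontier \<Omega> = {z})"


section \<open>Functions of class \<open>C\<^sup>k\<close>\<close>

text \<open>To be used for open \<open>U\<close> only.\<close>

primrec Ck_on :: "nat \<Rightarrow> 'a::euclidean_space set \<Rightarrow> ('a \<Rightarrow> real) \<Rightarrow> bool" where
  "Ck_on 0 U f \<longleftrightarrow> continuous_on U f"
| "Ck_on (Suc k) U f \<longleftrightarrow>
     (\<forall>z\<in>U. f differentiable (at z)) \<and>
     (\<forall>b\<in>Basis. Ck_on k U (\<lambda>z. frechet_derivative f (at z) b))"

definition compact_support_in :: "'a::euclidean_space set \<Rightarrow> ('a \<Rightarrow> real) \<Rightarrow> bool" where
  "compact_support_in U f \<longleftrightarrow>
     compact (closure {z. f z \<noteq> 0}) \<and> closure {z. f z \<noteq> 0} \<subseteq> U"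


section \<open>\<open>C\<^sup>1\<close> boundaries and strict starshapedness\<close>

text \<open>
  Near a boundary point \<open>z\<close>, the set \<open>\<Omega>\<close> is the sublevel set \<open>{g < 0}\<close> of a \<open>C\<^sup>1\<close> function
  with non-vanishing gradient.  The exterior normal is then the normalised gradient of \<open>g\<close>;
  it does not depend on the choice of \<open>V\<close> and \<open>g\<close>.
\<close>

definition C1_defining_fun ::
    "'a::euclidean_space set \<Rightarrow> 'a \<Rightarrow> 'a set \<Rightarrow> ('a \<Rightarrow> real) \<Rightarrow> bool" where
  "C1_defining_fun \<Omega> z V g \<longleftrightarrow>
     open V \<and> z \<in> V \<and> Ck_on 1 V g \<and> (\<forall>w\<in>V. \<not> GDERIV g w :> 0) \<and>
     \<Omega> \<inter> V = {w\<in>V. g w < 0} \<and> frontier \<Omega> \<inter> V = {w\<in>V. g w = 0}"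

definition C1_boundary :: "'a::euclidean_space set \<Rightarrow> bool" where
  "C1_boundary \<Omega> \<longleftrightarrow> (\<forall>z\<in>frontier \<Omega>. \<exists>V g. C1_defining_fun \<Omega> z V g)"

definition exterior_unit_normal :: "'a::euclidean_space set \<Rightarrow> 'a \<Rightarrow> 'a \<Rightarrow> bool" where
  "exterior_unit_normal \<Omega> z \<nu> \<longleftrightarrow>
     (\<exists>V g D. C1_defining_fun \<Omega> z V g \<and> GDERIV g z :> D \<and> \<nu> = D /\<^sub>R norm D)"

definition strictly_starshaped :: "'n::finite heis set \<Rightarrow> bool" where
  "strictly_starshaped \<Omega> \<longleftrightarrow>
     open \<Omega> \<and> bounded \<Omega> \<and> C1_boundary \<Omega> \<and> 0 \<in> \<Omega> \<and>
     (\<forall>z\<in>frontier \<Omega>. \<forall>\<nu>. exterior_unit_normal \<Omega> z \<nu> \<longrightarrow> \<nu> \<bullet> dilation_field z > 0)"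


section \<open>Horizontal derivatives and horizontal Sobolev spaces\<close>

fun Xvec :: "'n::finite \<Rightarrow> 'n heis \<Rightarrow> 'n heis" where
  "Xvec i (x, y, t) = (axis i 1, 0, 2 * y $ i)"

fun Yvec :: "'n::finite \<Rightarrow> 'n heis \<Rightarrow> 'n heis" where
  "Yvec i (x, y, t) = (0, axis i 1, - (2 * x $ i))"

definition Xder :: "'n::finite \<Rightarrow> ('n heis \<Rightarrow> real) \<Rightarrow> 'n heis \<Rightarrow> real" where
  "Xder i f z = frechet_derivative f (at z) (Xvec i z)"

definition Yder :: "'n::finite \<Rightarrow> ('n heis \<Rightarrow> real) \<Rightarrow> 'n heis \<Rightarrow> real" where
  "Yder i f z = frechet_derivative f (at z) (Yvec i z)"

definition hgrad :: "('n::finite heis \<Rightarrow> real) \<Rightarrow> 'n heis \<Rightarrow> (real ^ 'n) \<times> (real ^ 'n)" where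
  "hgrad f z = (\<chi> i. Xder i f z, \<chi> i. Yder i f z)"

text \<open>The \<open>p\<close>-th power of the Sobolev norm of a function \<open>f\<close> with horizontal gradient \<open>G\<close>.\<close>

definition hsob_pow ::
    "real \<Rightarrow> 'n::finite heis set \<Rightarrow> ('n heis \<Rightarrow> real) \<Rightarrow>
     ('n heis \<Rightarrow> (real ^ 'n) \<times> (real ^ 'n)) \<Rightarrow> ennreal" where
  "hsob_pow p U f G =
     (\<integral>\<^sup>+z. ennreal (\<bar>f z\<bar> powr p + norm (G z) powr p) \<partial>lebesgue_on U)"

text \<open>
  The completion of a class \<open>S\<close> of functions of finite Sobolev norm is realised as the
  closure of \<open>{(\<phi>, \<nabla>\<^sub>H\<phi>). \<phi> \<in> S}\<close> in \<open>L\<^sup>p(U) \<times> L\<^sup>p(U; \<real>\<^sup>2\<^sup>n)\<close>.  An element is thus a pair \<open>(f, G)\<close>,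
  where \<open>G\<close> is the horizontal gradient of \<open>f\<close>; \<open>G\<close> is determined by \<open>f\<close> almost everywhere.
\<close>

definition hsob_completion ::
    "real \<Rightarrow> 'n::finite heis set \<Rightarrow> ('n heis \<Rightarrow> real) set \<Rightarrow> ('n heis \<Rightarrow> real) \<Rightarrow>
     ('n heis \<Rightarrow> (real ^ 'n) \<times> (real ^ 'n)) \<Rightarrow> bool" where
  "hsob_completion p U S f G \<longleftrightarrow>
     f \<in> borel_measurable (lebesgue_on U) \<and> G \<in> borel_measurable (lebesgue_on U) \<and>
     (\<exists>F. (\<forall>k::nat. F k \<in> S) \<and>
          (\<lambda>k. hsob_pow p U (\<lambda>z. F k z - f z) (\<lambda>z. hgrad (F k) z - G z)) \<longlonglongrightarrow> 0)"

definition HW :: "real \<Rightarrow> 'n::finite heis set \<Rightarrow> ('n heis \<Rightarrow> real) \<Rightarrow>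
     ('n heis \<Rightarrow> (real ^ 'n) \<times> (real ^ 'n)) \<Rightarrow> bool" where
  "HW p U = hsob_completion p U {f. Ck_on 1 U f \<and> hsob_pow p U f (hgrad f) < \<infinity>}"

definition C1_0 :: "'n::finite heis set \<Rightarrow> ('n heis \<Rightarrow> real) set" where
  "C1_0 U = {\<phi>. Ck_on 1 U \<phi> \<and> compact_support_in U \<phi>}"

definition HW0 :: "real \<Rightarrow> 'n::finite heis set \<Rightarrow> ('n heis \<Rightarrow> real) \<Rightarrow>
     ('n heis \<Rightarrow> (real ^ 'n) \<times> (real ^ 'n)) \<Rightarrow> bool" where
  "HW0 p U = hsob_completion p U (C1_0 U)"


section \<open>Weak solutions\<close>

text \<open>For \<open>p < 2\<close> the convention \<open>0 powr a = 0\<close> makes \<open>|G|\<^sup>p\<^sup>-\<^sup>2 G\<close> vanish where \<open>G\<close> does.\<close>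

definition weakly_p_harmonic :: "real \<Rightarrow> 'n::finite heis set \<Rightarrow> ('n heis \<Rightarrow> real) \<Rightarrow>
     ('n heis \<Rightarrow> (real ^ 'n) \<times> (real ^ 'n)) \<Rightarrow> bool" where
  "weakly_p_harmonic p U f G \<longleftrightarrow>
     HW p U f G \<and>
     (\<forall>\<phi>\<in>C1_0 U.
        (\<Sum>i\<in>UNIV. \<integral>z. norm (G z) powr (p - 2) *
            (fst (G z) $ i * Xder i \<phi> z + snd (G z) $ i * Yder i \<phi> z) \<partial>lebesgue_on U) = 0)"

text \<open>
  Weak solution of the Dirichlet problem in \<open>\<Omega>2 - closure \<Omega>1\<close> with value \<open>1\<close> on \<open>closure \<Omega>1\<close>
  and \<open>0\<close> on \<open>frontier \<Omega>2\<close>.  The function \<open>u\<close> is the continuous representative; its values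
  outside \<open>\<Omega>2 - closure \<Omega>1\<close> play no role.
\<close>

definition weak_solution :: "real \<Rightarrow> 'n::finite heis set \<Rightarrow> 'n heis set \<Rightarrow>
     ('n heis \<Rightarrow> real) \<Rightarrow> bool" where
  "weak_solution p \<Omega>1 \<Omega>2 u \<longleftrightarrow>
     continuous_on (\<Omega>2 - closure \<Omega>1) u \<and>
     (\<exists>G. weakly_p_harmonic p (\<Omega>2 - closure \<Omega>1) u G \<and>
       (\<exists>\<theta>. (\<forall>k. Ck_on k \<Omega>2 \<theta>) \<and> compact_support_in \<Omega>2 \<theta> \<and> (\<forall>z\<in>closure \<Omega>1. \<theta> z = 1) \<and>
            HW0 p (\<Omega>2 - closure \<Omega>1) (\<lambda>z. u z - \<theta> z) (\<lambda>z. G z - hgrad \<theta> z)))"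

end

theory Submission
  imports Defs
begin

text \<open>
  Let \<open>U = \<Omega>\<^sub>2 - closure \<Omega>\<^sub>1\<close> and let \<open>\<delta>\<^sub>r(x, y, t) = (r x, r y, r\<^sup>2 t)\<close> be the Heisenberg dilations.  They
  are generated by \<open>Z\<close>, and they map \<open>p\<close>-harmonic functions to \<open>p\<close>-harmonic functions.  The bound on
  \<open>\<langle>\<nabla>u, Z\<rangle>\<close> is the derivative at \<open>r = 1\<close> of the inequality
  \<open>u(\<delta>\<^sub>r z) \<le> u(z) - m (r - 1)\<close> for \<open>r > 1\<close>, with one constant \<open>m > 0\<close> for the whole ring.  Both sides
  are \<open>p\<close>-harmonic, so this follows from a comparison principle once it holds on the boundary of
  \<open>\<delta>\<^sub>1\<^sub>/\<^sub>r \<Omega>\<^sub>2 - closure \<Omega>\<^sub>1\<close>, that is, once \<open>u(z) \<ge> m (r - 1)\<close> for \<open>\<delta>\<^sub>r z\<close> on the boundary of \<open>\<Omega>\<^sub>2\<close>,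
  and \<open>1 - u(\<delta>\<^sub>r z) \<ge> m (r - 1)\<close> for \<open>z\<close> on the boundary of \<open>\<Omega>\<^sub>1\<close>.  Such linear growth away from the
  boundary is where the gauge balls enter.

  Growth.  Let \<open>N\<close> be the fourth power of the gauge distance to a centre \<open>a\<close>.  Away from \<open>a\<close>, and for large
  \<open>\<alpha>\<close>, the function \<open>exp (- \<alpha> N)\<close> is \<open>p\<close>-subharmonic (\<open>barrier_weak_subsolution\<close>), so \<open>u\<close> lies above a
  multiple of \<open>exp (- \<alpha> N) - exp (- \<alpha> S)\<close> in a gauge ball \<open>{N < S}\<close> inside \<open>\<Omega>\<^sub>2\<close> as soon as it has a positive
  lower bound near the centre (\<open>barrier_le\<close>).  This barrier is used twice.  Being positive in the whole
  ball, it spreads positivity from the centre, along chains of balls, to all of \<open>\<Omega>\<^sub>2\<close>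
  (\<open>positive_near_connected\<close>).  Being linear in \<open>S - N\<close> at the sphere, it gives
  \<open>u \<ge> \<kappa> (S - N)\<close> in the balls that touch the boundary.  At the touching point the differential of
  \<open>N\<close> is a positive multiple of the exterior normal, so strict starshapedness says that
  \<open>\<delta>\<^sub>1\<^sub>-\<^sub>h\<close> moves that point into the ball with \<open>S - N\<close> at least \<open>m h\<close> (\<open>touching_ball_crossing\<close>,
  \<open>dilation_enters_balls\<close>).  The touching balls have one radius, hence form a compact family, and the constants are
  uniform.  The same argument for \<open>1 - u\<close> in the exterior of \<open>\<Omega>\<^sub>1\<close> uses \<open>\<delta>\<^sub>1\<^sub>+\<^sub>h\<close>; the locale
  \<open>capacitary\<close> treats both cases at once.

  Comparison.  Weak solutions are limits of \<open>C\<^sup>1\<close> functions that satisfy the boundary condition, up to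
  small errors, near the boundary.  The test functions are \<open>C\<^sup>1\<close> functions of two such approximants, cut off according to
  the values of these functions, so that their supports are compact.  In the limit
  strict monotonicity of \<open>G \<mapsto> |G|\<^sup>p\<^sup>-\<^sup>2 G\<close> shows that the positive part of the difference
  has vanishing horizontal gradient, and integration by parts against \<open>x\<^sub>i\<close> shows that a nonnegative
  function with that property and zero boundary values vanishes (\<open>comparison_principle\<close>).
\<close>

section \<open>Functions of class \<open>C\<^sup>1\<close> and their horizontal gradients\<close>

lemma Ck_on_1_differentiable:
  assumes "Ck_on 1 V f" "z \<in> V"
  shows "(f has_derivative frechet_derivative f (at z)) (at z)"
  using assms by (auto simp: frechet_derivative_works)

lemma Ck_on_1_continuous_derivative:
  fixes f :: "'a::euclidean_space \<Rightarrow> real"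
  assumes "Ck_on 1 V f" "continuous_on V v"
  shows "continuous_on V (\<lambda>z. frechet_derivative f (at z) (v z))"
proof -
  have "frechet_derivative f (at z) (v z) =
      (\<Sum>b\<in>Basis. (v z \<bullet> b) * frechet_derivative f (at z) b)" if "z \<in> V" for z
  proof -
    interpret linear "frechet_derivative f (at z)"
      using Ck_on_1_differentiable[OF assms(1) that] has_derivative_linear by blast
    have "frechet_derivative f (at z) (\<Sum>b\<in>Basis. (v z \<bullet> b) *\<^sub>R b) =
      (\<Sum>b\<in>Basis. (v z \<bullet> b) * frechet_derivative f (at z) b)"
      by (simp add: sum scale)
    then show ?thesis by (simp add: euclidean_representation)
  qed
  moreover have "continuous_on V (\<lambda>z. \<Sum>b\<in>Basis. (v z \<bullet> b) * frechet_derivative f (at z) b)"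
    using assms by (intro continuous_intros) auto
  ultimately show ?thesis by (simp cong: continuous_on_cong)
qed

lemma Ck_on_1I:
  fixes f :: "'a::euclidean_space \<Rightarrow> real"
  assumes "\<And>z. z \<in> V \<Longrightarrow> (f has_derivative f' z) (at z)"
    and "\<And>v. continuous_on V (\<lambda>z. f' z v)"
  shows "Ck_on 1 V f"
proof -
  have "frechet_derivative f (at z) = f' z" if "z \<in> V" for z
    using frechet_derivative_at[OF assms(1)[OF that]] by simp
  then have "continuous_on V (\<lambda>z. frechet_derivative f (at z) b)" for b
    using assms(2)[of b] by (simp cong: continuous_on_cong)
  then show ?thesis
    using assms(1) by (auto simp: differentiable_def)
qed

lemma Ck_on_1_continuous: "Ck_on 1 V f \<Longrightarrow> continuous_on V f"
  using Ck_on_1_differentiable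
  by (meson continuous_at_imp_continuous_on has_derivative_continuous)

lemma Ck_on_subset: "Ck_on k V f \<Longrightarrow> W \<subseteq> V \<Longrightarrow> Ck_on k W f"
proof (induction k arbitrary: f)
  case 0
  then show ?case using continuous_on_subset by auto
next
  case (Suc k)
  then show ?case by (auto simp: subset_iff)
qed

lemma Ck_on_1_cong:
  assumes "open V" "\<And>z. z \<in> V \<Longrightarrow> f z = g z" "Ck_on 1 V f"
  shows "Ck_on 1 V g"
proof (rule Ck_on_1I[where f' = "\<lambda>z. frechet_derivative f (at z)"])
  show "(g has_derivative frechet_derivative f (at z)) (at z)" if "z \<in> V" for z
    using has_derivative_transform_within_open[OF Ck_on_1_differentiable[OF assms(3) that] assms(1) that]
      assms(2) by blast
  show "continuous_on V (\<lambda>z. frechet_derivative f (at z) v)" for v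
    using Ck_on_1_continuous_derivative[OF assms(3)] by auto
qed

lemma Ck_on_1_const: "Ck_on 1 V (\<lambda>z. c)"
  by (rule Ck_on_1I[where f' = "\<lambda>z v. 0"]) auto

lemma Ck_on_1_add:
  assumes "Ck_on 1 V f" "Ck_on 1 V g"
  shows "Ck_on 1 V (\<lambda>z. f z + g z)"
proof (rule Ck_on_1I)
  show "((\<lambda>z. f z + g z) has_derivative (\<lambda>v. frechet_derivative f (at z) v + frechet_derivative g (at z) v)) (at z)"
    if "z \<in> V" for z
    using Ck_on_1_differentiable[OF assms(1) that] Ck_on_1_differentiable[OF assms(2) that]
    by (rule has_derivative_add)
qed (intro continuous_intros Ck_on_1_continuous_derivative assms)

lemma Ck_on_1_mult:
  assumes "Ck_on 1 V f" "Ck_on 1 V g"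
  shows "Ck_on 1 V (\<lambda>z. f z * g z)"
proof (rule Ck_on_1I)
  show "((\<lambda>z. f z * g z) has_derivative
      (\<lambda>v. f z * frechet_derivative g (at z) v + frechet_derivative f (at z) v * g z)) (at z)"
    if "z \<in> V" for z
    using Ck_on_1_differentiable[OF assms(1) that] Ck_on_1_differentiable[OF assms(2) that]
    by (rule has_derivative_mult)
qed (intro continuous_intros Ck_on_1_continuous_derivative Ck_on_1_continuous assms)

text \<open>
  The horizontal derivatives of a function are the values of its differential on the horizontal
  frame.  Recording this for an arbitrary linear form makes every rule of the
  differential calculus into a rule for horizontal gradients.
\<close>

definition horizontal_part ::
    "'n::finite heis \<Rightarrow> ('n heis \<Rightarrow> real) \<Rightarrow> (real ^ 'n) \<times> (real ^ 'n)" where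
  "horizontal_part z L = (\<chi> i. L (Xvec i z), \<chi> i. L (Yvec i z))"

lemma hgrad_eq_horizontal_part:
  "(f has_derivative L) (at z) \<Longrightarrow> hgrad f z = horizontal_part z L"
  by (auto simp: hgrad_def horizontal_part_def Xder_def Yder_def dest: frechet_derivative_at)

lemma horizontal_part_add:
  "horizontal_part z (\<lambda>v. L v + L' v) = horizontal_part z L + horizontal_part z L'"
  by (simp add: horizontal_part_def vec_eq_iff)

lemma horizontal_part_scale:
  "horizontal_part z (\<lambda>v. c * L v) = c *\<^sub>R horizontal_part z L"
  by (simp add: horizontal_part_def vec_eq_iff)

lemma hgrad_horizontal_part_frechet:
  "hgrad f z = horizontal_part z (frechet_derivative f (at z))"
  by (simp add: hgrad_def horizontal_part_def Xder_def Yder_def)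

lemma continuous_on_Xvec [continuous_intros]: "continuous_on V (Xvec i)"
  and continuous_on_Yvec [continuous_intros]: "continuous_on V (Yvec i)"
proof -
  have "Xvec i = (\<lambda>z. (axis i 1, 0, 2 * fst (snd z) $ i))"
    "Yvec i = (\<lambda>z. (0, axis i 1, - (2 * fst z $ i)))" by auto
  then show "continuous_on V (Xvec i)" "continuous_on V (Yvec i)"
    by (auto intro!: continuous_intros)
qed

lemma continuous_on_hgrad:
  assumes "Ck_on 1 V f"
  shows "continuous_on V (hgrad f)"
  unfolding hgrad_def[abs_def] Xder_def Yder_def
  by (intro continuous_intros Ck_on_1_continuous_derivative assms)

lemma hgrad_add:
  assumes "f differentiable at z" "g differentiable at z"
  shows "hgrad (\<lambda>z. f z + g z) z = hgrad f z + hgrad g z"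
  using hgrad_eq_horizontal_part[OF has_derivative_add[OF assms[unfolded frechet_derivative_works]]]
  by (simp add: horizontal_part_add hgrad_horizontal_part_frechet)

lemma hgrad_const: "hgrad (\<lambda>z. c) z = 0"
  by (simp add: hgrad_def Xder_def Yder_def vec_eq_iff prod_eq_iff zero_vec_def)

lemma
  fixes P :: "real \<Rightarrow> real \<Rightarrow> real" and z :: "'n::finite heis"
  assumes P: "\<And>s t. ((\<lambda>x. P (fst x) (snd x)) has_derivative (\<lambda>x. P1 s t * fst x + P2 s t * snd x)) (at (s, t))"
    and cP: "continuous_on UNIV (\<lambda>x. P1 (fst x) (snd x))" "continuous_on UNIV (\<lambda>x. P2 (fst x) (snd x))"
    and f: "Ck_on 1 V f" and g: "Ck_on 1 V g"
  shows Ck_on_1_compose2: "Ck_on 1 V (\<lambda>z. P (f z) (g z))"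
    and hgrad_compose2: "z \<in> V \<Longrightarrow> hgrad (\<lambda>z. P (f z) (g z)) z =
      P1 (f z) (g z) *\<^sub>R hgrad f z + P2 (f z) (g z) *\<^sub>R hgrad g z"
proof -
  have D: "((\<lambda>z. P (f z) (g z)) has_derivative
      (\<lambda>v. P1 (f z) (g z) * frechet_derivative f (at z) v + P2 (f z) (g z) * frechet_derivative g (at z) v)) (at z)"
    if "z \<in> V" for z
  proof -
    have "((\<lambda>z. (f z, g z)) has_derivative
        (\<lambda>v. (frechet_derivative f (at z) v, frechet_derivative g (at z) v))) (at z)"
      using Ck_on_1_differentiable[OF f that] Ck_on_1_differentiable[OF g that]
      by (rule has_derivative_Pair)
    from has_derivative_compose[OF this P] show ?thesis by simp
  qed
  have c: "continuous_on V (\<lambda>z. P1 (f z) (g z))" "continuous_on V (\<lambda>z. P2 (f z) (g z))"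
    using continuous_on_compose2[OF cP(1), of V "\<lambda>z. (f z, g z)"]
      continuous_on_compose2[OF cP(2), of V "\<lambda>z. (f z, g z)"]
    using continuous_on_Pair[OF Ck_on_1_continuous[OF f] Ck_on_1_continuous[OF g]] by simp_all
  show "Ck_on 1 V (\<lambda>z. P (f z) (g z))"
    by (rule Ck_on_1I[OF D]) (auto intro!: continuous_intros c Ck_on_1_continuous_derivative f g)
  show "hgrad (\<lambda>z. P (f z) (g z)) z = P1 (f z) (g z) *\<^sub>R hgrad f z + P2 (f z) (g z) *\<^sub>R hgrad g z"
    if "z \<in> V"
    unfolding hgrad_eq_horizontal_part[OF D[OF that]]
    by (simp add: horizontal_part_add horizontal_part_scale hgrad_horizontal_part_frechet)
qed

text \<open>
  Functions of the approximants are smooth only in the open set where these are.  Extension by zero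
  makes them admissible test functions.
\<close>

lemma C1_0_restrictI:
  assumes V: "open V" and C: "compact C" "C \<subseteq> V" and f: "Ck_on 1 V f"
    and 0: "\<And>z. z \<in> V - C \<Longrightarrow> f z = 0"
  shows "(\<lambda>z. if z \<in> V then f z else 0) \<in> C1_0 V"
proof -
  let ?f = "\<lambda>z. if z \<in> V then f z else 0"
  have "Ck_on 1 V ?f"
    by (rule Ck_on_1_cong[OF V _ f]) auto
  moreover have "{z. ?f z \<noteq> 0} \<subseteq> C" using 0 by auto
  then have "closure {z. ?f z \<noteq> 0} \<subseteq> C"
    using C(1) compact_imp_closed closure_minimal by blast
  then have "compact_support_in V ?f"
    using C compact_Int_closed[OF C(1) closed_closure[of "{z. ?f z \<noteq> 0}"]]
    by (auto simp: compact_support_in_def Int_absorb1)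
  ultimately show ?thesis by (simp add: C1_0_def)
qed

lemma C1_0_Ck_on_UNIV:
  assumes "open V" "\<phi> \<in> C1_0 V"
  shows "Ck_on 1 UNIV \<phi>"
proof -
  let ?K = "closure {z. \<phi> z \<noteq> 0}"
  have \<phi>: "Ck_on 1 V \<phi>" and K: "?K \<subseteq> V" using assms by (auto simp: C1_0_def compact_support_in_def)
  have "0 = \<phi> z" if "z \<in> - ?K" for z
    using that closure_subset[of "{z. \<phi> z \<noteq> 0}"] by auto
  then have 0: "Ck_on 1 (- ?K) \<phi>"
    by (rule Ck_on_1_cong[OF _ _ Ck_on_1_const[of _ 0], rotated]) auto
  have D: "(\<phi> has_derivative frechet_derivative \<phi> (at z)) (at z)" for z
  proof (cases "z \<in> V")
    case True
    then show ?thesis by (rule Ck_on_1_differentiable[OF \<phi>])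
  next
    case False
    with K have "z \<in> - ?K" by blast
    then show ?thesis by (rule Ck_on_1_differentiable[OF 0])
  qed
  show ?thesis
  proof (rule Ck_on_1I[OF D])
    fix v
    have "continuous_on (V \<union> - ?K) (\<lambda>z. frechet_derivative \<phi> (at z) v)"
      using assms(1)
      by (intro continuous_on_open_Un Ck_on_1_continuous_derivative \<phi> 0 continuous_on_const) auto
    moreover have "V \<union> - ?K = UNIV" using K by auto
    ultimately show "continuous_on UNIV (\<lambda>z. frechet_derivative \<phi> (at z) v)" by simp
  qed
qed

lemma C1_0_mono:
  assumes "open V" "V \<subseteq> U" "\<phi> \<in> C1_0 V"
  shows "\<phi> \<in> C1_0 U"
  using assms(2,3) Ck_on_subset[OF C1_0_Ck_on_UNIV[OF assms(1,3)] subset_UNIV]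
  unfolding C1_0_def compact_support_in_def by blast

lemma has_derivative_0_off_closed:
  assumes "closed K" "\<And>z. z \<notin> K \<Longrightarrow> f z = 0" "z \<notin> K"
  shows "(f has_derivative (\<lambda>v. 0)) (at z)"
proof (rule has_derivative_transform_within_open)
  show "((\<lambda>z. 0) has_derivative (\<lambda>v. 0)) (at z)" by simp
  show "open (- K)" "z \<in> - K" using assms(1,3) by auto
  show "0 = f w" if "w \<in> - K" for w using assms(2)[of w] that by simp
qed

lemma C1_0_zero:
  assumes "\<phi> \<in> C1_0 V" "z \<notin> closure {z. \<phi> z \<noteq> 0}"
  shows "\<phi> z = 0" "hgrad \<phi> z = 0"
proof -
  have 0: "\<phi> w = 0" if "w \<in> - closure {z. \<phi> z \<noteq> 0}" for w
    using that closure_subset[of "{z. \<phi> z \<noteq> 0}"] by auto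
  then show "\<phi> z = 0" using assms(2) by blast
  have "(\<phi> has_derivative (\<lambda>v. 0)) (at z)"
    by (rule has_derivative_0_off_closed[OF closed_closure _ assms(2)]) (use 0 in blast)
  then show "hgrad \<phi> z = 0"
    by (simp add: hgrad_eq_horizontal_part horizontal_part_def vec_eq_iff prod_eq_iff zero_vec_def)
qed

lemma C1_0_zero_outside:
  assumes "\<phi> \<in> C1_0 V" "z \<notin> V"
  shows "\<phi> z = 0" "hgrad \<phi> z = 0"
proof -
  have "z \<notin> closure {z. \<phi> z \<noteq> 0}" using assms by (auto simp: C1_0_def compact_support_in_def)
  from C1_0_zero[OF assms(1) this] show "\<phi> z = 0" "hgrad \<phi> z = 0" .
qed

lemma compactly_supported_bounded:
  fixes f :: "'a::euclidean_space \<Rightarrow> 'b::real_normed_vector"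
  assumes "compact K" "continuous_on UNIV f" "\<And>z. z \<notin> K \<Longrightarrow> f z = 0"
  obtains B where "B > 0" "\<And>z. norm (f z) \<le> B"
proof -
  have "bounded (f ` K)"
    using assms compact_continuous_image continuous_on_subset compact_imp_bounded by blast
  then obtain B where "B > 0" "\<And>z. z \<in> K \<Longrightarrow> norm (f z) \<le> B"
    unfolding bounded_pos by auto
  with that[of B] assms(3) show ?thesis by (metis norm_zero less_imp_le)
qed

lemma C1_0_bounded:
  assumes "open V" "\<phi> \<in> C1_0 V"
  obtains B where "B > 0" "\<And>z. \<bar>\<phi> z\<bar> \<le> B" "\<And>z. norm (hgrad \<phi> z) \<le> B"
proof -
  let ?K = "closure {z. \<phi> z \<noteq> 0}"
  have C: "Ck_on 1 UNIV \<phi>" "compact ?K"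
    using C1_0_Ck_on_UNIV[OF assms] assms by (auto simp: C1_0_def compact_support_in_def)
  obtain B1 where "B1 > 0" "\<And>z. norm (\<phi> z) \<le> B1"
    using compactly_supported_bounded[OF C(2) Ck_on_1_continuous[OF C(1)]] C1_0_zero[OF assms(2)] by metis
  moreover obtain B2 where "B2 > 0" "\<And>z. norm (hgrad \<phi> z) \<le> B2"
    using compactly_supported_bounded[OF C(2) continuous_on_hgrad[OF C(1)]] C1_0_zero[OF assms(2)] by metis
  ultimately show ?thesis using that[of "max B1 B2"] by (simp add: le_max_iff_disj)
qed

section \<open>The flux \<open>|G|\<^sup>p\<^sup>-\<^sup>2 G\<close>\<close>

definition p_flux :: "real \<Rightarrow> 'a::real_normed_vector \<Rightarrow> 'a" where
  "p_flux p G = norm G powr (p - 2) *\<^sub>R G"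

lemma powr_minus_two_mult: "0 \<le> x \<Longrightarrow> x powr (p - 2) * x = x powr (p - 1)" for x p :: real
  using powr_add[of x "p - 2" 1] by (cases "x = 0") (auto simp: algebra_simps)

lemma powr_minus_one_mult: "0 \<le> x \<Longrightarrow> x powr (p - 1) * x = x powr p" for x p :: real
  using powr_add[of x "p - 1" 1] by (cases "x = 0") (auto simp: algebra_simps)

lemma norm_p_flux: "norm (p_flux p G) = norm G powr (p - 1)"
  by (simp add: p_flux_def powr_minus_two_mult)

lemma p_flux_0 [simp]: "p_flux p 0 = 0"
  by (simp add: p_flux_def)

lemma p_flux_minus: "p_flux p (- G) = - p_flux p G"
  by (simp add: p_flux_def)

lemma p_flux_scale:
  assumes "c \<ge> 0"
  shows "p_flux p (c *\<^sub>R G) = c powr (p - 1) *\<^sub>R p_flux p G"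
  using assms by (simp add: p_flux_def powr_mult powr_minus_two_mult[symmetric] mult_ac)

text \<open>Strict monotonicity reduces, by the Cauchy-Schwarz inequality, to that of \<open>r \<mapsto> r\<^sup>p\<^sup>-\<^sup>1\<close>.\<close>

lemma p_flux_strict_mono:
  fixes a b :: "'a::real_inner"
  assumes "p > 1"
  shows p_flux_mono: "(p_flux p a - p_flux p b) \<bullet> (a - b) \<ge> 0"
    and p_flux_eq_if: "(p_flux p a - p_flux p b) \<bullet> (a - b) = 0 \<Longrightarrow> a = b"
proof -
  define r s where "r = norm a" and "s = norm b"
  have rs: "0 \<le> r" "0 \<le> s" by (auto simp: r_def s_def)
  have expand: "(p_flux p a - p_flux p b) \<bullet> (a - b) =
      r powr p + s powr p - (r powr (p - 2) + s powr (p - 2)) * (a \<bullet> b)"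
  proof -
    have "r powr (p - 2) * (a \<bullet> a) = r powr p" "s powr (p - 2) * (b \<bullet> b) = s powr p"
      using rs by (simp_all add: r_def s_def dot_square_norm power2_eq_square powr_minus_two_mult
          powr_minus_one_mult flip: mult.assoc)
    then show ?thesis
      by (simp add: p_flux_def r_def s_def inner_diff_left inner_diff_right algebra_simps inner_commute)
  qed
  have "(r powr (p - 2) + s powr (p - 2)) * (a \<bullet> b) \<le> (r powr (p - 2) + s powr (p - 2)) * (r * s)"
    using norm_cauchy_schwarz[of a b] by (intro mult_left_mono) (auto simp: r_def s_def)
  also have "\<dots> = r powr (p - 1) * s + s powr (p - 1) * r"
    using rs by (simp add: algebra_simps flip: powr_minus_two_mult)
  finally have lower: "(p_flux p a - p_flux p b) \<bullet> (a - b) \<ge> (r powr (p - 1) - s powr (p - 1)) * (r - s)"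
    using rs powr_minus_one_mult[of r p] powr_minus_one_mult[of s p]
    unfolding expand by (simp add: algebra_simps)
  have lt: "(r powr (p - 1) - s powr (p - 1)) * (r - s) > 0" if "r \<noteq> s"
    using that rs assms powr_less_mono2[of "p - 1" r s] powr_less_mono2[of "p - 1" s r]
    by (cases "r < s") (auto simp: mult_neg_neg mult_pos_pos)
  show "(p_flux p a - p_flux p b) \<bullet> (a - b) \<ge> 0"
    using lt lower by (cases "r = s") auto
  assume 0: "(p_flux p a - p_flux p b) \<bullet> (a - b) = 0"
  then have "r = s" using lt lower by fastforce
  then have "p_flux p a - p_flux p b = r powr (p - 2) *\<^sub>R (a - b)"
    by (simp add: p_flux_def r_def s_def scaleR_diff_right)
  then have "r powr (p - 2) * (norm (a - b))\<^sup>2 = 0"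
    using 0 by (simp add: dot_square_norm)
  then show "a = b" using \<open>r = s\<close> by (auto simp: r_def s_def)
qed

text \<open>
  This elementary inequality does the work of Hoelder's: split according to whether
  \<open>b \<le> \<epsilon> a\<close> or \<open>a < b / \<epsilon>\<close>.
\<close>

lemma powr_split_bound:
  fixes a b \<epsilon> p :: real
  assumes "0 \<le> a" "0 \<le> b" "0 < \<epsilon>" "p > 1"
  shows "a powr (p - 1) * b \<le> \<epsilon> * a powr p + \<epsilon> powr (1 - p) * b powr p"
proof (cases "b \<le> \<epsilon> * a")
  case True
  then have "a powr (p - 1) * b \<le> a powr (p - 1) * (\<epsilon> * a)"
    by (intro mult_left_mono) auto
  also have "\<dots> = \<epsilon> * a powr p"
    using powr_minus_one_mult[OF assms(1), of p] by simp
  finally show ?thesis by (smt (verit) mult_nonneg_nonneg powr_ge_zero)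
next
  case False
  then have "a \<le> b / \<epsilon>" using assms by (simp add: field_simps)
  then have "a powr (p - 1) * b \<le> (b / \<epsilon>) powr (p - 1) * b"
    using assms by (intro mult_right_mono powr_mono2) auto
  also have "\<dots> = \<epsilon> powr (1 - p) * b powr p"
    using assms powr_minus_one_mult[OF assms(2), of p]
    by (simp add: powr_divide powr_minus_divide[of \<epsilon> "p - 1", simplified] field_simps)
  finally show ?thesis using assms by (smt (verit) mult_nonneg_nonneg powr_ge_zero)
qed

lemma norm_add_powr_le:
  fixes a b :: "'a::real_normed_vector"
  assumes "p > 0"
  shows "norm (a + b) powr p \<le> 2 powr p * (norm a powr p + norm b powr p)"
proof -
  have "norm (a + b) \<le> 2 * max (norm a) (norm b)"
    using norm_triangle_ineq[of a b] by linarith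
  then have "norm (a + b) powr p \<le> (2 * max (norm a) (norm b)) powr p"
    using assms by (intro powr_mono2) auto
  also have "\<dots> = 2 powr p * max (norm a) (norm b) powr p"
    by (simp add: powr_mult)
  also have "\<dots> \<le> 2 powr p * (norm a powr p + norm b powr p)"
    by (intro mult_left_mono) (auto simp: max_def)
  finally show ?thesis .
qed

section \<open>Limits of integrals against a flux\<close>

text \<open>In the bound \<open>a\<^sup>p\<^sup>-\<^sup>1 h \<le> \<epsilon> a\<^sup>p + \<epsilon>\<^sup>1\<^sup>-\<^sup>p h\<^sup>p\<close> let first \<open>h\<close> and then \<open>\<epsilon>\<close> tend to \<open>0\<close>.\<close>

lemma weighted_nn_integral_tendsto_0:
  fixes a :: "'a \<Rightarrow> real" and h :: "nat \<Rightarrow> 'a \<Rightarrow> real"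
  assumes p: "p > 1"
    and [measurable]: "a \<in> borel_measurable M" "\<And>k. h k \<in> borel_measurable M"
    and nn: "\<And>z. 0 \<le> a z" "\<And>k z. 0 \<le> h k z"
    and fin: "(\<integral>\<^sup>+z. a z powr p \<partial>M) < \<infinity>"
    and lim: "(\<lambda>k. \<integral>\<^sup>+z. h k z powr p \<partial>M) \<longlonglongrightarrow> 0"
  shows "(\<lambda>k. \<integral>\<^sup>+z. a z powr (p - 1) * h k z \<partial>M) \<longlonglongrightarrow> 0"
proof (rule order_tendstoI)
  fix e :: ennreal assume "0 < e"
  then obtain e' where e': "0 < e'" "e' < e" using dense by blast
  then obtain d where d: "e' = ennreal d" "d > 0"
    by (cases e' rule: ennreal_cases) (auto simp: ennreal_zero_less_top)
  obtain I where I: "(\<integral>\<^sup>+z. a z powr p \<partial>M) = ennreal I" "I \<ge> 0"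
    using fin by (cases "\<integral>\<^sup>+z. a z powr p \<partial>M" rule: ennreal_cases) auto
  define \<epsilon> where "\<epsilon> = d / (2 * (I + 1))"
  have \<epsilon>: "\<epsilon> > 0" using d I by (simp add: \<epsilon>_def)
  define C where "C = \<epsilon> powr (1 - p)"
  have C: "C > 0" using \<epsilon> by (simp add: C_def)
  have ev: "\<forall>\<^sub>F k in sequentially. (\<integral>\<^sup>+z. h k z powr p \<partial>M) < ennreal (d / (2 * C))"
    using lim d C by (intro order_tendstoD(2)) (auto simp: ennreal_zero_less_top)
  have bound: "(\<integral>\<^sup>+z. a z powr (p - 1) * h k z \<partial>M) \<le> ennreal \<epsilon> * I + ennreal C * (\<integral>\<^sup>+z. h k z powr p \<partial>M)" for k
  proof -
    have "(\<integral>\<^sup>+z. a z powr (p - 1) * h k z \<partial>M) \<le> (\<integral>\<^sup>+z. ennreal \<epsilon> * a z powr p + ennreal C * h k z powr p \<partial>M)"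
    proof (rule nn_integral_mono)
      fix z
      have "a z powr (p - 1) * h k z \<le> \<epsilon> * a z powr p + C * h k z powr p"
        unfolding C_def by (rule powr_split_bound) (use nn \<epsilon> p in auto)
      then have "ennreal (a z powr (p - 1) * h k z) \<le> ennreal (\<epsilon> * a z powr p + C * h k z powr p)"
        by (rule ennreal_leI)
      then show "ennreal (a z powr (p - 1) * h k z) \<le> ennreal \<epsilon> * a z powr p + ennreal C * h k z powr p"
        using \<epsilon> C by (simp add: ennreal_mult ennreal_plus)
    qed
    then show ?thesis by (simp add: nn_integral_add nn_integral_cmult I)
  qed
  have "ennreal \<epsilon> * I + ennreal C * x < e" if "x < ennreal (d / (2 * C))" for x
  proof -
    have "ennreal C * x \<le> ennreal C * ennreal (d / (2 * C))"
      using that by (intro mult_left_mono) auto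
    also have "\<dots> = ennreal (d / 2)" using C d by (simp flip: ennreal_mult)
    finally have "ennreal \<epsilon> * I + ennreal C * x \<le> ennreal \<epsilon> * I + ennreal (d / 2)"
      by (intro add_left_mono)
    also have "\<dots> = ennreal (\<epsilon> * I + d / 2)"
      using \<epsilon> I d by (simp add: ennreal_mult ennreal_plus)
    also have "\<dots> \<le> ennreal d"
      using d I by (intro ennreal_leI) (simp add: \<epsilon>_def field_simps)
    finally show ?thesis using e' d by simp
  qed
  then have "(\<integral>\<^sup>+z. a z powr (p - 1) * h k z \<partial>M) < e"
    if "(\<integral>\<^sup>+z. h k z powr p \<partial>M) < ennreal (d / (2 * C))" for k
    using bound[of k] that le_less_trans by blast
  then show "\<forall>\<^sub>F k in sequentially. (\<integral>\<^sup>+z. a z powr (p - 1) * h k z \<partial>M) < e"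
    by (rule eventually_mono[OF ev])
qed auto

lemma integrable_weighted:
  fixes a :: "'a \<Rightarrow> real" and g :: "'a \<Rightarrow> real"
  assumes p: "p > 1"
    and [measurable]: "a \<in> borel_measurable M" "g \<in> borel_measurable M"
    and nn: "\<And>z. 0 \<le> a z" "\<And>z. 0 \<le> g z"
    and int: "integrable M (\<lambda>z. a z powr p)" "integrable M (\<lambda>z. g z powr p)"
  shows "integrable M (\<lambda>z. a z powr (p - 1) * g z)"
proof (rule Bochner_Integration.integrable_bound)
  show "integrable M (\<lambda>z. a z powr p + g z powr p)" using int by simp
  show "AE z in M. norm (a z powr (p - 1) * g z) \<le> norm (a z powr p + g z powr p)"
    using powr_split_bound[OF nn(1) nn(2) _ p, of 1] nn by (auto simp: abs_mult)
qed measurable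

text \<open>
  Write \<open>q\<^sub>k H\<^sub>k - Q G = q\<^sub>k (H\<^sub>k - G) + (q\<^sub>k - Q) G\<close>.  The first term is small in \<open>L\<^sup>p\<close>, and the second tends
  to \<open>0\<close> almost everywhere under a fixed bound.  The field \<open>Y\<close> will be either the flux of one of the
  two functions compared, or a bounded field.
\<close>

lemma flux_integral_tendsto:
  fixes Y G :: "'a \<Rightarrow> 'b::euclidean_space" and H :: "nat \<Rightarrow> 'a \<Rightarrow> 'b"
    and q :: "nat \<Rightarrow> 'a \<Rightarrow> real"
  assumes p: "p > 1"
    and a[measurable]: "a \<in> borel_measurable M" and a0: "\<And>z. 0 \<le> a z"
    and ai: "integrable M (\<lambda>z. a z powr p)"
    and [measurable]: "Y \<in> borel_measurable M" and Y: "\<And>z. z \<in> space M \<Longrightarrow> norm (Y z) \<le> C * a z powr (p - 1)" 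
    and [measurable]: "G \<in> borel_measurable M" "\<And>k. H k \<in> borel_measurable M"
    and Gi: "integrable M (\<lambda>z. norm (G z) powr p)"
    and Hi: "\<And>k. integrable M (\<lambda>z. norm (H k z - G z) powr p)"
    and lim: "(\<lambda>k. \<integral>\<^sup>+z. norm (H k z - G z) powr p \<partial>M) \<longlonglongrightarrow> 0"
    and [measurable]: "\<And>k. q k \<in> borel_measurable M" "Q \<in> borel_measurable M"
    and qB: "\<And>k z. \<bar>q k z\<bar> \<le> B" and q: "AE z in M. (\<lambda>k. q k z) \<longlonglongrightarrow> Q z"
  shows "(\<lambda>k. \<integral>z. Y z \<bullet> (q k z *\<^sub>R H k z) \<partial>M) \<longlonglongrightarrow> (\<integral>z. Y z \<bullet> (Q z *\<^sub>R G z) \<partial>M)"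
    and "integrable M (\<lambda>z. Y z \<bullet> (q k z *\<^sub>R H k z))"
    and "integrable M (\<lambda>z. Y z \<bullet> (Q z *\<^sub>R G z))"
proof -
  have B0: "0 \<le> B" using qB[of 0 undefined] by linarith
  have QB: "AE z in M. \<bar>Q z\<bar> \<le> B"
    using q
  proof eventually_elim
    case (elim z)
    then have "(\<lambda>k. \<bar>q k z\<bar>) \<longlonglongrightarrow> \<bar>Q z\<bar>" by (rule tendsto_rabs)
    then show ?case by (rule LIMSEQ_le_const2) (use qB in auto)
  qed
  have Yle: "norm (Y z \<bullet> (c *\<^sub>R h)) \<le> norm (B * C * (a z powr (p - 1) * norm h))"
    if "z \<in> space M" "\<bar>c\<bar> \<le> B" for z c h
  proof -
    have "\<bar>c\<bar> * \<bar>Y z \<bullet> h\<bar> \<le> B * (norm (Y z) * norm h)"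
      using that(2) B0 by (intro mult_mono Cauchy_Schwarz_ineq2) auto
    also have "\<dots> \<le> B * (C * a z powr (p - 1) * norm h)"
      using B0 Y[OF that(1)] by (intro mult_left_mono mult_right_mono) auto
    also have "\<dots> \<le> \<bar>\<dots>\<bar>" by (rule abs_ge_self)
    finally show ?thesis by (simp add: abs_mult mult_ac)
  qed
  have i1: "integrable M (\<lambda>z. Y z \<bullet> (c z *\<^sub>R h z))"
    if [measurable]: "c \<in> borel_measurable M" "h \<in> borel_measurable M"
      and c: "AE z in M. \<bar>c z\<bar> \<le> B" and h: "integrable M (\<lambda>z. norm (h z) powr p)" for c h
  proof (rule Bochner_Integration.integrable_bound)
    show "integrable M (\<lambda>z. B * C * (a z powr (p - 1) * norm (h z)))"
      by (intro integrable_mult_right integrable_weighted p a0 ai h) auto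
    show "AE z in M. norm (Y z \<bullet> (c z *\<^sub>R h z)) \<le> norm (B * C * (a z powr (p - 1) * norm (h z)))"
      using c AE_space by eventually_elim (use Yle in auto)
  qed measurable
  show QG: "integrable M (\<lambda>z. Y z \<bullet> (Q z *\<^sub>R G z))"
    by (rule i1) (use QB Gi in auto)
  have qD: "integrable M (\<lambda>z. Y z \<bullet> (q k z *\<^sub>R (H k z - G z)))" for k
    by (rule i1) (use qB Hi in auto)
  have qG: "integrable M (\<lambda>z. Y z \<bullet> (q k z *\<^sub>R G z))" for k
    by (rule i1) (use qB Gi in auto)
  have split: "Y z \<bullet> (q k z *\<^sub>R H k z) = Y z \<bullet> (q k z *\<^sub>R (H k z - G z)) + Y z \<bullet> (q k z *\<^sub>R G z)" for k z
    by (simp add: inner_diff_right algebra_simps)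
  show "integrable M (\<lambda>z. Y z \<bullet> (q k z *\<^sub>R H k z))"
    unfolding split using qD qG by simp
  have "(\<lambda>k. \<integral>z. Y z \<bullet> (q k z *\<^sub>R (H k z - G z)) \<partial>M) \<longlonglongrightarrow> 0"
  proof (rule Lim_null_comparison)
    have "(\<lambda>k. \<integral>\<^sup>+z. a z powr (p - 1) * norm (H k z - G z) \<partial>M) \<longlonglongrightarrow> 0"
      using ai a0 lim by (intro weighted_nn_integral_tendsto_0 p)
        (auto simp: integrable_iff_bounded)
    then have "(\<lambda>k. enn2real (\<integral>\<^sup>+z. a z powr (p - 1) * norm (H k z - G z) \<partial>M)) \<longlonglongrightarrow> enn2real 0"
      by (intro tendsto_enn2real) auto
    then have "(\<lambda>k. \<integral>z. a z powr (p - 1) * norm (H k z - G z) \<partial>M) \<longlonglongrightarrow> 0"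
      by (subst integral_eq_nn_integral) (auto simp: a0)
    then show "(\<lambda>k. \<bar>B * C\<bar> * (\<integral>z. a z powr (p - 1) * norm (H k z - G z) \<partial>M)) \<longlonglongrightarrow> 0"
      by (rule tendsto_mult_right_zero)
    show "\<forall>\<^sub>F k in sequentially. norm (\<integral>z. Y z \<bullet> (q k z *\<^sub>R (H k z - G z)) \<partial>M)
        \<le> \<bar>B * C\<bar> * (\<integral>z. a z powr (p - 1) * norm (H k z - G z) \<partial>M)"
    proof (rule always_eventually, rule allI)
      fix k
      have i: "integrable M (\<lambda>z. a z powr (p - 1) * norm (H k z - G z))"
        by (intro integrable_weighted p a0 ai Hi) auto
      have "norm (\<integral>z. Y z \<bullet> (q k z *\<^sub>R (H k z - G z)) \<partial>M)
          \<le> (\<integral>z. \<bar>B * C\<bar> * (a z powr (p - 1) * norm (H k z - G z)) \<partial>M)"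
      proof (rule order_trans[OF Bochner_Integration.integral_norm_bound], rule integral_mono)
        show "integrable M (\<lambda>z. norm (Y z \<bullet> (q k z *\<^sub>R (H k z - G z))))"
          using qD by (rule integrable_norm)
        fix z assume "z \<in> space M"
        from Yle[OF this qB, where h = "H k z - G z"]
        show "norm (Y z \<bullet> (q k z *\<^sub>R (H k z - G z))) \<le> \<bar>B * C\<bar> * (a z powr (p - 1) * norm (H k z - G z))"
          by (simp add: abs_mult a0 mult_ac)
      qed (use i in auto)
      then show "norm (\<integral>z. Y z \<bullet> (q k z *\<^sub>R (H k z - G z)) \<partial>M)
          \<le> \<bar>B * C\<bar> * (\<integral>z. a z powr (p - 1) * norm (H k z - G z) \<partial>M)" by simp
    qed
  qed
  moreover have "(\<lambda>k. \<integral>z. Y z \<bullet> (q k z *\<^sub>R G z) \<partial>M) \<longlonglongrightarrow> (\<integral>z. Y z \<bullet> (Q z *\<^sub>R G z) \<partial>M)"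
  proof (rule integral_dominated_convergence)
    show "integrable M (\<lambda>z. \<bar>B * C\<bar> * (a z powr (p - 1) * norm (G z)))"
      by (intro integrable_mult_right integrable_weighted p a0 ai Gi) auto
    show "AE z in M. (\<lambda>k. Y z \<bullet> (q k z *\<^sub>R G z)) \<longlonglongrightarrow> Y z \<bullet> (Q z *\<^sub>R G z)"
      using q by eventually_elim (intro tendsto_intros)
    show "AE z in M. norm (Y z \<bullet> (q k z *\<^sub>R G z)) \<le> \<bar>B * C\<bar> * (a z powr (p - 1) * norm (G z))" for k
      using AE_space
    proof eventually_elim
      case (elim z)
      from Yle[OF this qB, where h = "G z"] show ?case by (simp add: abs_mult a0 mult_ac)
    qed
  qed auto
  ultimately show "(\<lambda>k. \<integral>z. Y z \<bullet> (q k z *\<^sub>R H k z) \<partial>M) \<longlonglongrightarrow> (\<integral>z. Y z \<bullet> (Q z *\<^sub>R G z) \<partial>M)"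
    unfolding split using tendsto_add qD qG by fastforce
qed

section \<open>Integration by parts\<close>

lemma C1_0E:
  assumes "\<phi> \<in> C1_0 V"
  obtains K where "compact K" "K \<subseteq> V" "\<And>z. z \<notin> K \<Longrightarrow> \<phi> z = 0" "\<And>z. z \<notin> K \<Longrightarrow> hgrad \<phi> z = 0"
  using that[of "closure {z. \<phi> z \<noteq> 0}"] C1_0_zero[OF assms] assms
  unfolding C1_0_def compact_support_in_def by blast

lemma integrable_on_open_compact_support:
  fixes f :: "'a::euclidean_space \<Rightarrow> real"
  assumes "open V" "compact C" "C \<subseteq> V" "continuous_on V f" "\<And>z. z \<in> V - C \<Longrightarrow> f z = 0"
  shows "integrable (lebesgue_on V) f"
proof -
  have V: "V \<in> sets lebesgue" using assms(1) by auto
  have [measurable]: "f \<in> borel_measurable (lebesgue_on V)"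
    using assms(4) V by (rule continuous_imp_measurable_on_sets_lebesgue)
  have C: "C \<in> lmeasurable" using assms(2) by (rule lmeasurable_compact)
  have "bounded (f ` C)"
    using assms compact_continuous_image continuous_on_subset compact_imp_bounded by blast
  then obtain B where B: "\<And>z. z \<in> C \<Longrightarrow> norm (f z) \<le> B"
    unfolding bounded_iff by auto
  have "emeasure (lebesgue_on V) C < \<infinity>"
    using C V assms(3) by (auto simp: emeasure_restrict_space fmeasurable_def)
  moreover have "C \<in> sets (lebesgue_on V)"
    using C V assms(3) by (auto simp: sets_restrict_space_iff fmeasurableD)
  ultimately have "integrable (lebesgue_on V) (\<lambda>z. B * indicator C z)" by simp
  then show ?thesis
  proof (rule Bochner_Integration.integrable_bound)
    have "norm (f z) \<le> norm (B * indicator C z)" if "z \<in> V" for z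
      using B[of z] assms(5)[of z] that by (cases "z \<in> C") auto
    then show "AE z in lebesgue_on V. norm (f z) \<le> norm (B * indicator C z)"
      by (auto simp: AE_restrict_space_iff V)
  qed measurable
qed

lemma integral_on_open_eq_lborel:
  fixes f :: "'a::euclidean_space \<Rightarrow> real"
  assumes "open V" "f \<in> borel_measurable borel" "\<And>z. z \<notin> V \<Longrightarrow> f z = 0"
  shows "integral\<^sup>L (lebesgue_on V) f = integral\<^sup>L lborel f"
proof -
  have "integral\<^sup>L (lebesgue_on V) f = integral\<^sup>L lebesgue (\<lambda>z. indicator V z *\<^sub>R f z)"
    using assms(1) by (intro integral_restrict_space) auto
  also have "(\<lambda>z. indicator V z *\<^sub>R f z) = f"
    using assms(3) by (auto simp: indicator_def fun_eq_iff)
  also have "integral\<^sup>L lebesgue f = integral\<^sup>L lborel f"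
    using assms(2) by (simp add: integral_completion)
  finally show ?thesis .
qed

text \<open>Translation invariance of Lebesgue measure, differentiated.\<close>

lemma integral_derivative_eq_0:
  fixes f :: "'a::euclidean_space \<Rightarrow> real"
  assumes f: "Ck_on 1 UNIV f" and K: "compact K" "\<And>z. z \<notin> K \<Longrightarrow> f z = 0"
  shows "(\<integral>z. frechet_derivative f (at z) b \<partial>lborel) = 0"
proof -
  define D where "D z = frechet_derivative f (at z) b" for z
  define s where "s k = 1 / real (Suc k)" for k
  have s: "0 < s k" "s k \<le> 1" for k by (auto simp: s_def)
  have s0: "s \<longlonglongrightarrow> 0" unfolding s_def[abs_def] by (rule LIMSEQ_Suc[OF lim_1_over_n])
  have cf: "continuous_on UNIV f" and cD: "continuous_on UNIV D"
    unfolding D_def[abs_def]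
    by (rule Ck_on_1_continuous[OF f], rule Ck_on_1_continuous_derivative[OF f continuous_on_const])
  have [measurable]: "f \<in> borel_measurable borel" "D \<in> borel_measurable borel"
    using cf cD by (auto intro: borel_measurable_continuous_onI)
  have int_f: "integrable lborel f"
  proof -
    have "integrable lborel (\<lambda>z. indicator K z *\<^sub>R f z)"
      using borel_integrable_compact[OF K(1) continuous_on_subset[OF cf subset_UNIV]] by simp
    moreover have "(\<lambda>z. indicator K z *\<^sub>R f z) = f" using K(2) by (auto simp: fun_eq_iff indicator_def)
    ultimately show ?thesis by simp
  qed
  have line: "((\<lambda>r. f (z + r *\<^sub>R b)) has_real_derivative D (z + r *\<^sub>R b)) (at r)" for z r
  proof -
    let ?L = "frechet_derivative f (at (z + r *\<^sub>R b))"
    have L: "(f has_derivative ?L) (at (z + r *\<^sub>R b))"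
      using Ck_on_1_differentiable[OF f] by simp
    have "((\<lambda>r. z + r *\<^sub>R b) has_derivative (\<lambda>h. h *\<^sub>R b)) (at r)"
      by (auto intro!: derivative_eq_intros)
    from has_derivative_compose[OF this L]
    have "((\<lambda>r. f (z + r *\<^sub>R b)) has_derivative (\<lambda>h. ?L (h *\<^sub>R b))) (at r)" .
    moreover have "?L (h *\<^sub>R b) = D (z + r *\<^sub>R b) * h" for h
      using has_derivative_linear[OF L] by (simp add: linear_cmul D_def)
    ultimately show ?thesis by (simp add: has_field_derivative_def)
  qed
  obtain R where R: "K \<subseteq> cball 0 R"
    using compact_imp_bounded[OF K(1)] by (auto simp: bounded_iff subset_iff)
  have D0: "D z = 0" if "norm z > R" for z
  proof -
    have "(f has_derivative (\<lambda>v. 0)) (at z)"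
      by (rule has_derivative_0_off_closed[OF closed_cball[of 0 R]])
        (use that R K(2) in \<open>auto simp: subset_iff\<close>)
    then show ?thesis using frechet_derivative_at unfolding D_def by metis
  qed
  obtain B where B: "\<And>z. norm (D z) \<le> B"
  proof (rule compactly_supported_bounded[OF compact_cball cD])
    show "D z = 0" if "z \<notin> cball 0 R" for z using that by (intro D0) (simp add: not_le)
  qed blast
  define d where "d k z = (f (z + s k *\<^sub>R b) - f z) / s k" for k z
  have d_mvt: "\<exists>r. 0 < r \<and> r < s k \<and> d k z = D (z + r *\<^sub>R b)" for k z
  proof -
    obtain r where "0 < r" "r < s k"
      "f (z + s k *\<^sub>R b) - f (z + 0 *\<^sub>R b) = (s k - 0) * D (z + r *\<^sub>R b)"
      using MVT2[of 0 "s k" "\<lambda>r. f (z + r *\<^sub>R b)" "\<lambda>r. D (z + r *\<^sub>R b)"] s line by blast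
    then show ?thesis using s[of k] by (auto simp: d_def intro!: exI[of _ r])
  qed
  have d_bound: "norm (d k z) \<le> B * indicator (cball 0 (R + norm b)) z" for k z
  proof -
    obtain r where r: "0 < r" "r < s k" "d k z = D (z + r *\<^sub>R b)" using d_mvt by blast
    have B0: "0 \<le> B" using B[of 0] norm_ge_zero order_trans by blast
    show ?thesis
    proof (cases "z \<in> cball 0 (R + norm b)")
      case True then show ?thesis using B r by simp
    next
      case False
      have "norm (r *\<^sub>R b) \<le> norm b" using r s[of k] by (simp add: mult_left_le_one_le)
      then have "norm (z + r *\<^sub>R b) > R"
        using False norm_diff_ineq[of z "r *\<^sub>R b"] by simp
      then show ?thesis using D0 r B0 by simp
    qed
  qed
  have "(\<lambda>k. integral\<^sup>L lborel (d k)) \<longlonglongrightarrow> integral\<^sup>L lborel D"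
  proof (rule integral_dominated_convergence)
    show "integrable lborel (\<lambda>z::'a. B * indicator (cball 0 (R + norm b)) z)"
      using emeasure_lborel_cball_finite[of "0::'a" "R + norm b"]
      by (intro integrable_mult_right integrable_real_indicator) auto
    show "AE z in lborel. norm (d k z) \<le> B * indicator (cball 0 (R + norm b)) z" for k
      using d_bound by simp
    have "(\<lambda>k. d k z) \<longlonglongrightarrow> D z" for z
    proof -
      have "(\<lambda>h. (f (z + (0 + h) *\<^sub>R b) - f (z + 0 *\<^sub>R b)) / h) \<midarrow>0\<rightarrow> D (z + 0 *\<^sub>R b)"
        using line[of z 0] by (simp add: DERIV_def)
      then have lim: "(\<lambda>h. (f (z + h *\<^sub>R b) - f z) / h) \<midarrow>0\<rightarrow> D z" by simp
      have "(\<forall>n. s n \<noteq> 0) \<and> s \<longlonglongrightarrow> 0" using s s0 by (simp add: less_imp_neq[symmetric])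
      then show ?thesis
        unfolding d_def by (rule LIMSEQ_SEQ_conv[THEN iffD2, OF lim, THEN spec, THEN mp])
    qed
    then show "AE z in lborel. (\<lambda>k. d k z) \<longlonglongrightarrow> D z" by simp
  qed (unfold d_def, measurable)
  moreover have "integral\<^sup>L lborel (d k) = 0" for k
  proof -
    have eq: "integral\<^sup>L lborel (\<lambda>z. f (z + c)) = integral\<^sup>L lborel f"
      and int: "integrable lborel (\<lambda>z. f (z + c))" for c
    proof -
      have "lborel = distr lborel borel ((+) c)" by (simp add: lborel_distr_plus)
      then show "integral\<^sup>L lborel (\<lambda>z. f (z + c)) = integral\<^sup>L lborel f"
        using integral_distr[of "(+) c" lborel borel f] by (simp add: add.commute)
      show "integrable lborel (\<lambda>z. f (z + c))"
        using int_f integrable_distr_eq[of "(+) c" lborel borel f] by (simp add: add.commute lborel_distr_plus)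
    qed
    have "integral\<^sup>L lborel (d k) = (integral\<^sup>L lborel (\<lambda>z. f (z + s k *\<^sub>R b)) - integral\<^sup>L lborel f) / s k"
      unfolding d_def using int int_f by (simp add: Bochner_Integration.integral_diff)
    then show ?thesis by (simp add: eq)
  qed
  ultimately show ?thesis
    by (simp add: D_def[abs_def] LIMSEQ_const_iff)
qed

text \<open>The coefficient of \<open>\<partial>\<^sub>t\<close> in each horizontal field does not depend on \<open>t\<close>.\<close>

lemma integral_horizontal_derivative_eq_0:
  fixes f :: "'n::finite heis \<Rightarrow> real"
  assumes f: "f \<in> C1_0 UNIV"
  shows "integral\<^sup>L lborel (Xder i f) = 0" and "integral\<^sup>L lborel (Yder i f) = 0"
proof -
  obtain K where K: "compact K" and f0: "\<And>z. z \<notin> K \<Longrightarrow> f z = 0"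
    using C1_0E[OF f] by metis
  have C: "Ck_on 1 UNIV f" using f by (simp add: C1_0_def)
  have key: "(\<integral>z. frechet_derivative f (at z) (b + c z *\<^sub>R (0, 0, 1)) \<partial>lborel) = 0"
    if c: "bounded_linear c" "c (0, 0, 1) = 0" for b and c :: "'n heis \<Rightarrow> real"
  proof -
    let ?e = "(0, 0, 1) :: 'n heis"
    define g where "g z = c z * f z" for z
    have D: "(f has_derivative frechet_derivative f (at z)) (at z)" for z
      using Ck_on_1_differentiable[OF C] by simp
    have Dc: "(c has_derivative c) (at z)" for z
      by (rule bounded_linear_imp_has_derivative[OF c(1)])
    have Dg: "(g has_derivative (\<lambda>v. c z * frechet_derivative f (at z) v + c v * f z)) (at z)" for z
      unfolding g_def using has_derivative_mult[OF Dc D] .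
    have cc_const: "continuous_on UNIV (\<lambda>z::'n heis. c v)" for v by simp
    have Cg: "Ck_on 1 UNIV g"
      using Ck_on_1_mult[OF Ck_on_1I[OF Dc cc_const] C] by (simp only: g_def[abs_def])
    have eq: "frechet_derivative f (at z) (b + c z *\<^sub>R ?e) =
        frechet_derivative f (at z) b + frechet_derivative g (at z) ?e" for z
    proof -
      have "frechet_derivative g (at z) ?e = c z * frechet_derivative f (at z) ?e"
        using fun_cong[OF frechet_derivative_at[OF Dg[of z]], of ?e] c(2) by simp
      then show ?thesis
        using has_derivative_linear[OF D, of z]
        by (simp only: linear_add linear_cmul real_scaleR_def)
    qed
    have i: "integrable lborel (\<lambda>z. frechet_derivative h (at z) v)"
      if h: "Ck_on 1 UNIV h" "\<And>z. z \<notin> K \<Longrightarrow> h z = 0" for h and v :: "'n heis"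
    proof -
      have cD: "continuous_on UNIV (\<lambda>z. frechet_derivative h (at z) v)"
        by (rule Ck_on_1_continuous_derivative[OF h(1) continuous_on_const])
      have "frechet_derivative h (at z) v = 0" if "z \<notin> K" for z
      proof -
        have "(h has_derivative (\<lambda>v. 0)) (at z)"
          by (rule has_derivative_0_off_closed[OF compact_imp_closed[OF K] h(2) that])
        then show ?thesis using frechet_derivative_at by metis
      qed
      then have "(\<lambda>z. indicator K z *\<^sub>R frechet_derivative h (at z) v) = (\<lambda>z. frechet_derivative h (at z) v)"
        by (auto simp: fun_eq_iff indicator_def)
      then show ?thesis
        using borel_integrable_compact[OF K continuous_on_subset[OF cD subset_UNIV]] by simp
    qed
    have "(\<integral>z. frechet_derivative f (at z) (b + c z *\<^sub>R ?e) \<partial>lborel) =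
        (\<integral>z. frechet_derivative f (at z) b \<partial>lborel) + (\<integral>z. frechet_derivative g (at z) ?e \<partial>lborel)"
      unfolding eq using f0 by (intro Bochner_Integration.integral_add i C Cg) (auto simp: g_def)
    also have "\<dots> = 0"
      using integral_derivative_eq_0[OF C K f0] integral_derivative_eq_0[OF Cg K] f0
      by (simp add: g_def)
    finally show ?thesis .
  qed
  have bl: "bounded_linear (\<lambda>z::'n heis. 2 * fst (snd z) $ i)" "bounded_linear (\<lambda>z::'n heis. - (2 * fst z $ i))"
    by (rule bounded_linear_const_mult[OF bounded_linear_compose[OF bounded_linear_vec_nth
            bounded_linear_compose[OF bounded_linear_fst bounded_linear_snd]]]
        bounded_linear_minus[OF bounded_linear_const_mult[OF bounded_linear_compose[OF
            bounded_linear_vec_nth bounded_linear_fst]]])+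
  have "Xder i f = (\<lambda>z. frechet_derivative f (at z) ((axis i 1, 0, 0) + (2 * fst (snd z) $ i) *\<^sub>R (0, 0, 1)))"
    "Yder i f = (\<lambda>z. frechet_derivative f (at z) ((0, axis i 1, 0) + (- (2 * fst z $ i)) *\<^sub>R (0, 0, 1)))"
    by (auto simp: fun_eq_iff Xder_def Yder_def)
  then show "integral\<^sup>L lborel (Xder i f) = 0" "integral\<^sup>L lborel (Yder i f) = 0"
    using key[OF bl(1), of "(axis i 1, 0, 0)"] key[OF bl(2), of "(0, axis i 1, 0)"] by simp_all
qed

lemma hgrad_cong_open:
  assumes "open V" "z \<in> V" "f differentiable (at z)" "\<And>w. w \<in> V \<Longrightarrow> f w = g w"
  shows "hgrad g z = hgrad f z"
proof -
  have "(f has_derivative frechet_derivative f (at z)) (at z)"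
    using assms(3) frechet_derivative_works by blast
  then have "(g has_derivative frechet_derivative f (at z)) (at z)"
    by (rule has_derivative_transform_within_open[OF _ assms(1,2)]) (use assms(4) in auto)
  from hgrad_eq_horizontal_part[OF this] show ?thesis
    by (simp only: hgrad_horizontal_part_frechet)
qed

lemma hgrad_nth:
  "fst (hgrad f z) $ i = Xder i f z" "snd (hgrad f z) $ i = Yder i f z"
  by (simp_all add: hgrad_def)

lemma hgrad_mult:
  assumes "f differentiable (at z)" "g differentiable (at z)"
  shows "hgrad (\<lambda>z. f z * g z) z = g z *\<^sub>R hgrad f z + f z *\<^sub>R hgrad g z"
proof -
  have "((\<lambda>z. f z * g z) has_derivative
      (\<lambda>v. g z * frechet_derivative f (at z) v + f z * frechet_derivative g (at z) v)) (at z)"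
    using has_derivative_mult[OF assms[unfolded frechet_derivative_works]]
    by (simp add: add.commute mult.commute)
  from hgrad_eq_horizontal_part[OF this] show ?thesis
    by (simp add: horizontal_part_add horizontal_part_scale hgrad_horizontal_part_frechet)
qed

text \<open>
  The horizontal derivatives of \<open>\<phi> g\<close> integrate to \<open>0\<close>.  Only linearity of \<open>D\<close> in the horizontal gradient matters, so both
  families of fields are treated at once.
\<close>

lemma horizontal_integration_by_parts:
  fixes \<phi> g :: "'n::finite heis \<Rightarrow> real"
  assumes V: "open V" and \<phi>: "\<phi> \<in> C1_0 V" and g: "Ck_on 1 V g"
    and D: "D \<in> range Xder \<union> range Yder"
  shows "integrable (lebesgue_on V) (\<lambda>z. g z * D \<phi> z)" 
    and "integrable (lebesgue_on V) (\<lambda>z. \<phi> z * D g z)"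
    and "(\<integral>z. g z * D \<phi> z \<partial>lebesgue_on V) = - (\<integral>z. \<phi> z * D g z \<partial>lebesgue_on V)"
proof -
  obtain K where K: "compact K" "K \<subseteq> V" and \<phi>0: "\<And>z. z \<notin> K \<Longrightarrow> \<phi> z = 0" "\<And>z. z \<notin> K \<Longrightarrow> hgrad \<phi> z = 0"
    using C1_0E[OF \<phi>] by metis
  obtain \<pi> :: "(real ^ 'n) \<times> (real ^ 'n) \<Rightarrow> real" where \<pi>: "\<And>f z. D f z = \<pi> (hgrad f z)" "bounded_linear \<pi>"
  proof -
    from D consider i where "D = Xder i" | i where "D = Yder i" by blast
    then show ?thesis
    proof cases
      case 1
      then show ?thesis
        by (intro that[of "\<lambda>v. fst v $ i"] bounded_linear_compose[OF bounded_linear_vec_nth]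
            bounded_linear_fst) (simp add: hgrad_nth)
    next
      case 2
      then show ?thesis
        by (intro that[of "\<lambda>v. snd v $ i"] bounded_linear_compose[OF bounded_linear_vec_nth]
            bounded_linear_snd) (simp add: hgrad_nth)
    qed
  qed
  interpret \<pi>: bounded_linear \<pi> by (rule \<pi>(2))
  have C\<phi>: "Ck_on 1 V \<phi>" using \<phi> by (simp add: C1_0_def)
  define h where "h z = (if z \<in> V then \<phi> z * g z else 0)" for z
  have h: "h \<in> C1_0 V"
    unfolding h_def
    using C1_0_restrictI[OF V K Ck_on_1_mult[OF C\<phi> g]] \<phi>0 by simp
  have dif: "\<phi> differentiable (at z)" "g differentiable (at z)" if "z \<in> V" for z
    using C\<phi> g that by auto
  have Dh: "D h z = g z * D \<phi> z + \<phi> z * D g z" if "z \<in> V" for z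
  proof -
    have "hgrad h z = hgrad (\<lambda>z. \<phi> z * g z) z"
      using dif that by (intro hgrad_cong_open[OF V that]) (auto simp: h_def)
    then show ?thesis using dif[OF that] 
      by (simp add: \<pi> hgrad_mult \<pi>.add \<pi>.scaleR)
  qed
  have cD: "continuous_on V (D f)" if "Ck_on 1 V f" for f
    unfolding \<pi>(1)[abs_def] by (rule \<pi>.continuous_on[OF continuous_on_hgrad[OF that]])
  note cont = continuous_on_mult[OF Ck_on_1_continuous cD]
  show i1: "integrable (lebesgue_on V) (\<lambda>z. g z * D \<phi> z)"
    using integrable_on_open_compact_support[OF V K cont[OF g C\<phi>]]
    by (simp add: \<pi> \<phi>0 \<pi>.zero)
  show i2: "integrable (lebesgue_on V) (\<lambda>z. \<phi> z * D g z)"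
    using integrable_on_open_compact_support[OF V K cont[OF C\<phi> g]]
    by (simp add: \<phi>0)
  have h': "h \<in> C1_0 UNIV" using C1_0_mono[OF V _ h] by simp
  have cDh: "continuous_on UNIV (D h)"
    unfolding \<pi>(1)[abs_def]
    by (rule \<pi>.continuous_on[OF continuous_on_hgrad[OF C1_0_Ck_on_UNIV[OF V h]]])
  have "integral\<^sup>L (lebesgue_on V) (D h) = integral\<^sup>L lborel (D h)"
    by (rule integral_on_open_eq_lborel[OF V])
      (auto intro!: borel_measurable_continuous_onI cDh simp: \<pi> C1_0_zero_outside(2)[OF h] \<pi>.zero)
  also have "\<dots> = 0"
    using D integral_horizontal_derivative_eq_0[OF h'] by auto
  finally have "0 = (\<integral>z. g z * D \<phi> z + \<phi> z * D g z \<partial>lebesgue_on V)"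
    using Bochner_Integration.integral_cong[OF refl, of "lebesgue_on V" "D h" "\<lambda>z. g z * D \<phi> z + \<phi> z * D g z"]
    by (simp add: Dh)
  also have "\<dots> = (\<integral>z. g z * D \<phi> z \<partial>lebesgue_on V) + (\<integral>z. \<phi> z * D g z \<partial>lebesgue_on V)"
    using i1 i2 by simp
  finally show "(\<integral>z. g z * D \<phi> z \<partial>lebesgue_on V) = - (\<integral>z. \<phi> z * D g z \<partial>lebesgue_on V)"
    by simp
qed

section \<open>The comparison principle\<close>

definition weak_subsolution where
  "weak_subsolution p V G \<longleftrightarrow> (\<forall>\<phi>\<in>C1_0 V. (\<forall>z. 0 \<le> \<phi> z) \<longrightarrow>
     (\<integral>z. p_flux p (G z) \<bullet> hgrad \<phi> z \<partial>lebesgue_on V) \<le> 0)"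

definition weak_supersolution where
  "weak_supersolution p V G \<longleftrightarrow> (\<forall>\<phi>\<in>C1_0 V. (\<forall>z. 0 \<le> \<phi> z) \<longrightarrow>
     (\<integral>z. p_flux p (G z) \<bullet> hgrad \<phi> z \<partial>lebesgue_on V) \<ge> 0)"

text \<open>
  Convergence of the gradients in \<open>L\<^sup>p\<close> and of the functions almost everywhere lets nonlinear
  \<open>C\<^sup>1\<close> functions of the approximants pass to the limit.
\<close>

definition sobolev_approx ::
    "real \<Rightarrow> 'n::finite heis set \<Rightarrow> (nat \<Rightarrow> 'n heis \<Rightarrow> real) \<Rightarrow> ('n heis \<Rightarrow> real) \<Rightarrow>
     ('n heis \<Rightarrow> (real ^ 'n) \<times> (real ^ 'n)) \<Rightarrow> bool" where
  "sobolev_approx p V F f G \<longleftrightarrow>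
     f \<in> borel_measurable (lebesgue_on V) \<and> G \<in> borel_measurable (lebesgue_on V) \<and>
     (\<forall>k. Ck_on 1 V (F k)) \<and>
     integrable (lebesgue_on V) (\<lambda>z. norm (G z) powr p) \<and>
     (\<forall>k. integrable (lebesgue_on V) (\<lambda>z. norm (hgrad (F k) z - G z) powr p)) \<and>
     (\<lambda>k. \<integral>\<^sup>+z. norm (hgrad (F k) z - G z) powr p \<partial>lebesgue_on V) \<longlonglongrightarrow> 0 \<and>
     (AE z in lebesgue_on V. (\<lambda>k. F k z) \<longlonglongrightarrow> f z)"

lemma measurable_hgrad:
  assumes "open V" "Ck_on 1 V f"
  shows "hgrad f \<in> borel_measurable (lebesgue_on V)"
  using assms by (intro continuous_imp_measurable_on_sets_lebesgue continuous_on_hgrad) auto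

lemma finite_measure_lebesgue_on_bounded:
  fixes V :: "'a::euclidean_space set"
  assumes "open V" "bounded V"
  shows "finite_measure (lebesgue_on V)"
proof
  have "V \<in> lmeasurable" using assms by (simp add: lmeasurable_open)
  then show "emeasure (lebesgue_on V) (space (lebesgue_on V)) \<noteq> \<infinity>"
    using assms by (auto simp: emeasure_restrict_space fmeasurable_def)
qed

lemma continuous_AE_0_imp_0:
  fixes f :: "'a::euclidean_space \<Rightarrow> real"
  assumes "open V" "continuous_on V f" "AE z in lebesgue_on V. f z = 0" "z \<in> V"
  shows "f z = 0"
proof (rule ccontr)
  assume "f z \<noteq> 0"
  define W where "W = {z\<in>V. f z \<noteq> 0}"
  have "W = V \<inter> f -` (- {0})" by (auto simp: W_def)
  then have "open W"
    using continuous_open_preimage[OF assms(2,1), of "- {0}"] by (simp add: open_Compl)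
  moreover have "W \<noteq> {}" using \<open>f z \<noteq> 0\<close> assms(4) by (auto simp: W_def)
  ultimately have "\<not> negligible W" by (rule open_not_negligible)
  moreover have "AE z in lebesgue. z \<in> V \<longrightarrow> f z = 0"
    using assms(1,3) by (simp add: AE_restrict_space_iff)
  then have "AE z in lebesgue. z \<notin> W" by (auto simp: W_def)
  then have "negligible W"
    using \<open>open W\<close> by (simp add: negligible_iff_null_sets AE_iff_null_sets)
  ultimately show False by simp
qed

text \<open>
  Testing both equations with \<open>P(f\<^sub>1, f\<^sub>2)\<close> gives, when \<open>\<partial>\<^sub>1P = - \<partial>\<^sub>2P \<ge> 0\<close> along \<open>(f\<^sub>1, f\<^sub>2)\<close>,
  the inequality \<open>\<integral> \<partial>\<^sub>1P \<langle>|G\<^sub>1|\<^sup>p\<^sup>-\<^sup>2 G\<^sub>1 - |G\<^sub>2|\<^sup>p\<^sup>-\<^sup>2 G\<^sub>2, G\<^sub>1 - G\<^sub>2\<rangle> \<le> 0\<close>, so that \<open>P(f\<^sub>1, f\<^sub>2)\<close> has vanishing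
  horizontal gradient.  It also has zero boundary values.  Since \<open>X\<^sub>i x\<^sub>i = 1\<close>, integration by
  parts turns its integral into that of \<open>- x\<^sub>i X\<^sub>i P(f\<^sub>1, f\<^sub>2)\<close>, which is \<open>0\<close>.
\<close>

lemma comparison_principle:
  fixes V :: "'n::finite heis set" and P :: "real \<Rightarrow> real \<Rightarrow> real"
  assumes p: "p > 1" and V: "open V" "bounded V"
    and a1: "sobolev_approx p V F1 f1 G1" and a2: "sobolev_approx p V F2 f2 G2"
    and c1: "continuous_on V f1" and c2: "continuous_on V f2"
    and sub: "weak_subsolution p V G1" and super: "weak_supersolution p V G2"
    and P: "\<And>s t. ((\<lambda>x. P (fst x) (snd x)) has_derivative (\<lambda>x. P1 s t * fst x + P2 s t * snd x)) (at (s, t))"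
    and cP: "continuous_on UNIV (\<lambda>x. P1 (fst x) (snd x))" "continuous_on UNIV (\<lambda>x. P2 (fst x) (snd x))"
    and bP: "\<And>s t. \<bar>P1 s t\<bar> \<le> B" "\<And>s t. \<bar>P2 s t\<bar> \<le> B" "\<And>s t. 0 \<le> P s t" "\<And>s t. P s t \<le> B"
    and supp: "\<And>k. \<exists>C. compact C \<and> C \<subseteq> V \<and> (\<forall>z\<in>V - C. P (F1 k z) (F2 k z) = 0)"
    and mono: "\<And>z. z \<in> V \<Longrightarrow> 0 \<le> P1 (f1 z) (f2 z) \<and> P2 (f1 z) (f2 z) = - P1 (f1 z) (f2 z)"
    and z: "z \<in> V"
  shows "P (f1 z) (f2 z) = 0"
proof -
  let ?M = "lebesgue_on V"
  have Vs: "V \<in> sets lebesgue" using V by auto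
  interpret finite_measure ?M by (rule finite_measure_lebesgue_on_bounded[OF V])
  have CP: "continuous_on UNIV (\<lambda>x. P (fst x) (snd x))"
  proof (rule continuous_at_imp_continuous_on, rule ballI)
    fix x :: "real \<times> real"
    show "isCont (\<lambda>x. P (fst x) (snd x)) x"
      using has_derivative_continuous[OF P[of "fst x" "snd x"]] by simp
  qed
  have F: "Ck_on 1 V (F1 k)" "Ck_on 1 V (F2 k)" for k
    using a1 a2 by (auto simp: sobolev_approx_def)
  have [measurable]: "f1 \<in> borel_measurable ?M" "f2 \<in> borel_measurable ?M"
    "G1 \<in> borel_measurable ?M" "G2 \<in> borel_measurable ?M"
    using a1 a2 by (auto simp: sobolev_approx_def)
  have [measurable]: "F1 k \<in> borel_measurable ?M" "F2 k \<in> borel_measurable ?M"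
    "hgrad (F1 k) \<in> borel_measurable ?M" "hgrad (F2 k) \<in> borel_measurable ?M" for k
    using F V by (auto intro: measurable_hgrad
        continuous_imp_measurable_on_sets_lebesgue[OF Ck_on_1_continuous] simp del: Ck_on.simps)
  have comp: "(\<lambda>z. R (u z) (v z)) \<in> borel_measurable ?M"
    if "continuous_on UNIV (\<lambda>x. R (fst x) (snd x))"
      and [measurable]: "u \<in> borel_measurable ?M" "v \<in> borel_measurable ?M"
    for R :: "real \<Rightarrow> real \<Rightarrow> real" and u v
  proof -
    have "(\<lambda>x. R (fst x) (snd x)) \<in> borel_measurable borel"
      using that(1) by (rule borel_measurable_continuous_onI)
    then have "(\<lambda>z. (\<lambda>x. R (fst x) (snd x)) (u z, v z)) \<in> borel_measurable ?M"
      by (rule measurable_compose_rev) measurable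
    then show ?thesis by simp
  qed
  have lim: "AE z in ?M. (\<lambda>k. R (F1 k z) (F2 k z)) \<longlonglongrightarrow> R (f1 z) (f2 z)"
    if "continuous_on UNIV (\<lambda>x. R (fst x) (snd x))" for R :: "real \<Rightarrow> real \<Rightarrow> real"
  proof -
    have "AE z in ?M. (\<lambda>k. F1 k z) \<longlonglongrightarrow> f1 z" "AE z in ?M. (\<lambda>k. F2 k z) \<longlonglongrightarrow> f2 z"
      using a1 a2 by (auto simp: sobolev_approx_def)
    then show ?thesis
    proof eventually_elim
      case (elim z)
      have "isCont (\<lambda>x. R (fst x) (snd x)) (f1 z, f2 z)"
        using that by (simp add: continuous_on_eq_continuous_at)
      from isCont_tendsto_compose[OF this tendsto_Pair[OF elim]] show ?case by simp
    qed
  qed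
  define w where "w k z = (if z \<in> V then P (F1 k z) (F2 k z) else 0)" for k z
  have w: "w k \<in> C1_0 V" for k
  proof -
    obtain C where "compact C" "C \<subseteq> V" "\<And>z. z \<in> V - C \<Longrightarrow> P (F1 k z) (F2 k z) = 0"
      using supp[of k] by blast
    then show ?thesis
      unfolding w_def[abs_def] by (intro C1_0_restrictI[OF V(1) _ _ Ck_on_1_compose2[OF P cP F]])
  qed
  have w0: "0 \<le> w k z" for k z using bP(3) by (simp add: w_def)
  define q1 q2 where "q1 k z = P1 (F1 k z) (F2 k z)" and "q2 k z = P2 (F1 k z) (F2 k z)" for k z
  define Q1 Q2 where "Q1 z = P1 (f1 z) (f2 z)" and "Q2 z = P2 (f1 z) (f2 z)" for z
  have [measurable]: "q1 k \<in> borel_measurable ?M" "q2 k \<in> borel_measurable ?M"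
    "Q1 \<in> borel_measurable ?M" "Q2 \<in> borel_measurable ?M" for k
    unfolding q1_def[abs_def] q2_def[abs_def] Q1_def[abs_def] Q2_def[abs_def]
    by (rule comp[OF cP(1)] comp[OF cP(2)]; measurable)+
  have hw: "hgrad (w k) z = q1 k z *\<^sub>R hgrad (F1 k) z + q2 k z *\<^sub>R hgrad (F2 k) z" if z: "z \<in> V" for k z
  proof -
    have "(\<lambda>z. P (F1 k z) (F2 k z)) differentiable (at z)"
      using Ck_on_1_differentiable[OF Ck_on_1_compose2[OF P cP F] z] differentiableI by blast
    then have "hgrad (w k) z = hgrad (\<lambda>z. P (F1 k z) (F2 k z)) z"
      by (intro hgrad_cong_open[OF V(1) z]) (auto simp: w_def)
    then show ?thesis
      using hgrad_compose2[OF P cP F z] by (simp add: q1_def q2_def)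
  qed
  have test: "(\<lambda>k. \<integral>z. Y z \<bullet> hgrad (w k) z \<partial>?M) \<longlonglongrightarrow> (\<integral>z. Y z \<bullet> (Q1 z *\<^sub>R G1 z + Q2 z *\<^sub>R G2 z) \<partial>?M)"
    "integrable ?M (\<lambda>z. Y z \<bullet> (Q1 z *\<^sub>R G1 z + Q2 z *\<^sub>R G2 z))"
    if [measurable]: "a \<in> borel_measurable ?M" "Y \<in> borel_measurable ?M"
      and a: "\<And>z. 0 \<le> a z" "integrable ?M (\<lambda>z. a z powr p)"
      and Y: "\<And>z. z \<in> space ?M \<Longrightarrow> norm (Y z) \<le> C * a z powr (p - 1)"
    for a :: "'n heis \<Rightarrow> real" and Y C
  proof -
    have q: "AE z in ?M. (\<lambda>k. q1 k z) \<longlonglongrightarrow> Q1 z" "AE z in ?M. (\<lambda>k. q2 k z) \<longlonglongrightarrow> Q2 z"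
      unfolding q1_def q2_def Q1_def Q2_def using lim[OF cP(1)] lim[OF cP(2)] .
    have qB: "\<And>k z. \<bar>q1 k z\<bar> \<le> B" "\<And>k z. \<bar>q2 k z\<bar> \<le> B"
      using bP by (auto simp: q1_def q2_def)
    have s1: "integrable ?M (\<lambda>z. norm (G1 z) powr p)"
        "\<And>k. integrable ?M (\<lambda>z. norm (hgrad (F1 k) z - G1 z) powr p)"
        "(\<lambda>k. \<integral>\<^sup>+z. norm (hgrad (F1 k) z - G1 z) powr p \<partial>?M) \<longlonglongrightarrow> 0"
      using a1 by (simp_all add: sobolev_approx_def)
    have s2: "integrable ?M (\<lambda>z. norm (G2 z) powr p)"
        "\<And>k. integrable ?M (\<lambda>z. norm (hgrad (F2 k) z - G2 z) powr p)"
        "(\<lambda>k. \<integral>\<^sup>+z. norm (hgrad (F2 k) z - G2 z) powr p \<partial>?M) \<longlonglongrightarrow> 0"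
      using a2 by (simp_all add: sobolev_approx_def)
    note t1 = flux_integral_tendsto[OF p that(1) a(1,2) that(2) Y _ _ s1 _ _ qB(1) q(1)]
    note t2 = flux_integral_tendsto[OF p that(1) a(1,2) that(2) Y _ _ s2 _ _ qB(2) q(2)]
    have "(\<integral>z. Y z \<bullet> hgrad (w k) z \<partial>?M) =
        (\<integral>z. Y z \<bullet> (q1 k z *\<^sub>R hgrad (F1 k) z) \<partial>?M) + (\<integral>z. Y z \<bullet> (q2 k z *\<^sub>R hgrad (F2 k) z) \<partial>?M)" for k
    proof -
      have "(\<integral>z. Y z \<bullet> hgrad (w k) z \<partial>?M) =
          (\<integral>z. Y z \<bullet> (q1 k z *\<^sub>R hgrad (F1 k) z) + Y z \<bullet> (q2 k z *\<^sub>R hgrad (F2 k) z) \<partial>?M)"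
        by (rule Bochner_Integration.integral_cong) (auto simp: hw inner_add_right)
      also have "\<dots> = (\<integral>z. Y z \<bullet> (q1 k z *\<^sub>R hgrad (F1 k) z) \<partial>?M) + (\<integral>z. Y z \<bullet> (q2 k z *\<^sub>R hgrad (F2 k) z) \<partial>?M)"
        by (rule Bochner_Integration.integral_add) (rule t1(2) t2(2); measurable)+
      finally show ?thesis .
    qed
    moreover have "(\<integral>z. Y z \<bullet> (Q1 z *\<^sub>R G1 z + Q2 z *\<^sub>R G2 z) \<partial>?M) =
        (\<integral>z. Y z \<bullet> (Q1 z *\<^sub>R G1 z) \<partial>?M) + (\<integral>z. Y z \<bullet> (Q2 z *\<^sub>R G2 z) \<partial>?M)"
      unfolding inner_add_right
      by (rule Bochner_Integration.integral_add) (rule t1(3) t2(3); measurable)+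
    moreover have "(\<lambda>k. \<integral>z. Y z \<bullet> (q1 k z *\<^sub>R hgrad (F1 k) z) \<partial>?M) \<longlonglongrightarrow> (\<integral>z. Y z \<bullet> (Q1 z *\<^sub>R G1 z) \<partial>?M)"
      by (rule t1(1)) measurable
    moreover have "(\<lambda>k. \<integral>z. Y z \<bullet> (q2 k z *\<^sub>R hgrad (F2 k) z) \<partial>?M) \<longlonglongrightarrow> (\<integral>z. Y z \<bullet> (Q2 z *\<^sub>R G2 z) \<partial>?M)"
      by (rule t2(1)) measurable
    ultimately show "(\<lambda>k. \<integral>z. Y z \<bullet> hgrad (w k) z \<partial>?M) \<longlonglongrightarrow> (\<integral>z. Y z \<bullet> (Q1 z *\<^sub>R G1 z + Q2 z *\<^sub>R G2 z) \<partial>?M)"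
      by (simp add: tendsto_add)
    show "integrable ?M (\<lambda>z. Y z \<bullet> (Q1 z *\<^sub>R G1 z + Q2 z *\<^sub>R G2 z))"
      unfolding inner_add_right
      by (rule Bochner_Integration.integrable_add) (rule t1(3) t2(3); measurable)+
  qed
  have mflux: "(\<lambda>z. p_flux p (G z)) \<in> borel_measurable ?M" if [measurable]: "G \<in> borel_measurable ?M"
    for G :: "'n heis \<Rightarrow> (real ^ 'n) \<times> (real ^ 'n)"
    unfolding p_flux_def by measurable
  let ?W = "\<lambda>z. Q1 z *\<^sub>R G1 z + Q2 z *\<^sub>R G2 z"
  have "AE z in ?M. ?W z = 0"
  proof -
    have i: "integrable ?M (\<lambda>z. norm (G1 z) powr p)" "integrable ?M (\<lambda>z. norm (G2 z) powr p)"
      using a1 a2 by (simp_all add: sobolev_approx_def)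
    have T1: "(\<lambda>k. \<integral>z. p_flux p (G1 z) \<bullet> hgrad (w k) z \<partial>?M) \<longlonglongrightarrow> (\<integral>z. p_flux p (G1 z) \<bullet> ?W z \<partial>?M)"
      "integrable ?M (\<lambda>z. p_flux p (G1 z) \<bullet> ?W z)"
      by (rule test[where a = "\<lambda>z. norm (G1 z)" and C = 1]; use i in \<open>simp add: norm_p_flux mflux\<close>)+
    have T2: "(\<lambda>k. \<integral>z. p_flux p (G2 z) \<bullet> hgrad (w k) z \<partial>?M) \<longlonglongrightarrow> (\<integral>z. p_flux p (G2 z) \<bullet> ?W z \<partial>?M)"
      "integrable ?M (\<lambda>z. p_flux p (G2 z) \<bullet> ?W z)"
      by (rule test[where a = "\<lambda>z. norm (G2 z)" and C = 1]; use i in \<open>simp add: norm_p_flux mflux\<close>)+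
    have "(\<integral>z. p_flux p (G1 z) \<bullet> ?W z \<partial>?M) \<le> 0"
      using sub w w0 by (intro LIMSEQ_le_const2[OF T1(1)]) (auto simp: weak_subsolution_def)
    moreover have "0 \<le> (\<integral>z. p_flux p (G2 z) \<bullet> ?W z \<partial>?M)"
      using super w w0 by (intro LIMSEQ_le_const[OF T2(1)]) (auto simp: weak_supersolution_def)
    ultimately have le: "(\<integral>z. p_flux p (G1 z) \<bullet> ?W z - p_flux p (G2 z) \<bullet> ?W z \<partial>?M) \<le> 0"
      using T1(2) T2(2) by simp
    have W: "?W z = Q1 z *\<^sub>R (G1 z - G2 z)" "0 \<le> Q1 z" if "z \<in> V" for z
      using mono[OF that] by (auto simp: Q1_def Q2_def scaleR_diff_right)
    have eq: "p_flux p (G1 z) \<bullet> ?W z - p_flux p (G2 z) \<bullet> ?W z =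
        Q1 z * ((p_flux p (G1 z) - p_flux p (G2 z)) \<bullet> (G1 z - G2 z))" if "z \<in> V" for z
      unfolding W[OF that] by (simp add: inner_diff_left algebra_simps)
    have nn: "AE z in ?M. 0 \<le> p_flux p (G1 z) \<bullet> ?W z - p_flux p (G2 z) \<bullet> ?W z"
      using AE_space by eventually_elim (simp add: space_restrict_space eq W(2) p_flux_mono[OF p] mult_nonneg_nonneg)
    have "(\<integral>z. p_flux p (G1 z) \<bullet> ?W z - p_flux p (G2 z) \<bullet> ?W z \<partial>?M) = 0"
      using le integral_nonneg_AE[OF nn] by linarith
    then have "AE z in ?M. p_flux p (G1 z) \<bullet> ?W z - p_flux p (G2 z) \<bullet> ?W z = 0"
      using integral_nonneg_eq_0_iff_AE[OF Bochner_Integration.integrable_diff[OF T1(2) T2(2)] nn] by simp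
    then show ?thesis
      using AE_space
    proof eventually_elim
      case (elim z)
      then have "z \<in> V" by (simp add: space_restrict_space)
      with elim(1) eq have "Q1 z = 0 \<or> G1 z = G2 z"
        using p_flux_eq_if[OF p, of "G1 z" "G2 z"] by auto
      then show ?case using W(1)[OF \<open>z \<in> V\<close>] by auto
    qed
  qed
  \<comment> \<open>The gradient of the limit vanishes, so \<open>x\<^sub>i X\<^sub>i w\<^sub>k\<close> has integral tending to \<open>0\<close>, for any index \<open>i\<close>.\<close>
  obtain i0 :: 'n where True by simp
  let ?Y = "\<lambda>z::'n heis. (fst z $ i0) *\<^sub>R ((axis i0 1, 0) :: (real ^ 'n) \<times> (real ^ 'n))"
  obtain R where R: "\<And>z. z \<in> V \<Longrightarrow> norm z \<le> R" using V(2) by (auto simp: bounded_iff)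
  have YB: "norm (?Y z) \<le> R" if "z \<in> V" for z
  proof -
    have "\<bar>fst z $ i0\<bar> \<le> norm (fst z)" by (rule component_le_norm_cart)
    also have "\<dots> \<le> norm z" using norm_fst_le[of "fst z" "snd z"] by simp
    finally show ?thesis using R[OF that] by (simp add: norm_Pair)
  qed
  have mY: "?Y \<in> borel_measurable ?M"
    using Vs by (intro continuous_imp_measurable_on_sets_lebesgue) 
      (intro continuous_intros)
  have "(\<lambda>k. \<integral>z. ?Y z \<bullet> hgrad (w k) z \<partial>?M) \<longlonglongrightarrow> (\<integral>z. ?Y z \<bullet> ?W z \<partial>?M)"
  proof (rule test(1)[where a = "\<lambda>z. 1" and C = R])
    show "norm (?Y z) \<le> R * 1 powr (p - 1)" if "z \<in> space ?M" for z
      using that YB[of z] by (simp only: space_restrict_space space_completion space_lborel) simp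
  qed (use mY in simp_all)
  also have "(\<integral>z. ?Y z \<bullet> ?W z \<partial>?M) = (\<integral>z. 0 \<partial>?M)"
    
  proof (rule integral_cong_AE)
    show "(\<lambda>z. ?Y z \<bullet> ?W z) \<in> borel_measurable ?M" using mY by measurable
    show "AE z in ?M. ?Y z \<bullet> ?W z = 0" using \<open>AE z in ?M. ?W z = 0\<close> by eventually_elim simp
  qed simp
  finally have l1: "(\<lambda>k. \<integral>z. ?Y z \<bullet> hgrad (w k) z \<partial>?M) \<longlonglongrightarrow> 0" by simp
  have parts: "(\<integral>z. ?Y z \<bullet> hgrad (w k) z \<partial>?M) = - (\<integral>z. w k z \<partial>?M)" for k
  proof -
    have D: "((\<lambda>z::'n heis. fst z $ i0) has_derivative (\<lambda>v. fst v $ i0)) (at z)" for z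
      by (rule bounded_linear_imp_has_derivative[OF bounded_linear_compose[OF bounded_linear_vec_nth bounded_linear_fst]])
    have C: "Ck_on 1 V (\<lambda>z::'n heis. fst z $ i0)"
      by (rule Ck_on_1I[OF D] continuous_on_const)+
    have X: "Xder i0 (\<lambda>z::'n heis. fst z $ i0) z = 1" for z
      unfolding Xder_def frechet_derivative_at[OF D, symmetric] by (cases z) simp
    have "?Y z \<bullet> hgrad (w k) z = fst z $ i0 * Xder i0 (w k) z" for z
      by (simp add: hgrad_def inner_prod_def inner_axis')
    then show ?thesis
      using horizontal_integration_by_parts(3)[OF V(1) w C, of "Xder i0" k] by (simp add: X)
  qed
  have [measurable]: "w k \<in> borel_measurable ?M" for k
    using C1_0_Ck_on_UNIV[OF V(1) w] Vs
    by (meson Ck_on_1_continuous continuous_imp_measurable_on_sets_lebesgue continuous_on_subset subset_UNIV)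
  have mP: "(\<lambda>z. P (f1 z) (f2 z)) \<in> borel_measurable ?M" by (rule comp[OF CP]) measurable
  have "(\<lambda>k. \<integral>z. w k z \<partial>?M) \<longlonglongrightarrow> (\<integral>z. P (f1 z) (f2 z) \<partial>?M)"
  proof (rule integral_dominated_convergence)
    show "AE z in ?M. (\<lambda>k. w k z) \<longlonglongrightarrow> P (f1 z) (f2 z)"
      using lim[OF CP] AE_space by eventually_elim (simp add: w_def space_restrict_space)
    show "AE z in ?M. norm (w k z) \<le> B" for k
      using bP(3,4) order_trans[OF bP(3) bP(4)] by (auto simp: w_def)
  qed (use mP in auto)
  moreover have "(\<lambda>k. \<integral>z. w k z \<partial>?M) \<longlonglongrightarrow> 0"
    using tendsto_minus[OF l1] unfolding parts by simp
  ultimately have "(\<integral>z. P (f1 z) (f2 z) \<partial>?M) = 0"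
    using LIMSEQ_unique by blast
  moreover have "integrable ?M (\<lambda>z. P (f1 z) (f2 z))"
    using bP(3,4) mP by (intro integrable_const_bound[where B = B]) auto
  ultimately have "AE z in ?M. P (f1 z) (f2 z) = 0"
    using integral_nonneg_eq_0_iff_AE[of ?M "\<lambda>z. P (f1 z) (f2 z)"] bP(3) by simp
  moreover have "continuous_on V (\<lambda>z. P (f1 z) (f2 z))"
    using continuous_on_compose2[OF CP continuous_on_Pair[OF c1 c2]] by simp
  ultimately show ?thesis
    using continuous_AE_0_imp_0[OF V(1)] z by blast
qed

section \<open>The gauge and a barrier\<close>

text \<open>
  For \<open>a\<^sup>-\<^sup>1 z = (\<xi>, T)\<close> the fourth power of the gauge distance is \<open>|\<xi>|\<^sup>4 + T\<^sup>2\<close>; these are \<open>\<xi>\<close>,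
  \<open>|\<xi>|\<^sup>2\<close>, \<open>T\<close> and that power.  It is a polynomial in \<open>a\<close> and \<open>z\<close>, unlike the gauge itself.
\<close>

definition hor_diff :: "'n::finite heis \<Rightarrow> 'n heis \<Rightarrow> (real ^ 'n) \<times> (real ^ 'n)" where
  "hor_diff a z = (fst z - fst a, fst (snd z) - fst (snd a))"

definition hor_sq :: "'n::finite heis \<Rightarrow> 'n heis \<Rightarrow> real" where
  "hor_sq a z = hor_diff a z \<bullet> hor_diff a z"

definition vert_diff :: "'n::finite heis \<Rightarrow> 'n heis \<Rightarrow> real" where
  "vert_diff a z = snd (snd z) - snd (snd a) + 2 * (fst a \<bullet> fst (snd z) - fst (snd a) \<bullet> fst z)"

definition gauge_pow4 :: "'n::finite heis \<Rightarrow> 'n heis \<Rightarrow> real" where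
  "gauge_pow4 a z = (hor_sq a z)\<^sup>2 + (vert_diff a z)\<^sup>2"

text \<open>
  The horizontal gradient of \<open>T\<close> is twice this rotation of \<open>\<xi>\<close>: it is orthogonal to that of \<open>|\<xi>|\<^sup>2\<close>
  and of equal length.
\<close>

definition symp :: "'a::ab_group_add \<times> 'a \<Rightarrow> 'a \<times> 'a" where
  "symp v = (snd v, - fst v)"

lemma symp_inner: "v \<bullet> symp v = 0" "symp v \<bullet> v = 0" "symp v \<bullet> symp v = v \<bullet> v"
  for v :: "'a::real_inner \<times> 'a"
  by (simp_all add: symp_def inner_prod_def inner_commute)

lemma hor_sq_nonneg: "0 \<le> hor_sq a z" by (simp add: hor_sq_def)

lemma gauge_pow4_nonneg: "0 \<le> gauge_pow4 a z" by (simp add: gauge_pow4_def)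

lemma
  fixes a z :: "'n::finite heis"
  shows has_derivative_hor_sq: "(hor_sq a has_derivative
      (\<lambda>v. 2 * (fst (hor_diff a z) \<bullet> fst v + snd (hor_diff a z) \<bullet> fst (snd v)))) (at z)"
    and has_derivative_vert_diff: "(vert_diff a has_derivative
      (\<lambda>v. snd (snd v) + 2 * (fst a \<bullet> fst (snd v) - fst (snd a) \<bullet> fst v))) (at z)"
  unfolding hor_sq_def[abs_def] hor_diff_def vert_diff_def[abs_def] inner_prod_def
  by (auto intro!: derivative_eq_intros simp: inner_commute algebra_simps)

lemma Ck_on_1_hor_sq: "Ck_on 1 V (hor_sq a)"
  by (rule Ck_on_1I[OF has_derivative_hor_sq]) (auto simp: hor_diff_def intro!: continuous_intros)

lemma Ck_on_1_vert_diff: "Ck_on 1 V (vert_diff a)"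
  by (rule Ck_on_1I[OF has_derivative_vert_diff]) (auto intro!: continuous_intros)

lemma Xvec_Yvec_components [simp]:
  "fst (Xvec i z) = axis i 1" "fst (snd (Xvec i z)) = 0" "snd (snd (Xvec i z)) = 2 * fst (snd z) $ i"
  "fst (Yvec i z) = 0" "fst (snd (Yvec i z)) = axis i 1" "snd (snd (Yvec i z)) = - (2 * fst z $ i)"
  by (cases z; simp)+

lemma hgrad_hor_sq: "hgrad (hor_sq a) z = 2 *\<^sub>R hor_diff a z"
  unfolding hgrad_eq_horizontal_part[OF has_derivative_hor_sq]
  by (simp add: horizontal_part_def prod_eq_iff vec_eq_iff inner_axis)

lemma hgrad_vert_diff: "hgrad (vert_diff a) z = 2 *\<^sub>R symp (hor_diff a z)"
  unfolding hgrad_eq_horizontal_part[OF has_derivative_vert_diff]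
  by (simp add: horizontal_part_def hor_diff_def symp_def prod_eq_iff vec_eq_iff inner_axis algebra_simps)

lemma Ck_on_1_differentiableD: "Ck_on 1 V f \<Longrightarrow> z \<in> V \<Longrightarrow> f differentiable (at z)"
  using Ck_on_1_differentiable differentiableI by blast

lemma
  fixes h :: "real \<Rightarrow> real" and f :: "'n::finite heis \<Rightarrow> real"
  assumes f: "Ck_on 1 V f"
    and h: "\<And>z. z \<in> V \<Longrightarrow> (h has_real_derivative h' (f z)) (at (f z))"
    and c: "continuous_on V (\<lambda>z. h' (f z))"
  shows Ck_on_1_compose: "Ck_on 1 V (\<lambda>z. h (f z))"
    and hgrad_compose: "z \<in> V \<Longrightarrow> hgrad (\<lambda>z. h (f z)) z = h' (f z) *\<^sub>R hgrad f z"
proof -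
  have D: "((\<lambda>z. h (f z)) has_derivative (\<lambda>v. h' (f z) * frechet_derivative f (at z) v)) (at z)"
    if "z \<in> V" for z
    using has_derivative_compose[OF Ck_on_1_differentiable[OF f that] h[OF that, unfolded has_field_derivative_def]] .
  show "Ck_on 1 V (\<lambda>z. h (f z))"
    by (rule Ck_on_1I[OF D], assumption)
      (intro continuous_on_mult c Ck_on_1_continuous_derivative[OF f] continuous_on_const)
  show "hgrad (\<lambda>z. h (f z)) z = h' (f z) *\<^sub>R hgrad f z" if "z \<in> V"
    using hgrad_eq_horizontal_part[OF D[OF that]] by (simp add: horizontal_part_scale hgrad_horizontal_part_frechet)
qed

lemma Ck_on_1_gauge_pow4: "Ck_on 1 V (gauge_pow4 a)"
  unfolding gauge_pow4_def[abs_def] power2_eq_square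
  by (rule Ck_on_1_add[OF Ck_on_1_mult[OF Ck_on_1_hor_sq Ck_on_1_hor_sq]
        Ck_on_1_mult[OF Ck_on_1_vert_diff Ck_on_1_vert_diff]])

lemma hgrad_gauge_pow4:
  "hgrad (gauge_pow4 a) z =
    (4 * hor_sq a z) *\<^sub>R hor_diff a z + (4 * vert_diff a z) *\<^sub>R symp (hor_diff a z)"
proof -
  note q = Ck_on_1_hor_sq[of UNIV a] note t = Ck_on_1_vert_diff[of UNIV a]
  show ?thesis
    unfolding gauge_pow4_def[abs_def] power2_eq_square
    by (simp add: hgrad_add hgrad_mult hgrad_hor_sq hgrad_vert_diff
        Ck_on_1_differentiableD[OF q] Ck_on_1_differentiableD[OF t]
        Ck_on_1_differentiableD[OF Ck_on_1_mult[OF q q]] Ck_on_1_differentiableD[OF Ck_on_1_mult[OF t t]]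
        flip: scaleR_add_left)
qed

lemma inner_hgrad_gauge_pow4:
  shows "hgrad (gauge_pow4 a) z \<bullet> hgrad (gauge_pow4 a) z = 16 * hor_sq a z * gauge_pow4 a z"
    and "hor_diff a z \<bullet> hgrad (gauge_pow4 a) z = 4 * (hor_sq a z)\<^sup>2"
  by (simp_all add: hgrad_gauge_pow4 inner_add_left inner_add_right symp_inner
      gauge_pow4_def hor_sq_def power2_eq_square algebra_simps)

lemma Ck_on_1_hgrad_gauge_pow4:
  shows "Ck_on 1 V (\<lambda>z. fst (hgrad (gauge_pow4 a) z) $ i)" (is ?C1)
    and "Ck_on 1 V (\<lambda>z. snd (hgrad (gauge_pow4 a) z) $ i)" (is ?C2)
    and "Xder i (\<lambda>z. fst (hgrad (gauge_pow4 a) z) $ i) z + Yder i (\<lambda>z. snd (hgrad (gauge_pow4 a) z) $ i) z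
      = 8 * hor_sq a z + 16 * ((fst (hor_diff a z) $ i)\<^sup>2 + (snd (hor_diff a z) $ i)\<^sup>2)" (is ?D)
proof -
  let ?x = "\<lambda>z. fst (hor_diff a z) $ i" and ?y = "\<lambda>z. snd (hor_diff a z) $ i"
  have Dx: "(?x has_derivative (\<lambda>v. fst v $ i)) (at z)"
    and Dy: "(?y has_derivative (\<lambda>v. fst (snd v) $ i)) (at z)" for z
    by (auto simp: hor_diff_def intro!: bounded_linear.has_derivative[OF bounded_linear_vec_nth] derivative_eq_intros)
  have Cx: "Ck_on 1 W ?x" and Cy: "Ck_on 1 W ?y" for W
    by (rule Ck_on_1I[OF Dx] Ck_on_1I[OF Dy]; auto intro!: continuous_intros)+
  note q = Ck_on_1_hor_sq note t = Ck_on_1_vert_diff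
  note D = Ck_on_1_differentiableD[OF _ UNIV_I]
  have e1: "(\<lambda>z. fst (hgrad (gauge_pow4 a) z) $ i) = (\<lambda>z. 4 * (hor_sq a z * ?x z + vert_diff a z * ?y z))"
    and e2: "(\<lambda>z. snd (hgrad (gauge_pow4 a) z) $ i) = (\<lambda>z. 4 * (hor_sq a z * ?y z + (- 1) * (vert_diff a z * ?x z)))"
    by (auto simp: hgrad_gauge_pow4 symp_def fun_eq_iff)
  note m = Ck_on_1_mult Ck_on_1_add Ck_on_1_const
  have C1: "Ck_on 1 W (\<lambda>z. hor_sq a z * ?x z + vert_diff a z * ?y z)"
    and C2: "Ck_on 1 W (\<lambda>z. hor_sq a z * ?y z + (- 1) * (vert_diff a z * ?x z))" for W
    by (rule m q t Cx Cy)+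
  show ?C1 ?C2 unfolding e1 e2 by (rule m C1 C2)+
  have hx: "hgrad ?x z = (axis i 1, 0)" and hy: "hgrad ?y z = (0, axis i 1)"
    unfolding hgrad_eq_horizontal_part[OF Dx] hgrad_eq_horizontal_part[OF Dy]
    by (auto simp: horizontal_part_def vec_eq_iff axis_def prod_eq_iff)
  have h1: "hgrad (\<lambda>z. hor_sq a z * ?x z + vert_diff a z * ?y z) z =
      (?x z *\<^sub>R (2 *\<^sub>R hor_diff a z) + hor_sq a z *\<^sub>R (axis i 1, 0))
      + (?y z *\<^sub>R (2 *\<^sub>R symp (hor_diff a z)) + vert_diff a z *\<^sub>R (0, axis i 1))"
    unfolding hgrad_add[OF D[OF Ck_on_1_mult[OF q Cx]] D[OF Ck_on_1_mult[OF t Cy]]]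
      hgrad_mult[OF D[OF q] D[OF Cx]] hgrad_mult[OF D[OF t] D[OF Cy]] hx hy hgrad_hor_sq hgrad_vert_diff ..
  have h2: "hgrad (\<lambda>z. hor_sq a z * ?y z + (- 1) * (vert_diff a z * ?x z)) z =
      (?y z *\<^sub>R (2 *\<^sub>R hor_diff a z) + hor_sq a z *\<^sub>R (0, axis i 1))
      + (- 1) *\<^sub>R (?x z *\<^sub>R (2 *\<^sub>R symp (hor_diff a z)) + vert_diff a z *\<^sub>R (axis i 1, 0))"
    unfolding hgrad_add[OF D[OF Ck_on_1_mult[OF q Cy]] D[OF Ck_on_1_mult[OF Ck_on_1_const Ck_on_1_mult[OF t Cx]]]]
      hgrad_mult[OF D[OF Ck_on_1_const] D[OF Ck_on_1_mult[OF t Cx]]]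
      hgrad_mult[OF D[OF q] D[OF Cy]] hgrad_mult[OF D[OF t] D[OF Cx]] hx hy hgrad_hor_sq hgrad_vert_diff hgrad_const
    by simp
  show ?D
    unfolding hgrad_nth[symmetric] e1 e2 hgrad_mult[OF D[OF Ck_on_1_const] D[OF C1]]
      hgrad_mult[OF D[OF Ck_on_1_const] D[OF C2]] h1 h2 hgrad_const
    by (simp add: symp_def power2_eq_square)
qed

lemma divergence_theorem_horizontal:
  fixes \<phi> :: "'n::finite heis \<Rightarrow> real"
  assumes V: "open V" and \<phi>: "\<phi> \<in> C1_0 V"
    and W: "\<And>i. Ck_on 1 V (\<lambda>z. fst (W z) $ i)" "\<And>i. Ck_on 1 V (\<lambda>z. snd (W z) $ i)"
  shows "(\<integral>z. W z \<bullet> hgrad \<phi> z \<partial>lebesgue_on V) =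
    - (\<integral>z. \<phi> z * (\<Sum>i\<in>UNIV. Xder i (\<lambda>z. fst (W z) $ i) z + Yder i (\<lambda>z. snd (W z) $ i) z) \<partial>lebesgue_on V)"
proof -
  note X = horizontal_integration_by_parts[OF V \<phi> W(1) UnI1[OF rangeI]]
  note Y = horizontal_integration_by_parts[OF V \<phi> W(2) UnI2[OF rangeI]]
  have "W z \<bullet> hgrad \<phi> z = (\<Sum>i\<in>UNIV. fst (W z) $ i * Xder i \<phi> z + snd (W z) $ i * Yder i \<phi> z)" for z
    by (simp add: inner_prod_def inner_vec_def hgrad_def sum.distrib)
  then have "(\<integral>z. W z \<bullet> hgrad \<phi> z \<partial>lebesgue_on V) =
      (\<Sum>i\<in>UNIV. (\<integral>z. fst (W z) $ i * Xder i \<phi> z \<partial>lebesgue_on V) + (\<integral>z. snd (W z) $ i * Yder i \<phi> z \<partial>lebesgue_on V))"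
    using X(1) Y(1) by (simp add: Bochner_Integration.integral_sum)
  also have "\<dots> = - (\<Sum>i\<in>UNIV. (\<integral>z. \<phi> z * Xder i (\<lambda>z. fst (W z) $ i) z \<partial>lebesgue_on V)
      + (\<integral>z. \<phi> z * Yder i (\<lambda>z. snd (W z) $ i) z \<partial>lebesgue_on V))"
    by (simp add: X(3) Y(3) sum.distrib sum_negf sum_subtractf)
  also have "\<dots> = - (\<integral>z. \<phi> z * (\<Sum>i\<in>UNIV. Xder i (\<lambda>z. fst (W z) $ i) z + Yder i (\<lambda>z. snd (W z) $ i) z) \<partial>lebesgue_on V)"
    using X(2) Y(2) by (simp add: Bochner_Integration.integral_sum sum_distrib_left distrib_left)
  finally show ?thesis .
qed

lemma horizontal_divergence_scaled:
  fixes E :: "'n::finite heis \<Rightarrow> real"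
  assumes E: "E differentiable (at z)"
    and W: "\<And>i. (\<lambda>z. fst (W z) $ i) differentiable (at z)" "\<And>i. (\<lambda>z. snd (W z) $ i) differentiable (at z)"
  shows "(\<Sum>i\<in>UNIV. Xder i (\<lambda>z. fst (E z *\<^sub>R W z) $ i) z + Yder i (\<lambda>z. snd (E z *\<^sub>R W z) $ i) z)
    = hgrad E z \<bullet> W z + E z * (\<Sum>i\<in>UNIV. Xder i (\<lambda>z. fst (W z) $ i) z + Yder i (\<lambda>z. snd (W z) $ i) z)"
proof -
  have "Xder i (\<lambda>z. fst (E z *\<^sub>R W z) $ i) z = fst (W z) $ i * Xder i E z + E z * Xder i (\<lambda>z. fst (W z) $ i) z"
    and "Yder i (\<lambda>z. snd (E z *\<^sub>R W z) $ i) z = snd (W z) $ i * Yder i E z + E z * Yder i (\<lambda>z. snd (W z) $ i) z" for i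
    using hgrad_mult[OF E W(1)[of i]] hgrad_mult[OF E W(2)[of i]]
    by (simp_all flip: hgrad_nth)
  moreover have "hgrad E z \<bullet> W z = (\<Sum>i\<in>UNIV. fst (W z) $ i * Xder i E z + snd (W z) $ i * Yder i E z)"
    by (simp add: hgrad_def inner_prod_def inner_vec_def sum.distrib mult.commute)
  ultimately show ?thesis
    by (simp add: sum.distrib sum_distrib_left algebra_simps)
qed

lemma divergence_hgrad_gauge_pow4:
  fixes a :: "'n::finite heis"
  shows "(\<Sum>i\<in>UNIV. Xder i (\<lambda>z. fst (hgrad (gauge_pow4 a) z) $ i) z + Yder i (\<lambda>z. snd (hgrad (gauge_pow4 a) z) $ i) z)
    = (8 * real CARD('n) + 16) * hor_sq a z"
proof -
  have "(\<Sum>i\<in>UNIV. (fst (hor_diff a z) $ i)\<^sup>2 + (snd (hor_diff a z) $ i)\<^sup>2) = hor_sq a z"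
    by (simp add: hor_sq_def inner_prod_def inner_vec_def sum.distrib power2_eq_square)
  then show ?thesis
    unfolding Ck_on_1_hgrad_gauge_pow4(3) sum.distrib[of "\<lambda>i. 8 * hor_sq a z"] sum_distrib_left[symmetric]
    by (simp add: algebra_simps)
qed

text \<open>
  The field \<open>|\<nabla>\<^sub>HN|\<^sup>p\<^sup>-\<^sup>2 \<nabla>\<^sub>HN\<close> need not be differentiable on the axis \<open>\<xi> = 0\<close>, where \<open>\<nabla>\<^sub>HN\<close> vanishes.
  With \<open>\<Psi> = |\<nabla>\<^sub>HN|\<^sup>2 + \<sigma>\<close> in place of \<open>|\<nabla>\<^sub>HN|\<^sup>2\<close> the divergence has the right sign for every
  \<open>\<sigma> > 0\<close>: differentiation of \<open>\<Psi>\<^sup>\<gamma>\<close> contributes \<open>384 \<gamma> |\<xi>|\<^sup>4 N / \<Psi>\<close> times the common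
  factor, at most \<open>24 |\<gamma>| |\<xi>|\<^sup>2\<close> since \<open>\<Psi> \<ge> 16 |\<xi>|\<^sup>2 N\<close>, while the exponential contributes
  \<open>- 16 \<beta> N |\<xi>|\<^sup>2\<close>.
\<close>

lemma regularised_flux_sign:
  fixes a :: "'n::finite heis"
  assumes V: "open V" and \<phi>: "\<phi> \<in> C1_0 V" "\<And>z. 0 \<le> \<phi> z" and \<sigma>: "\<sigma> > 0"
    and s: "\<And>z. z \<in> V \<Longrightarrow> s \<le> gauge_pow4 a z"
    and \<beta>: "\<beta> \<ge> 0" "16 * \<beta> * s \<ge> 16 + 8 * real CARD('n) + 24 * \<bar>\<gamma>\<bar>"
  shows "0 \<le> (\<integral>z. (exp (- \<beta> * gauge_pow4 a z) *
      ((norm (hgrad (gauge_pow4 a) z))\<^sup>2 + \<sigma>) powr \<gamma>) *\<^sub>R hgrad (gauge_pow4 a) z \<bullet> hgrad \<phi> z \<partial>lebesgue_on V)"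
proof -
  let ?N = "gauge_pow4 a" and ?q = "hor_sq a" and ?H = "hgrad (gauge_pow4 a)"
  define \<Psi> where "\<Psi> z = 16 * (?q z * ?N z) + \<sigma>" for z
  define E where "E z = exp (- \<beta> * ?N z) * \<Psi> z powr \<gamma>" for z
  have \<Psi>: "\<Psi> z > 0" for z using \<sigma> hor_sq_nonneg[of a z] gauge_pow4_nonneg[of a z]
    by (simp add: \<Psi>_def add_nonneg_pos)
  note CN = Ck_on_1_gauge_pow4 note Cq = Ck_on_1_hor_sq
  note d = Ck_on_1_differentiableD[OF _ UNIV_I]
  have C\<Psi>: "Ck_on 1 W \<Psi>" for W
    unfolding \<Psi>_def[abs_def] by (rule Ck_on_1_add Ck_on_1_mult Ck_on_1_const CN Cq)+
  have h\<Psi>: "hgrad \<Psi> z = 16 *\<^sub>R (?N z *\<^sub>R (2 *\<^sub>R hor_diff a z) + ?q z *\<^sub>R ?H z)" for z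
    unfolding \<Psi>_def[abs_def] hgrad_add[OF d[OF Ck_on_1_mult[OF Ck_on_1_const Ck_on_1_mult[OF Cq CN]]] d[OF Ck_on_1_const]]
      hgrad_mult[OF d[OF Ck_on_1_const] d[OF Ck_on_1_mult[OF Cq CN]]] hgrad_mult[OF d[OF Cq] d[OF CN]]
      hgrad_const hgrad_hor_sq by simp
  have C1: "Ck_on 1 W (\<lambda>z. exp (- \<beta> * ?N z))"
    and h1: "hgrad (\<lambda>z. exp (- \<beta> * ?N z)) z = (- \<beta> * exp (- \<beta> * ?N z)) *\<^sub>R ?H z" for W z
  proof -
    have D: "((\<lambda>r. exp (- \<beta> * r)) has_real_derivative - \<beta> * exp (- \<beta> * r)) (at r)" for r
      by (auto intro!: derivative_eq_intros)
    have c: "continuous_on W (\<lambda>z. - \<beta> * exp (- \<beta> * ?N z))" for W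
      by (intro continuous_intros Ck_on_1_continuous[OF CN])
    show "Ck_on 1 W (\<lambda>z. exp (- \<beta> * ?N z))" by (rule Ck_on_1_compose[OF CN D c])
    show "hgrad (\<lambda>z. exp (- \<beta> * ?N z)) z = (- \<beta> * exp (- \<beta> * ?N z)) *\<^sub>R ?H z"
      by (rule hgrad_compose[OF CN D c UNIV_I])
  qed
  have C2: "Ck_on 1 W (\<lambda>z. \<Psi> z powr \<gamma>)"
    and h2: "hgrad (\<lambda>z. \<Psi> z powr \<gamma>) z = (\<gamma> * \<Psi> z powr (\<gamma> - 1)) *\<^sub>R hgrad \<Psi> z" for W z
  proof -
    have D: "((\<lambda>r. r powr \<gamma>) has_real_derivative \<gamma> * \<Psi> z powr (\<gamma> - 1)) (at (\<Psi> z))" for z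
      using \<Psi>[of z] by (auto intro!: derivative_eq_intros)
    have "\<Psi> z \<noteq> 0" for z using \<Psi>[of z] by simp
    then have c: "continuous_on W (\<lambda>z. \<gamma> * \<Psi> z powr (\<gamma> - 1))" for W
      by (intro continuous_intros Ck_on_1_continuous[OF C\<Psi>]) auto
    show "Ck_on 1 W (\<lambda>z. \<Psi> z powr \<gamma>)" by (rule Ck_on_1_compose[OF C\<Psi> D c])
    show "hgrad (\<lambda>z. \<Psi> z powr \<gamma>) z = (\<gamma> * \<Psi> z powr (\<gamma> - 1)) *\<^sub>R hgrad \<Psi> z"
      by (rule hgrad_compose[OF C\<Psi> D c UNIV_I])
  qed
  have CE: "Ck_on 1 W E" for W unfolding E_def[abs_def] by (rule Ck_on_1_mult[OF C1 C2])
  have hE: "hgrad E z = E z *\<^sub>R ((- \<beta>) *\<^sub>R ?H z + (\<gamma> / \<Psi> z) *\<^sub>R hgrad \<Psi> z)" for z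
  proof -
    have "\<Psi> z powr (\<gamma> - 1) = \<Psi> z powr \<gamma> / \<Psi> z" using \<Psi>[of z] by (simp add: powr_diff)
    then show ?thesis
      unfolding E_def[abs_def] hgrad_mult[OF d[OF C1] d[OF C2]] h1 h2 by (simp add: scaleR_add_right scaleR_diff_right mult_ac)
  qed
  define dv where "dv z = (\<Sum>i\<in>UNIV. Xder i (\<lambda>z. fst (E z *\<^sub>R ?H z) $ i) z + Yder i (\<lambda>z. snd (E z *\<^sub>R ?H z) $ i) z)" for z
  have dv: "dv z = E z * ?q z * (- 16 * \<beta> * ?N z + 384 * \<gamma> * (?q z * ?N z / \<Psi> z) + 16 + 8 * real CARD('n))" for z
  proof -
    have "hgrad \<Psi> z \<bullet> ?H z = 384 * ((?q z)\<^sup>2 * ?N z)"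
      unfolding h\<Psi> by (simp add: inner_add_left inner_hgrad_gauge_pow4 power2_eq_square algebra_simps)
    then have "hgrad E z \<bullet> ?H z = E z * (- \<beta> * (16 * ?q z * ?N z) + (\<gamma> / \<Psi> z) * (384 * ((?q z)\<^sup>2 * ?N z)))"
      unfolding hE by (simp add: inner_add_left inner_diff_left inner_hgrad_gauge_pow4)
    moreover have "dv z = hgrad E z \<bullet> ?H z + E z * ((8 * real CARD('n) + 16) * ?q z)"
      unfolding dv_def
      using horizontal_divergence_scaled[where z = z and W = ?H, OF d[OF CE]
          d[OF Ck_on_1_hgrad_gauge_pow4(1)] d[OF Ck_on_1_hgrad_gauge_pow4(2)]]
      by (simp add: divergence_hgrad_gauge_pow4)
    ultimately show ?thesis
      by (simp add: power2_eq_square algebra_simps)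
  qed
  have sign: "dv z \<le> 0" if "z \<in> V" for z
  proof -
    have "?q z * ?N z / \<Psi> z \<le> 1 / 16"
      using \<Psi>[of z] \<sigma> by (simp add: \<Psi>_def divide_le_eq)
    moreover have "0 \<le> ?q z * ?N z / \<Psi> z"
      using \<Psi>[of z] hor_sq_nonneg[of a z] gauge_pow4_nonneg[of a z] by (simp add: less_imp_le)
    ultimately have "\<gamma> * (?q z * ?N z / \<Psi> z) \<le> \<bar>\<gamma>\<bar> * (1 / 16)"
      by (meson abs_ge_self abs_ge_zero mult_mono order_trans mult_right_mono)
    moreover have "16 * \<beta> * s \<le> 16 * \<beta> * ?N z" using s[OF that] \<beta>(1) by (simp add: mult_left_mono)
    ultimately have "- 16 * \<beta> * ?N z + 384 * \<gamma> * (?q z * ?N z / \<Psi> z) + 16 + 8 * real CARD('n) \<le> 0"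
      using \<beta>(2) by linarith
    moreover have "0 \<le> E z * ?q z" using hor_sq_nonneg[of a z] by (simp add: E_def)
    ultimately show ?thesis unfolding dv by (rule mult_nonneg_nonpos[rotated])
  qed
  have "(exp (- \<beta> * ?N z) * ((norm (?H z))\<^sup>2 + \<sigma>) powr \<gamma>) = E z" for z
    by (simp add: E_def \<Psi>_def power2_norm_eq_inner inner_hgrad_gauge_pow4 mult_ac)
  then have "(\<integral>z. (exp (- \<beta> * ?N z) * ((norm (?H z))\<^sup>2 + \<sigma>) powr \<gamma>) *\<^sub>R ?H z \<bullet> hgrad \<phi> z \<partial>lebesgue_on V)
      = (\<integral>z. (E z *\<^sub>R ?H z) \<bullet> hgrad \<phi> z \<partial>lebesgue_on V)" by simp
  also have "\<dots> = - (\<integral>z. \<phi> z * dv z \<partial>lebesgue_on V)"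
    unfolding dv_def
    by (rule divergence_theorem_horizontal[OF V \<phi>(1)])
      (simp_all add: Ck_on_1_mult[OF CE] Ck_on_1_hgrad_gauge_pow4 del: Ck_on.simps One_nat_def)
  also have "\<dots> = (\<integral>z. \<phi> z * (- dv z) \<partial>lebesgue_on V)" by simp
  also have "0 \<le> \<dots>"
    using \<phi>(2) sign by (intro integral_nonneg_AE AE_I2) (auto simp: mult_nonneg_nonpos)
  finally show ?thesis .
qed

text \<open>
  The fundamental solution is a power of \<open>N\<close>, singular at the centre and logarithmic for one value of
  \<open>p\<close>.  The exponential is smooth everywhere, covers all \<open>p\<close> alike, and as a subsolution is still good
  for lower bounds.
\<close>

definition barrier :: "real \<Rightarrow> real \<Rightarrow> 'n::finite heis \<Rightarrow> real \<Rightarrow> 'n heis \<Rightarrow> real" where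
  "barrier K \<alpha> a S z = K * (exp (- \<alpha> * gauge_pow4 a z) - exp (- \<alpha> * S))"

lemma Ck_on_1_barrier: "Ck_on 1 V (barrier K \<alpha> a S)"
  and hgrad_barrier: "hgrad (barrier K \<alpha> a S) z =
    - ((K * \<alpha> * exp (- \<alpha> * gauge_pow4 a z)) *\<^sub>R hgrad (gauge_pow4 a) z)"
proof -
  let ?h = "\<lambda>r. K * (exp (- \<alpha> * r) - exp (- \<alpha> * S))"
  have D: "(?h has_real_derivative - (K * \<alpha> * exp (- \<alpha> * r))) (at r)" for r
    by (auto intro!: derivative_eq_intros simp: algebra_simps)
  have c: "continuous_on V (\<lambda>z. - (K * \<alpha> * exp (- \<alpha> * gauge_pow4 a z)))" for V
    by (intro continuous_intros Ck_on_1_continuous[OF Ck_on_1_gauge_pow4])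
  show "Ck_on 1 V (barrier K \<alpha> a S)"
    unfolding barrier_def[abs_def] by (rule Ck_on_1_compose[OF Ck_on_1_gauge_pow4 D c])
  show "hgrad (barrier K \<alpha> a S) z = - ((K * \<alpha> * exp (- \<alpha> * gauge_pow4 a z)) *\<^sub>R hgrad (gauge_pow4 a) z)"
    unfolding barrier_def[abs_def]
    using hgrad_compose[OF Ck_on_1_gauge_pow4 D c UNIV_I, of z] by simp
qed

text \<open>A bound uniform in \<open>\<sigma>\<close>; for \<open>p < 2\<close> the first factor alone is unbounded as \<open>\<sigma>\<close> and \<open>m\<close> tend to \<open>0\<close>.\<close>

lemma powr_flux_bound:
  fixes m \<sigma> p :: real
  assumes "p > 1" "0 \<le> m" "0 < \<sigma>" "\<sigma> \<le> 1"
  shows "(m\<^sup>2 + \<sigma>) powr ((p - 2) / 2) * m \<le> (m\<^sup>2 + 1) powr ((p - 1) / 2)"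
proof -
  have pos: "m\<^sup>2 + \<sigma> > 0" using assms by (simp add: add_nonneg_pos)
  have "m = (m\<^sup>2) powr (1 / 2)" using assms by (simp add: powr_half_sqrt)
  also have "\<dots> \<le> (m\<^sup>2 + \<sigma>) powr (1 / 2)" using assms by (intro powr_mono2) auto
  finally have "(m\<^sup>2 + \<sigma>) powr ((p - 2) / 2) * m \<le> (m\<^sup>2 + \<sigma>) powr ((p - 2) / 2) * (m\<^sup>2 + \<sigma>) powr (1 / 2)"
    by (intro mult_left_mono) auto
  also have "\<dots> = (m\<^sup>2 + \<sigma>) powr ((p - 1) / 2)"
    by (simp add: diff_divide_distrib flip: powr_add)
  also have "\<dots> \<le> (m\<^sup>2 + 1) powr ((p - 1) / 2)" using assms pos by (intro powr_mono2) auto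
  finally show ?thesis .
qed

text \<open>Let the regularisation tend to \<open>0\<close>; the flux of the barrier points against \<open>\<nabla>\<^sub>HN\<close>.\<close>

lemma barrier_weak_subsolution:
  fixes a :: "'n::finite heis"
  assumes p: "p > 1" and V: "open V" "bounded V" and s: "\<And>z. z \<in> V \<Longrightarrow> s \<le> gauge_pow4 a z"
    and K: "K \<ge> 0" and \<alpha>: "\<alpha> > 0" "16 * (\<alpha> * (p - 1)) * s \<ge> 16 + 8 * real CARD('n) + 24 * \<bar>(p - 2) / 2\<bar>"
  shows "weak_subsolution p V (hgrad (barrier K \<alpha> a S))"
  unfolding weak_subsolution_def
proof (intro ballI impI)
  fix \<phi> assume \<phi>: "\<phi> \<in> C1_0 V" and \<phi>0: "\<forall>z. 0 \<le> \<phi> z"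
  let ?M = "lebesgue_on V"
  let ?N = "gauge_pow4 a" and ?H = "hgrad (gauge_pow4 a)"
  define \<beta> \<gamma> where "\<beta> = \<alpha> * (p - 1)" and "\<gamma> = (p - 2) / 2"
  have \<beta>0: "\<beta> \<ge> 0" using \<alpha> p by (simp add: \<beta>_def)
  interpret finite_measure ?M by (rule finite_measure_lebesgue_on_bounded[OF V])
  define f where "f \<sigma> z = (exp (- \<beta> * ?N z) * ((norm (?H z))\<^sup>2 + \<sigma>) powr \<gamma>) *\<^sub>R ?H z \<bullet> hgrad \<phi> z" for \<sigma> z
  define g where "g z = exp (- \<beta> * ?N z) * (p_flux p (?H z) \<bullet> hgrad \<phi> z)" for z
  define \<sigma> where "\<sigma> k = 1 / real (Suc k)" for k
  have \<sigma>: "0 < \<sigma> k" "\<sigma> k \<le> 1" for k by (auto simp: \<sigma>_def)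
  have \<sigma>0: "\<sigma> \<longlonglongrightarrow> 0" unfolding \<sigma>_def[abs_def] by (rule LIMSEQ_Suc[OF lim_1_over_n])
  have [measurable]: "?N \<in> borel_measurable ?M" "?H \<in> borel_measurable ?M" "hgrad \<phi> \<in> borel_measurable ?M"
    using V(1) Ck_on_subset[OF C1_0_Ck_on_UNIV[OF V(1) \<phi>] subset_UNIV]
    by (auto intro!: measurable_hgrad Ck_on_1_gauge_pow4
        continuous_imp_measurable_on_sets_lebesgue[OF Ck_on_1_continuous[OF Ck_on_1_gauge_pow4]]
        simp del: Ck_on.simps One_nat_def)
  obtain B where B: "B > 0" "\<And>z. norm (hgrad \<phi> z) \<le> B" using C1_0_bounded[OF V(1) \<phi>] by metis
  have "compact (closure V)" using V(2) by simp
  then have "bounded (?H ` closure V)"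
    by (intro compact_imp_bounded compact_continuous_image continuous_on_hgrad Ck_on_1_gauge_pow4)
  then obtain L where L: "\<And>z. z \<in> closure V \<Longrightarrow> norm (?H z) \<le> L" by (auto simp: bounded_iff)
  have "0 \<le> (\<integral>z. f (\<sigma> k) z \<partial>?M)" for k
    unfolding f_def
    by (rule regularised_flux_sign[OF V(1) \<phi> _ \<sigma>(1) s \<beta>0])
      (use \<phi>0 \<alpha>(2) in \<open>auto simp: \<beta>_def \<gamma>_def\<close>)
  moreover have "(\<lambda>k. \<integral>z. f (\<sigma> k) z \<partial>?M) \<longlonglongrightarrow> (\<integral>z. g z \<partial>?M)"
  proof (rule integral_dominated_convergence)
    show "g \<in> borel_measurable ?M" unfolding g_def p_flux_def by measurable
    show "f (\<sigma> k) \<in> borel_measurable ?M" for k unfolding f_def by measurable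
    show "integrable ?M (\<lambda>z. (L\<^sup>2 + 1) powr ((p - 1) / 2) * B)" by simp
    have "(\<lambda>k. f (\<sigma> k) z) \<longlonglongrightarrow> g z" for z
    proof (cases "?H z = 0")
      case True
      then show ?thesis by (simp add: f_def g_def)
    next
      case False
      then have "(\<lambda>k. ((norm (?H z))\<^sup>2 + \<sigma> k) powr \<gamma>) \<longlonglongrightarrow> ((norm (?H z))\<^sup>2 + 0) powr \<gamma>"
        by (intro tendsto_intros \<sigma>0) auto
      moreover have "((norm (?H z))\<^sup>2 + 0) powr \<gamma> = norm (?H z) powr (p - 2)"
        using False powr_powr[of "norm (?H z)" 2 \<gamma>] by (simp add: \<gamma>_def diff_divide_distrib)
      ultimately have l: "(\<lambda>k. ((norm (?H z))\<^sup>2 + \<sigma> k) powr \<gamma>) \<longlonglongrightarrow> norm (?H z) powr (p - 2)"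
        by simp
      have "(\<lambda>k. (exp (- \<beta> * ?N z) * ((norm (?H z))\<^sup>2 + \<sigma> k) powr \<gamma>) *\<^sub>R ?H z \<bullet> hgrad \<phi> z)
          \<longlonglongrightarrow> (exp (- \<beta> * ?N z) * norm (?H z) powr (p - 2)) *\<^sub>R ?H z \<bullet> hgrad \<phi> z"
        by (rule tendsto_inner[OF tendsto_scaleR[OF tendsto_mult[OF tendsto_const l] tendsto_const] tendsto_const])
      then show ?thesis by (simp add: f_def g_def p_flux_def mult_ac)
    qed
    then show "AE z in ?M. (\<lambda>k. f (\<sigma> k) z) \<longlonglongrightarrow> g z" by simp
    have "norm (f (\<sigma> k) z) \<le> (L\<^sup>2 + 1) powr ((p - 1) / 2) * B" if "z \<in> V" for k z
    proof -
      let ?m = "norm (?H z)"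
      have "norm (f (\<sigma> k) z) = exp (- \<beta> * ?N z) * ((?m\<^sup>2 + \<sigma> k) powr \<gamma> * \<bar>?H z \<bullet> hgrad \<phi> z\<bar>)"
        by (simp add: f_def abs_mult)
      also have "\<dots> \<le> 1 * ((?m\<^sup>2 + \<sigma> k) powr \<gamma> * (?m * norm (hgrad \<phi> z)))"
        using \<beta>0 gauge_pow4_nonneg[of a z] by (intro mult_mono Cauchy_Schwarz_ineq2) auto
      also have "\<dots> = ((?m\<^sup>2 + \<sigma> k) powr ((p - 2) / 2) * ?m) * norm (hgrad \<phi> z)" by (simp add: \<gamma>_def)
      also have "\<dots> \<le> (?m\<^sup>2 + 1) powr ((p - 1) / 2) * B"
        using B by (intro mult_mono powr_flux_bound[OF p _ \<sigma>]) auto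
      also have "\<dots> \<le> (L\<^sup>2 + 1) powr ((p - 1) / 2) * B"
        using B(1) p L[of z] that closure_subset[of V]
        by (intro mult_right_mono powr_mono2 add_mono power_mono) auto
      finally show ?thesis .
    qed
    then show "AE z in ?M. norm (f (\<sigma> k) z) \<le> (L\<^sup>2 + 1) powr ((p - 1) / 2) * B" for k
      by (intro AE_I2) (simp add: space_restrict_space)
  qed
  ultimately have g: "0 \<le> (\<integral>z. g z \<partial>?M)"
    by (intro LIMSEQ_le_const[of _ "\<integral>z. g z \<partial>?M"]) auto
  have "p_flux p (hgrad (barrier K \<alpha> a S) z) \<bullet> hgrad \<phi> z = - ((K * \<alpha>) powr (p - 1)) * g z" for z
  proof -
    have "(K * \<alpha> * exp (- \<alpha> * ?N z)) powr (p - 1) = (K * \<alpha>) powr (p - 1) * exp (- \<beta> * ?N z)"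
      using K \<alpha>(1) by (simp add: powr_mult exp_powr_real \<beta>_def mult_ac)
    then show ?thesis
      unfolding hgrad_barrier p_flux_minus using K \<alpha>(1) by (simp add: p_flux_scale g_def)
  qed
  then have "(\<integral>z. p_flux p (hgrad (barrier K \<alpha> a S) z) \<bullet> hgrad \<phi> z \<partial>?M) = - ((K * \<alpha>) powr (p - 1)) * (\<integral>z. g z \<partial>?M)"
    by simp
  also have "\<dots> \<le> 0" using g by (intro mult_nonpos_nonneg) auto
  finally show "(\<integral>z. p_flux p (hgrad (barrier K \<alpha> a S) z) \<bullet> hgrad \<phi> z \<partial>?M) \<le> 0" .
qed

lemma sobolev_approx_smooth:
  assumes V: "open V" "bounded V" and f: "Ck_on 1 UNIV f" and p: "p > 0"
  shows "sobolev_approx p V (\<lambda>k. f) f (hgrad f)"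
proof -
  interpret finite_measure "lebesgue_on V" by (rule finite_measure_lebesgue_on_bounded[OF V])
  have fV: "Ck_on 1 V f" by (rule Ck_on_subset[OF f subset_UNIV])
  have [measurable]: "f \<in> borel_measurable (lebesgue_on V)" "hgrad f \<in> borel_measurable (lebesgue_on V)"
    using V(1) continuous_imp_measurable_on_sets_lebesgue[OF Ck_on_1_continuous[OF fV]] measurable_hgrad[OF V(1) fV]
    by auto
  have "compact (closure V)" using V(2) by simp
  then have "bounded (hgrad f ` closure V)"
    by (intro compact_imp_bounded compact_continuous_image continuous_on_hgrad Ck_on_subset[OF f subset_UNIV])
  then obtain L where L: "\<And>z. z \<in> closure V \<Longrightarrow> norm (hgrad f z) \<le> L" by (auto simp: bounded_iff)
  have "integrable (lebesgue_on V) (\<lambda>z. norm (hgrad f z) powr p)"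
  proof (rule integrable_const_bound[where B = "L powr p"])
    show "AE z in lebesgue_on V. norm (norm (hgrad f z) powr p) \<le> L powr p"
      using L closure_subset[of V] p
      by (intro AE_I2) (auto simp: space_restrict_space intro!: powr_mono2)
  qed measurable
  with fV show ?thesis by (simp add: sobolev_approx_def del: Ck_on.simps One_nat_def)
qed

section \<open>Comparison with cut-offs\<close>

definition pos_sq :: "real \<Rightarrow> real" where "pos_sq x = (max 0 x)\<^sup>2"

lemma DERIV_pos_sq: "(pos_sq has_real_derivative 2 * max 0 x) (at x)"
proof -
  consider "x < 0" | "x = 0" | "x > 0" by linarith
  then show ?thesis
  proof cases
    case 1
    have "((\<lambda>x. 0) has_real_derivative 2 * max 0 x) (at x)" using 1 by simp
    then show ?thesis
      by (rule has_field_derivative_transform_within_open[where S = "{..<0}"])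
        (use 1 in \<open>auto simp: pos_sq_def\<close>)
  next
    case 2
    have "(\<lambda>h. pos_sq h / h) \<midarrow>0\<rightarrow> 0"
    proof (rule Lim_null_comparison)
      show "\<forall>\<^sub>F h in at 0. norm (pos_sq h / h) \<le> \<bar>h\<bar>"
        by (rule always_eventually) (auto simp: pos_sq_def max_def power2_eq_square)
      show "(\<lambda>h. \<bar>h\<bar>) \<midarrow>0\<rightarrow> (0::real)" by (rule tendsto_rabs_zero) (rule tendsto_ident_at)
    qed
    then show ?thesis using 2 by (simp add: DERIV_def pos_sq_def)
  next
    case 3
    have "((\<lambda>x. x\<^sup>2) has_real_derivative 2 * max 0 x) (at x)"
      using 3 by (auto intro!: derivative_eq_intros)
    then show ?thesis
      by (rule has_field_derivative_transform_within_open[where S = "{0<..}"])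
        (use 3 in \<open>auto simp: pos_sq_def\<close>)
  qed
qed

text \<open>
  The function \<open>max(0, x)\<^sup>2\<close> is \<open>C\<^sup>1\<close>.  Using it twice, the second time reflected, gives a \<open>C\<^sup>1\<close> step
  from \<open>0\<close> to \<open>1\<close> that is constant outside \<open>[0, 1]\<close>.
\<close>

definition step :: "real \<Rightarrow> real" where "step x = 1 - pos_sq (1 - pos_sq x)"

definition step_deriv :: "real \<Rightarrow> real" where
  "step_deriv x = 4 * max 0 (1 - pos_sq x) * max 0 x"

lemma DERIV_step: "(step has_real_derivative step_deriv x) (at x)"
proof -
  have "((\<lambda>x. 1 - pos_sq x) has_real_derivative - (2 * max 0 x)) (at x)"
    using DERIV_diff[OF DERIV_const DERIV_pos_sq] by simp
  from DERIV_diff[OF DERIV_const DERIV_chain2[OF DERIV_pos_sq this], of 1] show ?thesis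
    by (simp add: step_def[abs_def] step_deriv_def mult.assoc)
qed

lemma continuous_on_step_deriv: "continuous_on A step_deriv"
  unfolding step_deriv_def pos_sq_def by (intro continuous_intros)

lemma step_props:
  shows "x \<le> 0 \<Longrightarrow> step x = 0" "x \<ge> 1 \<Longrightarrow> step x = 1" "x > 0 \<Longrightarrow> step x > 0"
    "0 \<le> step x" "step x \<le> 1"
    "x \<le> 0 \<Longrightarrow> step_deriv x = 0" "x \<ge> 1 \<Longrightarrow> step_deriv x = 0" "0 \<le> step_deriv x" "step_deriv x \<le> 4"
proof -
  have sq1: "pos_sq x \<ge> 1" if "x \<ge> 1" using that by (simp add: pos_sq_def)
  have sq: "0 \<le> pos_sq y" for y by (simp add: pos_sq_def)
  have lt: "pos_sq (1 - pos_sq x) < 1" if "x > 0"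
  proof -
    have "pos_sq x > 0" using that by (simp add: pos_sq_def)
    then have "0 \<le> max 0 (1 - pos_sq x)" "max 0 (1 - pos_sq x) < 1" by auto
    then show ?thesis unfolding pos_sq_def[of "1 - pos_sq x"] by (simp add: power_less_one_iff)
  qed
  show "x \<le> 0 \<Longrightarrow> step x = 0" "x \<le> 0 \<Longrightarrow> step_deriv x = 0"
    by (auto simp: step_def step_deriv_def pos_sq_def)
  show "x \<ge> 1 \<Longrightarrow> step x = 1" "x \<ge> 1 \<Longrightarrow> step_deriv x = 0"
    using sq1 by (auto simp: step_def step_deriv_def pos_sq_def[of "1 - pos_sq x"])
  show "x > 0 \<Longrightarrow> step x > 0" using lt by (simp add: step_def)
  then show "0 \<le> step x" using \<open>x \<le> 0 \<Longrightarrow> step x = 0\<close> by (cases "x \<le> 0") auto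
  show "step x \<le> 1" using sq by (simp add: step_def)
  show "0 \<le> step_deriv x" by (simp add: step_deriv_def)
  show "step_deriv x \<le> 4"
  proof (cases "x \<ge> 1")
    case True
    then show ?thesis using \<open>x \<ge> 1 \<Longrightarrow> step_deriv x = 0\<close> by simp
  next
    case False
    then have "max 0 (1 - pos_sq x) * max 0 x \<le> 1 * 1" using sq[of x] by (intro mult_mono) auto
    then show ?thesis by (simp add: step_deriv_def)
  qed
qed

definition cutoff :: "(real \<Rightarrow> real) \<Rightarrow> (real \<Rightarrow> real) \<Rightarrow> bool" where
  "cutoff \<eta> \<eta>' \<longleftrightarrow> (\<forall>s. (\<eta> has_real_derivative \<eta>' s) (at s)) \<and> continuous_on UNIV \<eta>' \<and>
     (\<exists>L. \<forall>s. \<bar>\<eta>' s\<bar> \<le> L) \<and> (\<forall>s. 0 \<le> \<eta> s \<and> \<eta> s \<le> 1)"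

lemma DERIV_imp_continuous_on_UNIV:
  fixes h h' :: "real \<Rightarrow> real"
  assumes "\<And>s. (h has_real_derivative h' s) (at s)"
  shows "continuous_on UNIV h"
  using DERIV_isCont[OF assms] by (simp add: continuous_on_eq_continuous_at)

lemma cutoff_one: "cutoff (\<lambda>s. 1) (\<lambda>s. 0)"
  by (auto simp: cutoff_def)

definition plateau :: "real \<Rightarrow> real \<Rightarrow> real \<Rightarrow> real \<Rightarrow> real" where
  "plateau l r e s = step ((s - l) / e) * step ((r - s) / e)"

definition plateau_deriv :: "real \<Rightarrow> real \<Rightarrow> real \<Rightarrow> real \<Rightarrow> real" where
  "plateau_deriv l r e s =
     step_deriv ((s - l) / e) / e * step ((r - s) / e) - step_deriv ((r - s) / e) / e * step ((s - l) / e)"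

lemma cutoff_plateau:
  assumes "e > 0"
  shows "cutoff (plateau l r e) (plateau_deriv l r e)"
proof -
  have d1: "((\<lambda>s. (s - l) / e) has_real_derivative 1 / e) (at s)"
    and d2: "((\<lambda>s. (r - s) / e) has_real_derivative - 1 / e) (at s)" for s
    using assms by (auto intro!: derivative_eq_intros)
  have D: "(plateau l r e has_real_derivative plateau_deriv l r e s) (at s)" for s
    using DERIV_mult[OF DERIV_chain2[OF DERIV_step d1] DERIV_chain2[OF DERIV_step d2], of s]
    by (simp add: plateau_def[abs_def] plateau_deriv_def)
  have cs: "continuous_on UNIV step"
    by (rule DERIV_imp_continuous_on_UNIV[OF DERIV_step])
  have "continuous_on UNIV (plateau_deriv l r e)"
    unfolding plateau_deriv_def[abs_def] using assms
    by (intro continuous_intros continuous_on_compose2[OF cs] continuous_on_compose2[OF continuous_on_step_deriv]) auto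
  moreover have "\<bar>plateau_deriv l r e s\<bar> \<le> 4 / e + 4 / e" for s
  proof -
    have b: "\<bar>step_deriv x / e * step y\<bar> \<le> 4 / e" for x y
    proof -
      have "step_deriv x * step y \<le> 4 * 1" by (intro mult_mono) (auto simp: step_props)
      then show ?thesis using assms step_props(4)[of y] step_props(8)[of x] by (simp add: divide_right_mono)
    qed
    show ?thesis
      unfolding plateau_deriv_def using b[of "(s - l) / e" "(r - s) / e"] b[of "(r - s) / e" "(s - l) / e"] by linarith
  qed
  moreover have "0 \<le> plateau l r e s \<and> plateau l r e s \<le> 1" for s
    unfolding plateau_def using step_props by (auto intro!: mult_nonneg_nonneg mult_le_one)
  ultimately show ?thesis using D unfolding cutoff_def by blast
qed

lemma plateau_props:
  assumes "e > 0"
  shows "s \<le> l \<or> r \<le> s \<Longrightarrow> plateau l r e s = 0"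
    and "l + e \<le> s \<Longrightarrow> s \<le> r - e \<Longrightarrow> plateau l r e s = 1"
    and "s \<le> l \<or> r \<le> s \<or> l + e \<le> s \<and> s \<le> r - e \<Longrightarrow> plateau_deriv l r e s = 0"
proof -
  have 1: "step ((s - l) / e) = 0" "step_deriv ((s - l) / e) = 0" if "s \<le> l"
    using assms that by (simp_all add: step_props divide_nonpos_pos)
  have 2: "step ((r - s) / e) = 0" "step_deriv ((r - s) / e) = 0" if "r \<le> s"
    using assms that by (simp_all add: step_props divide_nonpos_pos)
  have 3: "step ((s - l) / e) = 1" "step_deriv ((s - l) / e) = 0" if "l + e \<le> s"
    using assms that by (simp_all add: step_props le_divide_eq)
  have 4: "step ((r - s) / e) = 1" "step_deriv ((r - s) / e) = 0" if "s \<le> r - e"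
    using assms that by (simp_all add: step_props le_divide_eq)
  show "s \<le> l \<or> r \<le> s \<Longrightarrow> plateau l r e s = 0" using 1 2 by (auto simp: plateau_def)
  show "l + e \<le> s \<Longrightarrow> s \<le> r - e \<Longrightarrow> plateau l r e s = 1" using 3 4 by (auto simp: plateau_def)
  show "s \<le> l \<or> r \<le> s \<or> l + e \<le> s \<and> s \<le> r - e \<Longrightarrow> plateau_deriv l r e s = 0"
    using 1 2 3 4 by (auto simp: plateau_deriv_def)
qed

text \<open>
  The cut-offs \<open>\<eta>\<^sub>1\<close>, \<open>\<eta>\<^sub>2\<close> force the approximating test functions to have compact support.  They
  do not disturb the sign condition of the comparison principle, because their derivatives vanish at the
  values of \<open>f\<^sub>1\<close> and \<open>f\<^sub>2\<close> wherever \<open>f\<^sub>1 > f\<^sub>2 + e\<close>.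
\<close>

lemma comparison_with_cutoffs:
  fixes V :: "'n::finite heis set"
  assumes p: "p > 1" and V: "open V" "bounded V"
    and a1: "sobolev_approx p V F1 f1 G1" and a2: "sobolev_approx p V F2 f2 G2"
    and c1: "continuous_on V f1" and c2: "continuous_on V f2"
    and sub: "weak_subsolution p V G1" and super: "weak_supersolution p V G2"
    and \<eta>1: "cutoff \<eta>1 \<eta>1'" and \<eta>2: "cutoff \<eta>2 \<eta>2'"
    and flat: "\<And>z. z \<in> V \<Longrightarrow> f1 z - f2 z > e \<Longrightarrow> \<eta>1' (f1 z) = 0 \<and> \<eta>2' (f2 z) = 0"
    and supp: "\<And>k. \<exists>C. compact C \<and> C \<subseteq> V \<and>
      (\<forall>z\<in>V - C. F1 k z - F2 k z \<le> e \<or> \<eta>1 (F1 k z) = 0 \<or> \<eta>2 (F2 k z) = 0)"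
    and z: "z \<in> V"
  shows "f1 z - f2 z \<le> e \<or> \<eta>1 (f1 z) = 0 \<or> \<eta>2 (f2 z) = 0"
proof -
  define P where "P s t = step (s - t - e) * (\<eta>1 s * \<eta>2 t)" for s t
  define P1 where "P1 s t = step_deriv (s - t - e) * (\<eta>1 s * \<eta>2 t) + step (s - t - e) * (\<eta>1' s * \<eta>2 t)" for s t
  define P2 where "P2 s t = - step_deriv (s - t - e) * (\<eta>1 s * \<eta>2 t) + step (s - t - e) * (\<eta>1 s * \<eta>2' t)" for s t
  from \<eta>1 obtain L1 where 1: "\<And>s. (\<eta>1 has_real_derivative \<eta>1' s) (at s)" "continuous_on UNIV \<eta>1'"
    "\<And>s. \<bar>\<eta>1' s\<bar> \<le> L1" "\<And>s. 0 \<le> \<eta>1 s" "\<And>s. \<eta>1 s \<le> 1" by (auto simp: cutoff_def)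
  from \<eta>2 obtain L2 where 2: "\<And>s. (\<eta>2 has_real_derivative \<eta>2' s) (at s)" "continuous_on UNIV \<eta>2'"
    "\<And>s. \<bar>\<eta>2' s\<bar> \<le> L2" "\<And>s. 0 \<le> \<eta>2 s" "\<And>s. \<eta>2 s \<le> 1" by (auto simp: cutoff_def)
  have cs: "continuous_on UNIV step" "continuous_on UNIV \<eta>1" "continuous_on UNIV \<eta>2"
    by (rule DERIV_imp_continuous_on_UNIV[OF DERIV_step] DERIV_imp_continuous_on_UNIV[OF 1(1)]
        DERIV_imp_continuous_on_UNIV[OF 2(1)])+
  have chain: "((\<lambda>x. h (l x)) has_derivative (\<lambda>v. h' * l' v)) (at x)"
    if "(h has_real_derivative h') (at (l x))" "(l has_derivative l') (at x)"
    for h :: "real \<Rightarrow> real" and h' and l :: "real \<times> real \<Rightarrow> real" and l' x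
    using has_derivative_compose[OF that(2) that(1)[unfolded has_field_derivative_def]] .
  have DP: "((\<lambda>x. P (fst x) (snd x)) has_derivative (\<lambda>x. P1 s t * fst x + P2 s t * snd x)) (at (s, t))" for s t
  proof -
    have l: "((\<lambda>x::real \<times> real. fst x - snd x - e) has_derivative (\<lambda>v. fst v - snd v)) (at (s, t))"
      by (auto intro!: derivative_eq_intros)
    have f: "((\<lambda>x::real \<times> real. fst x) has_derivative fst) (at (s, t))"
      "((\<lambda>x::real \<times> real. snd x) has_derivative snd) (at (s, t))"
      by (auto intro!: derivative_eq_intros)
    have A: "((\<lambda>x. step (fst x - snd x - e)) has_derivative (\<lambda>v. step_deriv (s - t - e) * (fst v - snd v))) (at (s, t))"
      by (rule chain[OF _ l]) (use DERIV_step[of "s - t - e"] in simp)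
    have B: "((\<lambda>x. \<eta>1 (fst x)) has_derivative (\<lambda>v. \<eta>1' s * fst v)) (at (s, t))"
      by (rule chain[OF _ f(1)]) (use 1(1)[of s] in simp)
    have C: "((\<lambda>x. \<eta>2 (snd x)) has_derivative (\<lambda>v. \<eta>2' t * snd v)) (at (s, t))"
      by (rule chain[OF _ f(2)]) (use 2(1)[of t] in simp)
    show ?thesis
      unfolding P_def P1_def P2_def
      by (rule has_derivative_eq_rhs[OF has_derivative_mult[OF A has_derivative_mult[OF B C]]])
        (auto simp: fun_eq_iff algebra_simps)
  qed
  have cP: "continuous_on UNIV (\<lambda>x. P1 (fst x) (snd x))" "continuous_on UNIV (\<lambda>x. P2 (fst x) (snd x))"
    unfolding P1_def P2_def
    by (auto intro!: continuous_intros continuous_on_compose2[OF cs(1)] continuous_on_compose2[OF cs(2)]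
        continuous_on_compose2[OF cs(3)] continuous_on_compose2[OF 1(2)] continuous_on_compose2[OF 2(2)]
        continuous_on_compose2[OF continuous_on_step_deriv[of UNIV]])
  have L: "0 \<le> L1" "0 \<le> L2" using 1(3)[of 0] 2(3)[of 0] by linarith+
  define B where "B = 5 + L1 + L2"
  have m: "\<bar>x * (y * w)\<bar> \<le> b" if "\<bar>x\<bar> * \<bar>y\<bar> \<le> b" "\<bar>w\<bar> \<le> 1" for x y w b :: real
  proof -
    have "\<bar>x * (y * w)\<bar> = (\<bar>x\<bar> * \<bar>y\<bar>) * \<bar>w\<bar>" by (simp add: abs_mult)
    also have "\<dots> \<le> (\<bar>x\<bar> * \<bar>y\<bar>) * 1" using that(2) by (intro mult_left_mono) auto
    finally show ?thesis using that(1) by simp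
  qed
  have b1: "\<bar>P1 s t\<bar> \<le> B" for s t
  proof -
    have "\<bar>step_deriv (s - t - e)\<bar> * \<bar>\<eta>1 s\<bar> \<le> 4 * 1"
      using 1(4,5) step_props(8,9) by (intro mult_mono) auto
    then have "\<bar>step_deriv (s - t - e) * (\<eta>1 s * \<eta>2 t)\<bar> \<le> 4" using 2(4,5) by (intro m) auto
    moreover have "\<bar>step (s - t - e)\<bar> * \<bar>\<eta>1' s\<bar> \<le> 1 * L1"
      using 1(3) step_props(4,5) by (intro mult_mono) auto
    then have "\<bar>step (s - t - e) * (\<eta>1' s * \<eta>2 t)\<bar> \<le> L1" using 2(4,5) by (intro m) auto
    ultimately show ?thesis using L unfolding P1_def B_def by linarith
  qed
  have b2: "\<bar>P2 s t\<bar> \<le> B" for s t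
  proof -
    have "\<bar>step_deriv (s - t - e)\<bar> * \<bar>\<eta>1 s\<bar> \<le> 4 * 1"
      using 1(4,5) step_props(8,9) by (intro mult_mono) auto
    then have "\<bar>step_deriv (s - t - e) * (\<eta>1 s * \<eta>2 t)\<bar> \<le> 4" using 2(4,5) by (intro m) auto
    moreover have "\<bar>step (s - t - e)\<bar> * \<bar>\<eta>2' t\<bar> \<le> 1 * L2"
      using 2(3) step_props(4,5) by (intro mult_mono) auto
    then have "\<bar>step (s - t - e) * (\<eta>2' t * \<eta>1 s)\<bar> \<le> L2" using 1(4,5) by (intro m) auto
    ultimately show ?thesis using L unfolding P2_def B_def by (simp add: mult.commute[of "\<eta>2' t"])
  qed
  have b3: "0 \<le> P s t" for s t unfolding P_def using 1(4) 2(4) step_props(4) by (intro mult_nonneg_nonneg) auto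
  have b4: "P s t \<le> B" for s t
  proof -
    have "P s t \<le> 1" unfolding P_def using 1(4,5) 2(4,5) step_props(4,5)
      by (intro mult_le_one mult_nonneg_nonneg) auto
    then show ?thesis using L by (simp add: B_def)
  qed
  have "P (f1 z) (f2 z) = 0"
  proof (rule comparison_principle[OF p V a1 a2 c1 c2 sub super DP cP b1 b2 b3 b4 _ _ z])
    fix k
    show "\<exists>C. compact C \<and> C \<subseteq> V \<and> (\<forall>z\<in>V - C. P (F1 k z) (F2 k z) = 0)"
    proof -
      obtain C where C: "compact C" "C \<subseteq> V"
        "\<And>z. z \<in> V - C \<Longrightarrow> F1 k z - F2 k z \<le> e \<or> \<eta>1 (F1 k z) = 0 \<or> \<eta>2 (F2 k z) = 0"
        using supp[of k] by blast
      have "P (F1 k z) (F2 k z) = 0" if "z \<in> V - C" for z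
        using C(3)[OF that] step_props(1)[of "F1 k z - F2 k z - e"] by (auto simp: P_def)
      with C show ?thesis by blast
    qed
  next
    fix z assume "z \<in> V"
    show "0 \<le> P1 (f1 z) (f2 z) \<and> P2 (f1 z) (f2 z) = - P1 (f1 z) (f2 z)"
    proof (cases "f1 z - f2 z > e")
      case True
      with flat[OF \<open>z \<in> V\<close>] show ?thesis
        using 1(4) 2(4) step_props(8) by (simp add: P1_def P2_def)
    next
      case False
      then show ?thesis
        using step_props(1,6)[of "f1 z - f2 z - e"] by (simp add: P1_def P2_def)
    qed
  qed
  then show ?thesis
    using step_props(3)[of "f1 z - f2 z - e"] by (auto simp: P_def not_le)
qed

section \<open>Gauge balls and the Euclidean topology\<close>

lemma continuous_on_gauge_pow4 [continuous_intros]: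
  assumes "continuous_on T a" "continuous_on T z"
  shows "continuous_on T (\<lambda>x. gauge_pow4 (a x) (z x))"
  unfolding gauge_pow4_def hor_sq_def hor_diff_def vert_diff_def inner_prod_def fst_conv snd_conv
  by (intro continuous_intros assms)

lemma gauge_pow4_self: "gauge_pow4 a a = 0"
  by (simp add: gauge_pow4_def hor_sq_def hor_diff_def vert_diff_def inner_commute)

lemma open_gauge_less: "open {z. gauge_pow4 a z < S}"
  by (intro open_Collect_less continuous_intros)

text \<open>
  The vertical coordinate of \<open>z - a\<close> differs from \<open>T\<close> by \<open>2 \<langle>a, J \<xi>\<rangle>\<close>, whence the factor \<open>|a|\<close>.
  So gauge balls are Euclidean neighbourhoods, uniformly for centres in a bounded set.
\<close>

lemma norm_diff_le_gauge:
  fixes a z :: "'n::finite heis"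
  assumes "0 \<le> r" "gauge_pow4 a z \<le> r ^ 4"
  shows "norm (z - a) \<le> 2 * r + r\<^sup>2 + 4 * norm a * r"
proof -
  have r4: "r ^ 4 = (r\<^sup>2)\<^sup>2" by simp
  have "(hor_sq a z)\<^sup>2 \<le> (r\<^sup>2)\<^sup>2" "(vert_diff a z)\<^sup>2 \<le> (r\<^sup>2)\<^sup>2"
    using assms(2) unfolding r4 gauge_pow4_def
    by (smt (verit) zero_le_power2)+
  then have q: "hor_sq a z \<le> r\<^sup>2" and t: "\<bar>vert_diff a z\<bar> \<le> r\<^sup>2"
    by (auto intro: power2_le_imp_le abs_le_square_iff[THEN iffD2, of _ "r\<^sup>2", simplified])
  let ?x = "fst z - fst a" and ?y = "fst (snd z) - fst (snd a)"
  have "(norm ?x)\<^sup>2 + (norm ?y)\<^sup>2 \<le> r\<^sup>2"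
    using q by (simp add: hor_sq_def hor_diff_def inner_prod_def power2_norm_eq_inner)
  then have "(norm ?x)\<^sup>2 \<le> r\<^sup>2" "(norm ?y)\<^sup>2 \<le> r\<^sup>2" by (smt (verit) zero_le_power2)+
  then have x: "norm ?x \<le> r" and y: "norm ?y \<le> r" using assms(1) by (auto intro: power2_le_imp_le)
  have "snd (snd z) - snd (snd a) = vert_diff a z - 2 * (fst a \<bullet> ?y - fst (snd a) \<bullet> ?x)"
    by (simp add: vert_diff_def inner_diff_right inner_commute)
  moreover have "\<bar>fst a \<bullet> ?y\<bar> \<le> norm a * r"
  proof -
    have "\<bar>fst a \<bullet> ?y\<bar> \<le> norm (fst a) * norm ?y" by (rule Cauchy_Schwarz_ineq2)
    also have "\<dots> \<le> norm a * r" using norm_fst_le[of "fst a" "snd a"] y by (intro mult_mono) auto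
    finally show ?thesis .
  qed
  moreover have "\<bar>fst (snd a) \<bullet> ?x\<bar> \<le> norm a * r"
  proof -
    have "norm (fst (snd a)) \<le> norm a"
      using norm_fst_le[of "fst (snd a)" "snd (snd a)"] norm_snd_le[of "snd a" "fst a"] by simp
    have "\<bar>fst (snd a) \<bullet> ?x\<bar> \<le> norm (fst (snd a)) * norm ?x" by (rule Cauchy_Schwarz_ineq2)
    also have "\<dots> \<le> norm a * r" using \<open>norm (fst (snd a)) \<le> norm a\<close> x by (intro mult_mono) auto
    finally show ?thesis .
  qed
  moreover have "\<bar>d\<bar> \<le> r\<^sup>2 + 4 * m"
    if "d = vert_diff a z - 2 * (x - y)" "\<bar>x\<bar> \<le> m" "\<bar>y\<bar> \<le> m" for d x y m :: real
    using that t by (auto simp: abs_le_iff)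
  ultimately have "\<bar>snd (snd z) - snd (snd a)\<bar> \<le> r\<^sup>2 + 4 * norm a * r"
    by (simp only: mult.assoc)
  moreover have "norm (z - a) \<le> norm ?x + (norm ?y + \<bar>snd (snd z) - snd (snd a)\<bar>)"
  proof -
    have tri: "norm w \<le> norm (fst w) + norm (snd w)" for w :: "'c::real_normed_vector \<times> 'd::real_normed_vector"
      using norm_Pair_le[of "fst w" "snd w"] by simp
    show ?thesis using tri[of "z - a"] tri[of "snd (z - a)"] by simp
  qed
  ultimately show ?thesis using x y by linarith
qed

lemma small_gauge_balls:
  assumes "\<epsilon> > 0"
  obtains S where "S > 0" "\<And>a z :: 'n::finite heis. norm a \<le> B \<Longrightarrow> gauge_pow4 a z \<le> S \<Longrightarrow> dist a z < \<epsilon>"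
proof -
  define C where "C = 3 + 4 * \<bar>B\<bar>"
  define r where "r = min 1 (\<epsilon> / (2 * C))"
  have C: "C > 0" by (simp add: C_def)
  have r: "0 < r" "r \<le> 1" using assms C by (auto simp: r_def)
  have "dist a z < \<epsilon>" if "norm a \<le> B" "gauge_pow4 a z \<le> r ^ 4" for a z :: "'n heis"
  proof -
    have "norm (z - a) \<le> 2 * r + r\<^sup>2 + 4 * norm a * r" by (rule norm_diff_le_gauge) (use r that in auto)
    also have "\<dots> \<le> 2 * r + r + 4 * \<bar>B\<bar> * r"
      using r that by (intro add_mono mult_mono) (auto simp: power2_eq_square mult_left_le)
    also have "\<dots> = C * r" by (simp add: C_def algebra_simps)
    also have "\<dots> \<le> C * (\<epsilon> / (2 * C))" using C by (intro mult_left_mono) (auto simp: r_def)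
    also have "\<dots> = \<epsilon> / 2" using C by simp
    also have "\<dots> < \<epsilon>" using assms by simp
    finally show ?thesis by (simp add: dist_norm norm_minus_commute)
  qed
  with r that[of "r ^ 4"] show ?thesis by simp
qed

lemma bounded_gauge_balls:
  obtains R where "\<And>a z :: 'n::finite heis. norm a \<le> B \<Longrightarrow> gauge_pow4 a z \<le> S \<Longrightarrow> norm z \<le> R"
proof -
  define r where "r = max 1 S"
  have r: "1 \<le> r" "S \<le> r" by (auto simp: r_def)
  have "S \<le> r ^ 4" using r power_increasing[of 1 4 r] by simp
  have "norm z \<le> B + (2 * r + r\<^sup>2 + 4 * B * r)" if "norm a \<le> B" "gauge_pow4 a z \<le> S" for a z :: "'n heis"
  proof -
    have "norm (z - a) \<le> 2 * r + r\<^sup>2 + 4 * norm a * r"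
      by (rule norm_diff_le_gauge) (use r that \<open>S \<le> r ^ 4\<close> in auto)
    also have "\<dots> \<le> 2 * r + r\<^sup>2 + 4 * B * r" using that r by (simp add: mult_right_mono)
    finally show ?thesis using that(1) norm_triangle_sub[of z a] by linarith
  qed
  with that show ?thesis by blast
qed

lemma compact_gauge_le: "compact {z. gauge_pow4 a z \<le> S}"
proof -
  obtain R where "\<And>b z :: 'a heis. norm b \<le> norm a \<Longrightarrow> gauge_pow4 b z \<le> S \<Longrightarrow> norm z \<le> R"
    using bounded_gauge_balls by blast
  then have "bounded {z. gauge_pow4 a z \<le> S}" unfolding bounded_iff by blast
  then show ?thesis
    by (intro compact_eq_bounded_closed[THEN iffD2] conjI closed_Collect_le continuous_intros)
qed

section \<open>One-sided barriers for capacitary functions\<close>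

text \<open>
  The properties shared by the solution \<open>u\<close>, with \<open>A = \<Omega>\<^sub>2\<close>, and by \<open>1 - u\<close>, with \<open>A\<close> the exterior
  of \<open>\<Omega>\<^sub>1\<close>: a function on the ring \<open>U\<close> with values in \<open>[0, 1]\<close>, weakly \<open>p\<close>-superharmonic, with
  weak boundary value \<open>1\<close> on the part of \<open>\<partial>U\<close> inside \<open>A\<close>.  The last assumption expresses the
  boundary value through the approximating functions.
\<close>

locale capacitary =
  fixes p :: real and A U :: "'n::finite heis set" and v :: "'n heis \<Rightarrow> real"
    and G :: "'n heis \<Rightarrow> (real ^ 'n) \<times> (real ^ 'n)" and F :: "nat \<Rightarrow> 'n heis \<Rightarrow> real"
  assumes p: "p > 1" and open_A: "open A" and open_U: "open U" and bounded_U: "bounded U"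
    and cont: "continuous_on U v" and range: "\<And>z. z \<in> U \<Longrightarrow> 0 \<le> v z" "\<And>z. z \<in> U \<Longrightarrow> v z \<le> 1"
    and approx: "sobolev_approx p U F v G" and super: "weak_supersolution p U G"
    and boundary: "\<And>k K e. compact K \<Longrightarrow> K \<subseteq> A \<Longrightarrow> e > 0 \<Longrightarrow>
      \<exists>C. compact C \<and> C \<subseteq> U \<and> (\<forall>z\<in>U \<inter> K - C. F k z > 1 - e)"

lemma sobolev_approx_subset:
  assumes "sobolev_approx p U F f G" "open V" "open U" "V \<subseteq> U"
  shows "sobolev_approx p V F f G"
proof -
  have s: "U \<in> sets lebesgue" "V \<in> sets lebesgue" using assms by auto
  have M: "lebesgue_on V = restrict_space (lebesgue_on U) V"
    using assms(4) s by (simp add: restrict_restrict_space Int_absorb1)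
  have V: "V \<in> sets (lebesgue_on U)" using s assms(4) by (simp add: sets_restrict_space_iff)
  then have V': "V \<inter> space (lebesgue_on U) \<in> sets (lebesgue_on U)"
    using assms(4) s by (simp add: space_restrict_space Int_absorb2)
  have int: "integrable (lebesgue_on V) g" if "integrable (lebesgue_on U) g" for g :: "'a heis \<Rightarrow> real"
    unfolding M integrable_restrict_space[OF V'] using integrable_mult_indicator[OF V that] by simp
  have le: "(\<integral>\<^sup>+z. g z \<partial>lebesgue_on V) \<le> (\<integral>\<^sup>+z. g z \<partial>lebesgue_on U)" for g
    unfolding M by (subst nn_integral_restrict_space[OF V']) (intro nn_integral_mono, auto simp: indicator_def)
  have meas: "g \<in> borel_measurable (lebesgue_on V)" if "g \<in> borel_measurable (lebesgue_on U)"
    for g :: "'a heis \<Rightarrow> 'c::topological_space"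
    unfolding M using that by (rule measurable_restrict_space1)
  have ae: "AE z in lebesgue_on V. Q z" if "AE z in lebesgue_on U. Q z" for Q
    using that s assms(4) by (auto simp: AE_restrict_space_iff elim!: eventually_mono)
  have "(\<lambda>k. \<integral>\<^sup>+z. norm (hgrad (F k) z - G z) powr p \<partial>lebesgue_on V) \<longlonglongrightarrow> 0"
  proof (rule tendsto_sandwich[OF _ _ tendsto_const])
    show "(\<lambda>k. \<integral>\<^sup>+z. norm (hgrad (F k) z - G z) powr p \<partial>lebesgue_on U) \<longlonglongrightarrow> 0"
      using assms(1) by (simp add: sobolev_approx_def)
  qed (auto intro!: always_eventually le)
  note lim = this
  show ?thesis
    using assms(1) unfolding sobolev_approx_def
  proof (elim conjE, intro conjI allI lim)
    show "Ck_on 1 V (F k)" if "\<forall>k. Ck_on 1 U (F k)" for k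
      using that Ck_on_subset[OF _ assms(4)] by blast
  qed (rule meas int ae; blast)+
qed

lemma integral_C1_0_subset:
  assumes "open V" "V \<subseteq> U" "\<phi> \<in> C1_0 V" "open U"
  shows "(\<integral>z. Y z \<bullet> hgrad \<phi> z \<partial>lebesgue_on V) = (\<integral>z. Y z \<bullet> hgrad \<phi> z \<partial>lebesgue_on U)"
proof -
  have 0: "hgrad \<phi> z = 0" if "z \<notin> V" for z using C1_0_zero_outside(2)[OF assms(3) that] .
  have "(\<integral>z. Y z \<bullet> hgrad \<phi> z \<partial>lebesgue_on W) = (\<integral>z. Y z \<bullet> hgrad \<phi> z \<partial>lebesgue)" if "open W" "V \<subseteq> W" for W
  proof -
    have "(\<integral>z. Y z \<bullet> hgrad \<phi> z \<partial>lebesgue_on W) = (\<integral>z. indicator W z *\<^sub>R (Y z \<bullet> hgrad \<phi> z) \<partial>lebesgue)"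
      using that by (intro integral_restrict_space) auto
    also have "(\<lambda>z. indicator W z *\<^sub>R (Y z \<bullet> hgrad \<phi> z)) = (\<lambda>z. Y z \<bullet> hgrad \<phi> z)"
    proof
      fix z
      show "indicator W z *\<^sub>R (Y z \<bullet> hgrad \<phi> z) = Y z \<bullet> hgrad \<phi> z"
      proof (cases "z \<in> W")
      case False
      with that(2) have "hgrad \<phi> z = 0" by (intro 0) blast
      then show ?thesis by simp
      qed simp
    qed
    finally show ?thesis .
  qed
  with assms show ?thesis by simp
qed

lemma weak_subsolution_subset:
  assumes "weak_subsolution p U G" "open V" "V \<subseteq> U" "open U"
  shows "weak_subsolution p V G"
  unfolding weak_subsolution_def
proof (intro ballI impI)
  fix \<phi> assume \<phi>: "\<phi> \<in> C1_0 V" "\<forall>z. 0 \<le> \<phi> z"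
  show "(\<integral>z. p_flux p (G z) \<bullet> hgrad \<phi> z \<partial>lebesgue_on V) \<le> 0"
    unfolding integral_C1_0_subset[OF assms(2,3) \<phi>(1) assms(4)]
    using assms(1) C1_0_mono[OF assms(2,3) \<phi>(1)] \<phi>(2) unfolding weak_subsolution_def by blast
qed

lemma weak_supersolution_subset:
  assumes "weak_supersolution p U G" "open V" "V \<subseteq> U" "open U"
  shows "weak_supersolution p V G"
  unfolding weak_supersolution_def
proof (intro ballI impI)
  fix \<phi> assume \<phi>: "\<phi> \<in> C1_0 V" "\<forall>z. 0 \<le> \<phi> z"
  show "0 \<le> (\<integral>z. p_flux p (G z) \<bullet> hgrad \<phi> z \<partial>lebesgue_on V)"
    unfolding integral_C1_0_subset[OF assms(2,3) \<phi>(1) assms(4)]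
    using assms(1) C1_0_mono[OF assms(2,3) \<phi>(1)] \<phi>(2) unfolding weak_supersolution_def by blast
qed

context capacitary
begin

text \<open>
  The barrier is compared with \<open>v\<close> outside a smaller gauge ball, even where the larger one leaves
  \<open>U\<close>: there \<open>v\<close> has the boundary value \<open>1\<close>.
\<close>

lemma barrier_le:
  assumes s: "0 < s" "s < S" and c: "0 < c" "c \<le> 1"
    and ball: "{z. gauge_pow4 a z < S} \<subseteq> A"
    and inner: "\<And>z. z \<in> U \<Longrightarrow> gauge_pow4 a z \<le> s \<Longrightarrow> c \<le> v z"
    and \<alpha>: "\<alpha> > 0" "16 * (\<alpha> * (p - 1)) * (s / 2) \<ge> 16 + 8 * real CARD('n) + 24 * \<bar>(p - 2) / 2\<bar>"
    and z: "z \<in> U" "s \<le> gauge_pow4 a z"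
  shows "c / (exp (- \<alpha> * s) - exp (- \<alpha> * S)) * (exp (- \<alpha> * gauge_pow4 a z) - exp (- \<alpha> * S)) \<le> v z"
proof -
  define K where "K = c / (exp (- \<alpha> * s) - exp (- \<alpha> * S))"
  have "exp (- \<alpha> * S) < exp (- \<alpha> * s)" using s \<alpha> by simp
  then have K: "K > 0" using c by (simp add: K_def)
  define b where "b = barrier K \<alpha> a S"
  define h where "h r = K * (exp (- \<alpha> * r) - exp (- \<alpha> * S))" for r
  have bh: "b w = h (gauge_pow4 a w)" for w by (simp add: b_def barrier_def h_def)
  have h_less: "h r < h r' \<longleftrightarrow> r' < r" for r r' using K \<alpha> by (simp add: h_def)
  have h_le: "h r \<le> h r' \<longleftrightarrow> r' \<le> r" for r r' using K \<alpha> by (simp add: h_def)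
  have "c / D * D = c" if "D > 0" for D :: real using that by simp
  then have hs: "h s = c" using \<open>exp (- \<alpha> * S) < exp (- \<alpha> * s)\<close> unfolding h_def K_def
    by (metis diff_gt_0_iff_gt)
  have hS: "h S = 0" by (simp add: h_def)
  define V where "V = U \<inter> {z. s / 2 < gauge_pow4 a z}"
  have V: "open V" "bounded V" "V \<subseteq> U"
    using open_U bounded_U
    by (auto simp: V_def intro!: open_Int open_Collect_less continuous_intros bounded_Int)
  have zV: "z \<in> V" using z s by (simp add: V_def)
  have Cb: "Ck_on 1 W b" for W unfolding b_def by (rule Ck_on_1_barrier)
  have cb: "continuous_on W b" for W by (rule Ck_on_1_continuous[OF Cb])
  have "b z - v z \<le> e" if e: "e > 0" "e < h (s / 2) - c" for e
  proof -
    \<comment> \<open>The cut-off in the values of \<open>b\<close> confines the test functions to a compact part of the gauge ball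
      and away from the inner ball.  The condition on its derivative holds because \<open>v \<ge> 0\<close> makes \<open>b > e\<close>, and
      \<open>v \<ge> c\<close> in the inner ball excludes \<open>c < b < c + e / 2\<close>, wherever \<open>b > v + e\<close>.\<close>
    let ?\<eta> = "plateau (e / 2) (c + e / 2) (e / 2)" and ?\<eta>' = "plateau_deriv (e / 2) (c + e / 2) (e / 2)"
    have e2: "e / 2 > 0" using e by simp
    note pl = plateau_props[OF e2]
    have "b z - v z \<le> e \<or> ?\<eta> (b z) = 0 \<or> (1::real) = 0"
    proof (rule comparison_with_cutoffs[OF p V(1,2), where ?\<eta>2.0 = "\<lambda>t. 1" and \<eta>2' = "\<lambda>t. 0"])
      show "sobolev_approx p V (\<lambda>k. b) b (hgrad b)"
        using p by (intro sobolev_approx_smooth V Cb) auto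
      show "sobolev_approx p V F v G" by (rule sobolev_approx_subset[OF approx V(1) open_U V(3)])
      show "continuous_on V b" "continuous_on V v" using cb continuous_on_subset[OF cont V(3)] .
      show "weak_subsolution p V (hgrad b)"
        unfolding b_def using K \<alpha> by (intro barrier_weak_subsolution[OF p V(1,2), where s = "s / 2"]) (auto simp: V_def)
      show "weak_supersolution p V G" by (rule weak_supersolution_subset[OF super V(1,3) open_U])
      show "cutoff ?\<eta> ?\<eta>'" by (rule cutoff_plateau[OF e2])
      show "cutoff (\<lambda>t. 1) (\<lambda>t. 0)" by (rule cutoff_one)
      show "z \<in> V" by (rule zV)
    next
      fix w assume w: "w \<in> V" "e < b w - v w"
      have wU: "w \<in> U" using w V by blast
      have "b w > e" using w range(1)[OF wU] by linarith
      moreover have "\<not> (c < b w \<and> b w < c + e / 2)"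
      proof
        assume cb: "c < b w \<and> b w < c + e / 2"
        then have "gauge_pow4 a w < s" using hs h_less bh by metis
        then have "c \<le> v w" using inner[OF wU] by simp
        then show False using w cb by linarith
      qed
      ultimately show "?\<eta>' (b w) = 0 \<and> (0::real) = 0" using pl(3)[of "b w"] by auto
    next
      fix k
      let ?K = "{w. e / 2 \<le> b w}"
      have "closed ?K" by (intro closed_Collect_le cb continuous_intros)
      moreover have sub: "?K \<subseteq> {w. gauge_pow4 a w < S}"
      proof
        fix w assume "w \<in> ?K"
        then have "h S < h (gauge_pow4 a w)" using e2 hS bh by simp
        then show "w \<in> {w. gauge_pow4 a w < S}" using h_less by simp
      qed
      ultimately have "compact ?K"
        using compact_Int_closed[OF compact_gauge_le[of a S], of ?K] by (simp add: Int_absorb1 subset_iff less_imp_le)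
      then obtain C where C: "compact C" "C \<subseteq> U" "\<And>w. w \<in> U \<inter> ?K - C \<Longrightarrow> F k w > 1 - e / 2"
        using boundary[of ?K "e / 2" k] sub ball e2 by blast
      show "\<exists>C. compact C \<and> C \<subseteq> V \<and> (\<forall>w\<in>V - C. b w - F k w \<le> e \<or> ?\<eta> (b w) = 0 \<or> (1::real) = 0)"
      proof (intro exI conjI ballI)
        show "compact (C \<inter> {w. b w \<le> c + e / 2})"
          by (intro compact_Int_closed C closed_Collect_le cb continuous_intros)
        show "C \<inter> {w. b w \<le> c + e / 2} \<subseteq> V"
        proof
          fix w assume w: "w \<in> C \<inter> {w. b w \<le> c + e / 2}"
          then have "h (gauge_pow4 a w) < h (s / 2)" using e bh by auto
          then show "w \<in> V" using w C(2) h_less by (auto simp: V_def)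
        qed
        fix w assume w: "w \<in> V - C \<inter> {w. b w \<le> c + e / 2}"
        show "b w - F k w \<le> e \<or> ?\<eta> (b w) = 0 \<or> (1::real) = 0"
        proof (cases "e / 2 < b w \<and> b w < c + e / 2")
          case True
          then have "F k w > 1 - e / 2" using w V(3) by (intro C(3)) auto
          then show ?thesis using True c by linarith
        next
          case False
          then show ?thesis using pl(1)[of "b w"] by auto
        qed
      qed
    qed
    then have "b z - v z \<le> e \<or> ?\<eta> (b z) = 0" by simp
    moreover have "?\<eta> (b z) = 1" if "b z - v z > e"
    proof (rule pl(2))
      show "e / 2 + e / 2 \<le> b z" using that range(1)[OF z(1)] by linarith
      show "b z \<le> c + e / 2 - e / 2" using z(2) hs h_le bh by (metis add_diff_cancel_right')
    qed
    ultimately show ?thesis by fastforce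
  qed
  moreover have "h (s / 2) - c > 0" using hs h_less[of s "s / 2"] s by simp
  ultimately have "b z - v z \<le> 0"
    by (metis dense_ge_bounded)
  then show ?thesis by (simp add: b_def barrier_def K_def)
qed

end

section \<open>Positivity\<close>

lemma barrier_exponent_exists:
  fixes p s :: real
  assumes "p > 1" "s > 0"
  obtains \<alpha> where "\<alpha> > 0" "16 * (\<alpha> * (p - 1)) * (s / 2) \<ge> 16 + 8 * real N + 24 * \<bar>(p - 2) / 2\<bar>"
proof
  let ?c = "16 + 8 * real N + 24 * \<bar>(p - 2) / 2\<bar>"
  show "?c / (8 * (p - 1) * s) > 0" using assms by (intro divide_pos_pos add_pos_nonneg) auto
  have "16 * (?c / (8 * (p - 1) * s) * (p - 1)) * (s / 2) = ?c" using assms by (simp add: field_simps)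
  then show "16 * (?c / (8 * (p - 1) * s) * (p - 1)) * (s / 2) \<ge> ?c" by simp
qed

context capacitary
begin

definition positive_near :: "'n heis \<Rightarrow> bool" where
  "positive_near z \<longleftrightarrow> (\<exists>c>0. \<exists>W. open W \<and> z \<in> W \<and> (\<forall>w\<in>W \<inter> U. c \<le> v w))"

text \<open>
  The barrier is positive in the whole gauge ball, so positivity at the centre spreads to the
  ball.  This replaces the strong maximum principle.
\<close>

lemma positive_near_spreads:
  assumes a: "positive_near a" and ball: "{z. gauge_pow4 a z < S} \<subseteq> A" and z: "gauge_pow4 a z < S"
  shows "positive_near z"
proof -
  obtain c W where c: "0 < c" and W: "open W" "a \<in> W" "\<And>w. w \<in> W \<inter> U \<Longrightarrow> c \<le> v w"
    using a by (auto simp: positive_near_def)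
  define c1 where "c1 = min 1 c"
  have c1: "0 < c1" "c1 \<le> 1" "c1 \<le> c" using c by (auto simp: c1_def)
  obtain \<epsilon> where \<epsilon>: "\<epsilon> > 0" "ball a \<epsilon> \<subseteq> W" using W(1,2) open_contains_ball by blast
  obtain s0 where s0: "s0 > 0" "\<And>b w :: 'n heis. norm b \<le> norm a \<Longrightarrow> gauge_pow4 b w \<le> s0 \<Longrightarrow> dist b w < \<epsilon>"
    using small_gauge_balls[OF \<epsilon>(1)] by blast
  have S: "0 < S" using z gauge_pow4_nonneg[of a z] by linarith
  define s where "s = min s0 (S / 2)"
  have s: "0 < s" "s < S" using s0 S by (auto simp: s_def)
  have inner: "c1 \<le> v w" if "w \<in> U" "gauge_pow4 a w \<le> s" for w
  proof -
    have "dist a w < \<epsilon>" using that(2) by (intro s0(2)) (auto simp: s_def)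
    then have "w \<in> W" using \<epsilon>(2) mem_ball by blast
    then show ?thesis using W(3)[of w] that(1) c1(3) by simp
  qed
  obtain \<alpha> where \<alpha>: "\<alpha> > 0" "16 * (\<alpha> * (p - 1)) * (s / 2) \<ge> 16 + 8 * real CARD('n) + 24 * \<bar>(p - 2) / 2\<bar>"
    using barrier_exponent_exists[OF p s(1)] by blast
  define D where "D = exp (- \<alpha> * s) - exp (- \<alpha> * S)"
  have D: "D > 0" using s \<alpha> by (simp add: D_def)
  define r where "r = (max s (gauge_pow4 a z) + S) / 2"
  have r: "gauge_pow4 a z < r" "r < S" using z s by (auto simp: r_def)
  define c2 where "c2 = c1 / D * (exp (- \<alpha> * r) - exp (- \<alpha> * S))"
  have c2: "c2 > 0" using c1 D r \<alpha> by (simp add: c2_def)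
  have "min c1 c2 \<le> v w" if w: "w \<in> {w. gauge_pow4 a w < r} \<inter> U" for w
  proof (cases "gauge_pow4 a w \<le> s")
    case True
    then show ?thesis using inner[of w] w by simp
  next
    case False
    have "c2 \<le> c1 / D * (exp (- \<alpha> * gauge_pow4 a w) - exp (- \<alpha> * S))"
      unfolding c2_def using w c1 D \<alpha> by (intro mult_left_mono) auto
    also have "\<dots> \<le> v w"
      unfolding D_def using barrier_le[OF s c1(1,2) ball inner \<alpha>, of w] w False by simp
    finally show ?thesis by simp
  qed
  moreover have "0 < min c1 c2" using c1 c2 by simp
  ultimately show ?thesis
    unfolding positive_near_def using open_gauge_less[of a r] r(1) by blast
qed

text \<open>
  The points near which \<open>v\<close> is bounded below form an open set, and by the preceding lemma a set
  that is closed in \<open>A\<close>: around all points near a limit point, gauge balls of one size lie in \<open>A\<close>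
  and contain that limit point.
\<close>

lemma positive_near_connected:
  assumes C: "connected C" "C \<subseteq> A" and meets: "z0 \<in> C" "positive_near z0" and z: "z \<in> C"
  shows "positive_near z"
proof -
  let ?P = "{z. positive_near z}"
  have "open ?P"
  proof (subst open_subopen, rule ballI)
    fix z assume "z \<in> ?P"
    then obtain c W where "0 < c" "open W" "z \<in> W" "\<forall>w\<in>W \<inter> U. c \<le> v w"
      by (auto simp: positive_near_def)
    then have "W \<subseteq> ?P" by (auto simp: positive_near_def)
    with \<open>open W\<close> \<open>z \<in> W\<close> show "\<exists>T. open T \<and> z \<in> T \<and> T \<subseteq> ?P" by blast
  qed
  have closed: "z \<in> ?P" if z: "z \<in> A" "z \<in> closure ?P" for z
  proof -
    obtain \<epsilon> where \<epsilon>: "\<epsilon> > 0" "ball z \<epsilon> \<subseteq> A" using open_A z(1) open_contains_ball by blast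
    obtain S where S: "S > 0"
      "\<And>b w :: 'n heis. norm b \<le> norm z + \<epsilon> \<Longrightarrow> gauge_pow4 b w \<le> S \<Longrightarrow> dist b w < \<epsilon> / 2"
      using small_gauge_balls[of "\<epsilon> / 2" "norm z + \<epsilon>"] \<epsilon>(1) by auto
    define W where "W = ball z (\<epsilon> / 2) \<inter> {b. gauge_pow4 b z < S}"
    have "open W" unfolding W_def by (intro open_Int open_ball open_Collect_less continuous_intros)
    moreover have "z \<in> W" using \<epsilon>(1) S(1) by (simp add: W_def gauge_pow4_self)
    ultimately obtain b where b: "b \<in> W" "positive_near b"
      using z(2) unfolding closure_iff_nhds_not_empty by blast
    have "dist z b < \<epsilon> / 2" using b(1) by (simp add: W_def)
    then have "norm b \<le> norm z + \<epsilon>"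
      using norm_triangle_sub[of b z] \<epsilon>(1) by (simp add: dist_norm norm_minus_commute)
    have "{w. gauge_pow4 b w < S} \<subseteq> A"
    proof
      fix w assume "w \<in> {w. gauge_pow4 b w < S}"
      then have "dist b w < \<epsilon> / 2" using S(2)[OF \<open>norm b \<le> norm z + \<epsilon>\<close>, of w] by simp
      then have "dist z w < \<epsilon>" using \<open>dist z b < \<epsilon> / 2\<close> dist_triangle[of z w b] by linarith
      then show "w \<in> A" using \<epsilon>(2) by auto
    qed
    then show ?thesis using positive_near_spreads[OF b(2), of S z] b(1) by (simp add: W_def)
  qed
  have "open (- closure ?P)" by (simp add: open_Compl)
  have "?P \<inter> C = {} \<or> - closure ?P \<inter> C = {}"
  proof (rule connectedD[OF C(1) \<open>open ?P\<close> \<open>open (- closure ?P)\<close>])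
    show "?P \<inter> - closure ?P \<inter> C = {}" using closure_subset[of ?P] by auto
    show "C \<subseteq> ?P \<union> - closure ?P" using closed C(2) by auto
  qed
  moreover have "?P \<inter> C \<noteq> {}" using meets by auto
  ultimately have "- closure ?P \<inter> C = {}" by simp
  then show ?thesis using closed z C(2) by blast
qed

lemma lower_bound_on_compact:
  assumes "compact K" "\<And>z. z \<in> K \<Longrightarrow> positive_near z"
  obtains c where "c > 0" "\<And>z. z \<in> K \<inter> U \<Longrightarrow> c \<le> v z"
proof -
  have "\<forall>z\<in>K. \<exists>c W. c > 0 \<and> open W \<and> z \<in> W \<and> (\<forall>w\<in>W \<inter> U. c \<le> v w)"
    using assms(2) unfolding positive_near_def by blast
  then obtain c W where cW: "\<And>z. z \<in> K \<Longrightarrow> c z > 0 \<and> open (W z) \<and> z \<in> W z \<and> (\<forall>w\<in>W z \<inter> U. c z \<le> v w)"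
    by metis
  then have "K \<subseteq> (\<Union>z\<in>K. W z)" "\<And>z. z \<in> K \<Longrightarrow> open (W z)" by blast+
  then obtain D where D: "D \<subseteq> K" "finite D" "K \<subseteq> (\<Union>z\<in>D. W z)"
    using compactE_image[OF assms(1), of K W] by blast
  define m where "m = Min (insert 1 (c ` D))"
  have fin: "finite (insert 1 (c ` D))" using D(2) by simp
  have "m > 0" unfolding m_def using fin D(1) cW by (subst Min_gr_iff) auto
  moreover have "m \<le> v z" if zK: "z \<in> K \<inter> U" for z
  proof -
    obtain w where w: "w \<in> D" "z \<in> W w" using D(3) zK by blast
    then have "m \<le> c w" unfolding m_def using fin by (intro Min_le) auto
    also have "c w \<le> v z" using cW[of w] D(1) w zK by blast
    finally show ?thesis .
  qed
  ultimately show ?thesis using that by blast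
qed

section \<open>Linear growth at the boundary\<close>

text \<open>
  The barriers for the balls of one radius \<open>S\<close> share their exponent, and the concentric smaller balls
  fill a compact subset of \<open>A\<close>, on which \<open>v\<close> has one lower bound.  Hence \<open>\<kappa>\<close> serves all centres
  in \<open>Z\<close>.  Linearity in \<open>S - N\<close> comes from \<open>exp x \<ge> 1 + x\<close>.
\<close>

lemma gauge_ball_growth:
  assumes S: "S > 0" and Z: "compact Z" and ball: "\<And>a. a \<in> Z \<Longrightarrow> {z. gauge_pow4 a z < S} \<subseteq> A"
    and pos: "\<And>z. z \<in> A \<Longrightarrow> positive_near z"
  obtains \<kappa> where "\<kappa> > 0"
    "\<And>a z. a \<in> Z \<Longrightarrow> z \<in> U \<Longrightarrow> gauge_pow4 a z < S \<Longrightarrow> \<kappa> * (S - gauge_pow4 a z) \<le> v z"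
proof -
  define s where "s = S / 2"
  have s: "0 < s" "s < S" using S by (auto simp: s_def)
  define T where "T = {x. fst x \<in> Z \<and> gauge_pow4 (fst x) (snd x) \<le> s}"
  have "compact T"
  proof -
    obtain B where B: "\<And>a. a \<in> Z \<Longrightarrow> norm a \<le> B" using compact_imp_bounded[OF Z] by (auto simp: bounded_iff)
    obtain R where R: "\<And>a z :: 'n heis. norm a \<le> B \<Longrightarrow> gauge_pow4 a z \<le> s \<Longrightarrow> norm z \<le> R"
      using bounded_gauge_balls by blast
    have "T \<subseteq> Z \<times> cball 0 R"
    proof
      fix x assume "x \<in> T"
      then have "fst x \<in> Z" "norm (snd x) \<le> R" using R[OF B] unfolding T_def by blast+
      then show "x \<in> Z \<times> cball 0 R" by (simp add: mem_Times_iff)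
    qed
    moreover have "closed T"
    proof -
      have "T = (Z \<times> UNIV) \<inter> {x. gauge_pow4 (fst x) (snd x) \<le> s}" by (auto simp: T_def)
      moreover have "closed (Z \<times> (UNIV :: 'n heis set))" by (rule closed_Times[OF compact_imp_closed[OF Z] closed_UNIV])
      moreover have "closed {x :: 'n heis \<times> 'n heis. gauge_pow4 (fst x) (snd x) \<le> s}"
        by (intro closed_Collect_le continuous_intros)
      ultimately show ?thesis by auto
    qed
    ultimately have "compact ((Z \<times> cball 0 R) \<inter> T)"
      by (intro compact_Int_closed compact_Times Z compact_cball)
    then show ?thesis using \<open>T \<subseteq> Z \<times> cball 0 R\<close> by (simp only: Int_absorb1)
  qed
  then have K: "compact (snd ` T)" by (intro compact_continuous_image continuous_intros)
  have posK: "positive_near z" if zT: "z \<in> snd ` T" for z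
  proof (rule pos)
    obtain a where "a \<in> Z" "gauge_pow4 a z \<le> s" using zT unfolding T_def by auto
    moreover from this(2) have "gauge_pow4 a z < S" using s(2) by linarith
    ultimately show "z \<in> A" using ball[of a] by blast
  qed
  then obtain c0 where c0: "c0 > 0" "\<And>z. z \<in> snd ` T \<inter> U \<Longrightarrow> c0 \<le> v z"
    using lower_bound_on_compact[OF K posK] by metis
  define c where "c = min 1 c0"
  have c: "0 < c" "c \<le> 1" "c \<le> c0" using c0 by (auto simp: c_def)
  have inner: "c \<le> v z" if "a \<in> Z" "z \<in> U" "gauge_pow4 a z \<le> s" for a z
  proof -
    have "(a, z) \<in> T" using that by (simp add: T_def)
    then have "z \<in> snd ` T" by (metis imageI snd_conv)
    then show ?thesis using c0(2)[of z] that(2) c(3) by simp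
  qed
  obtain \<alpha> where \<alpha>: "\<alpha> > 0" "16 * (\<alpha> * (p - 1)) * (s / 2) \<ge> 16 + 8 * real CARD('n) + 24 * \<bar>(p - 2) / 2\<bar>"
    using barrier_exponent_exists[OF p s(1)] by blast
  define D where "D = exp (- \<alpha> * s) - exp (- \<alpha> * S)"
  have D: "D > 0" using s \<alpha> by (simp add: D_def)
  define \<kappa>1 where "\<kappa>1 = c / D * (\<alpha> * exp (- \<alpha> * S))"
  have \<kappa>1: "\<kappa>1 > 0" using c D \<alpha> by (simp add: \<kappa>1_def)
  define \<kappa> where "\<kappa> = min (c / S) \<kappa>1"
  show ?thesis
  proof (rule that[of \<kappa>])
    show "\<kappa> > 0" using \<kappa>1 c S by (simp add: \<kappa>_def)
    fix a z assume a: "a \<in> Z" and z: "z \<in> U" "gauge_pow4 a z < S"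
    let ?N = "gauge_pow4 a z"
    show "\<kappa> * (S - ?N) \<le> v z"
    proof (cases "?N \<le> s")
      case True
      have "\<kappa> * (S - ?N) \<le> c / S * (S - ?N)" using z(2) by (intro mult_right_mono) (auto simp: \<kappa>_def)
      also have "\<dots> \<le> c / S * S" using c S gauge_pow4_nonneg[of a z] by (intro mult_left_mono) auto
      also have "\<dots> = c" using S by simp
      finally show ?thesis using inner[OF a z(1) True] by simp
    next
      case False
      have "\<alpha> * (S - ?N) \<le> exp (\<alpha> * (S - ?N)) - 1" using exp_ge_add_one_self[of "\<alpha> * (S - ?N)"] by linarith
      then have "exp (- \<alpha> * S) * (\<alpha> * (S - ?N)) \<le> exp (- \<alpha> * S) * (exp (\<alpha> * (S - ?N)) - 1)"
        by (intro mult_left_mono) auto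
      also have "\<dots> = exp (- \<alpha> * ?N) - exp (- \<alpha> * S)"
        by (simp add: algebra_simps flip: exp_add)
      finally have e: "exp (- \<alpha> * S) * (\<alpha> * (S - ?N)) \<le> exp (- \<alpha> * ?N) - exp (- \<alpha> * S)" .
      have "\<kappa> * (S - ?N) \<le> \<kappa>1 * (S - ?N)" using z(2) by (intro mult_right_mono) (auto simp: \<kappa>_def)
      also have "\<dots> = c / D * (exp (- \<alpha> * S) * (\<alpha> * (S - ?N)))" by (simp add: \<kappa>1_def mult_ac)
      also have "\<dots> \<le> c / D * (exp (- \<alpha> * ?N) - exp (- \<alpha> * S))"
        using e c D by (intro mult_left_mono) auto
      also have "\<dots> \<le> v z"
        unfolding D_def using barrier_le[OF s c(1,2) ball[OF a] inner[OF a] \<alpha> z(1)] False by simp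
      finally show ?thesis .
    qed
  qed
qed

end

section \<open>Approaching a touching point along a dilation\<close>

definition dil :: "real \<Rightarrow> 'n::finite heis \<Rightarrow> 'n heis" where
  "dil r z = (r *\<^sub>R fst z, r *\<^sub>R fst (snd z), r\<^sup>2 * snd (snd z))"

lemma dil_dil: "dil r (dil s z) = dil (r * s) z"
  by (simp add: dil_def power_mult_distrib)

lemma dil_1 [simp]: "dil 1 z = z"
  by (simp add: dil_def)

lemma continuous_on_dil [continuous_intros]:
  assumes "continuous_on T r" "continuous_on T z"
  shows "continuous_on T (\<lambda>x. dil (r x) (z x))"
  unfolding dil_def by (intro continuous_intros assms)

lemma dilation_field_eq: "dilation_field z = (fst z, fst (snd z), 2 * snd (snd z))"
  by (cases z) simp

lemma has_derivative_dil:
  "((\<lambda>r. dil r z) has_derivative (\<lambda>h. h *\<^sub>R (fst z, fst (snd z), 2 * r * snd (snd z)))) (at r)"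
  unfolding dil_def by (auto intro!: derivative_eq_intros simp: fun_eq_iff)

definition gauge_pow4_deriv :: "'n::finite heis \<Rightarrow> 'n heis \<Rightarrow> 'n heis \<Rightarrow> real" where
  "gauge_pow4_deriv a z w =
     2 * hor_sq a z * (2 * (fst (hor_diff a z) \<bullet> fst w + snd (hor_diff a z) \<bullet> fst (snd w))) +
     2 * vert_diff a z * (snd (snd w) + 2 * (fst a \<bullet> fst (snd w) - fst (snd a) \<bullet> fst w))"

lemma has_derivative_gauge_pow4: "(gauge_pow4 a has_derivative gauge_pow4_deriv a z) (at z)"
proof -
  have "((\<lambda>z. hor_sq a z * hor_sq a z + vert_diff a z * vert_diff a z) has_derivative gauge_pow4_deriv a z) (at z)"
    by (rule has_derivative_eq_rhs[OF has_derivative_add[OF has_derivative_mult[OF has_derivative_hor_sq has_derivative_hor_sq]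
          has_derivative_mult[OF has_derivative_vert_diff has_derivative_vert_diff]]])
      (simp add: fun_eq_iff gauge_pow4_deriv_def algebra_simps)
  then show ?thesis by (simp add: gauge_pow4_def[abs_def] power2_eq_square)
qed

lemma continuous_on_gauge_pow4_deriv [continuous_intros]:
  assumes "continuous_on T a" "continuous_on T z" "continuous_on T w"
  shows "continuous_on T (\<lambda>x. gauge_pow4_deriv (a x) (z x) (w x))"
  unfolding gauge_pow4_deriv_def hor_sq_def hor_diff_def vert_diff_def inner_prod_def fst_conv snd_conv
  by (intro continuous_intros assms)

lemma gauge_pow4_commute: "gauge_pow4 a z = gauge_pow4 z a"
proof -
  have "hor_sq a z = hor_sq z a"
    by (simp add: hor_sq_def hor_diff_def inner_prod_def inner_diff_left inner_diff_right inner_commute)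
  moreover have "vert_diff a z = - vert_diff z a"
    by (simp add: vert_diff_def inner_commute)
  ultimately show ?thesis by (simp add: gauge_pow4_def)
qed

text \<open>
  Pairs of a centre and a touching point.  Inclusion of the open ball in \<open>A\<close> is a closed condition on
  the centre, so the pairs form a closed set.
\<close>

definition touching_pairs :: "'n::finite heis set \<Rightarrow> 'n heis set \<Rightarrow> real \<Rightarrow> ('n heis \<times> 'n heis) set" where
  "touching_pairs A E S = {(a, z). z \<in> E \<and> gauge_pow4 a z = S \<and> {w. gauge_pow4 a w < S} \<subseteq> A}"

lemma compact_touching_pairs:
  assumes "compact E"
  shows "compact (touching_pairs A E S)"
proof -
  obtain B where B: "\<And>z. z \<in> E \<Longrightarrow> norm z \<le> B" using compact_imp_bounded[OF assms] by (auto simp: bounded_iff)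
  obtain R where R: "\<And>a z :: 'a heis. norm a \<le> B \<Longrightarrow> gauge_pow4 a z \<le> S \<Longrightarrow> norm z \<le> R"
    using bounded_gauge_balls by blast
  have sub: "touching_pairs A E S \<subseteq> cball 0 R \<times> E"
  proof
    fix x assume "x \<in> touching_pairs A E S"
    then have x: "snd x \<in> E" "gauge_pow4 (snd x) (fst x) \<le> S"
      using gauge_pow4_commute[of "snd x" "fst x"] by (auto simp: touching_pairs_def case_prod_beta)
    then have "norm (fst x) \<le> R" using R[OF B] by blast
    with x show "x \<in> cball 0 R \<times> E" by (simp add: mem_Times_iff)
  qed
  have "touching_pairs A E S = (UNIV \<times> E) \<inter> {x. gauge_pow4 (fst x) (snd x) = S} \<inter>
      (\<Inter>w\<in>- A. {x. S \<le> gauge_pow4 (fst x) w})"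
  proof (rule set_eqI)
    fix x :: "'a heis \<times> 'a heis"
    have "{w. gauge_pow4 (fst x) w < S} \<subseteq> A \<longleftrightarrow> (\<forall>w\<in>- A. S \<le> gauge_pow4 (fst x) w)"
      using not_less by blast
    then show "x \<in> touching_pairs A E S \<longleftrightarrow> x \<in> (UNIV \<times> E) \<inter> {x. gauge_pow4 (fst x) (snd x) = S} \<inter>
        (\<Inter>w\<in>- A. {x. S \<le> gauge_pow4 (fst x) w})"
      unfolding touching_pairs_def by (simp add: case_prod_beta mem_Times_iff)
  qed
  moreover have "closed \<dots>"
    using compact_imp_closed[OF assms]
    by (intro closed_Int closed_Times closed_INT ballI closed_Collect_le closed_Collect_eq continuous_intros) auto
  ultimately have "closed (touching_pairs A E S)" by simp
  then show ?thesis
    using compact_Int_closed[OF compact_Times[OF compact_cball[of 0 R] assms], of "touching_pairs A E S"] sub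
    by (simp only: Int_absorb1)
qed

text \<open>
  If the dilation field crosses every touching ball at its touching point, then by compactness the
  dilations enter the balls at a uniform rate.
\<close>

lemma dilation_enters_balls:
  fixes E :: "'n::finite heis set"
  assumes E: "compact E"
    and cross: "\<And>a z. (a, z) \<in> touching_pairs A E S \<Longrightarrow> 0 < \<sigma> * gauge_pow4_deriv a z (dilation_field z)"
  obtains m h0 where "m > 0" "h0 > 0"
    "\<And>a z h. (a, z) \<in> touching_pairs A E S \<Longrightarrow> 0 < h \<Longrightarrow> h \<le> h0 \<Longrightarrow>
      gauge_pow4 a (dil (1 - \<sigma> * h) z) \<le> S - m * h"
proof -
  let ?T = "touching_pairs A E S"
  define g where "g x = \<sigma> * gauge_pow4_deriv (fst (fst x)) (dil (1 - \<sigma> * snd x) (snd (fst x)))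
    (fst (snd (fst x)), fst (snd (snd (fst x))), 2 * (1 - \<sigma> * snd x) * snd (snd (snd (fst x))))"
    for x :: "('n heis \<times> 'n heis) \<times> real"
  have cg: "continuous_on W g" for W unfolding g_def by (intro continuous_intros)
  have T: "compact ?T" by (rule compact_touching_pairs[OF E])
  have g0: "g (x, 0) > 0" if "x \<in> ?T" for x
    using cross[of "fst x" "snd x"] that by (simp add: g_def dilation_field_eq)
  obtain m where m: "m > 0" "\<And>x. x \<in> ?T \<Longrightarrow> 2 * m \<le> g (x, 0)"
  proof (cases "?T = {}")
    case True
    then show ?thesis using that[of 1] by simp
  next
    case False
    have "continuous_on ?T (\<lambda>x. g (x, 0))"
      by (rule continuous_on_compose2[OF cg[of UNIV]]) (auto intro!: continuous_intros)
    from continuous_attains_inf[OF T False this] obtain y where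
      "y \<in> ?T" "\<And>x. x \<in> ?T \<Longrightarrow> g (y, 0) \<le> g (x, 0)" by blast
    with g0 show ?thesis using that[of "g (y, 0) / 2"] by simp
  qed
  have "uniformly_continuous_on (?T \<times> {0..1}) g"
    by (intro compact_uniformly_continuous cg compact_Times T compact_Icc)
  then obtain d where d: "d > 0"
    "\<And>x y. x \<in> ?T \<times> {0..1} \<Longrightarrow> y \<in> ?T \<times> {0..1} \<Longrightarrow> dist y x < d \<Longrightarrow> dist (g y) (g x) < m"
    using m(1) unfolding uniformly_continuous_on_def by metis
  define h0 where "h0 = min 1 (d / 2)"
  have h0: "0 < h0" "h0 \<le> 1" "h0 < d" using d(1) by (auto simp: h0_def)
  have gm: "m \<le> g (x, h)" if "x \<in> ?T" "0 \<le> h" "h \<le> h0" for x h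
  proof -
    have "dist (g (x, h)) (g (x, 0)) < m"
      using that h0 by (intro d(2)) (auto simp: dist_Pair_Pair dist_real_def)
    then show ?thesis using m(2)[OF that(1)] by (simp add: dist_real_def abs_less_iff)
  qed
  show ?thesis
  proof (rule that[OF m(1) h0(1)])
    fix a z h assume az: "(a, z) \<in> ?T" and h: "0 < h" "h \<le> h0"
    define f where "f h = gauge_pow4 a (dil (1 - \<sigma> * h) z)" for h
    have D: "(f has_real_derivative - g ((a, z), h)) (at h)" for h
    proof -
      let ?w = "(fst z, fst (snd z), 2 * (1 - \<sigma> * h) * snd (snd z))"
      have "((\<lambda>h. 1 - \<sigma> * h) has_derivative (\<lambda>k. - \<sigma> * k)) (at h)"
        by (auto intro!: derivative_eq_intros)
      from has_derivative_compose[OF has_derivative_compose[OF this has_derivative_dil] has_derivative_gauge_pow4]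
      have "(f has_derivative (\<lambda>k. gauge_pow4_deriv a (dil (1 - \<sigma> * h) z) ((- \<sigma> * k) *\<^sub>R ?w))) (at h)"
        by (simp add: f_def[abs_def])
      moreover have "gauge_pow4_deriv a (dil (1 - \<sigma> * h) z) ((- \<sigma> * k) *\<^sub>R ?w) = - g ((a, z), h) * k" for k
        using has_derivative_linear[OF has_derivative_gauge_pow4[of a "dil (1 - \<sigma> * h) z"]]
        by (simp only: linear_cmul) (simp add: g_def)
      ultimately show ?thesis unfolding has_field_derivative_def by (simp only:)
    qed
    obtain \<xi> where \<xi>: "0 < \<xi>" "\<xi> < h" "f h - f 0 = (h - 0) * - g ((a, z), \<xi>)"
      using MVT2[of 0 h f "\<lambda>h. - g ((a, z), h)"] h(1) D by blast
    have "f 0 = S" using az by (simp add: f_def touching_pairs_def)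
    moreover have "h * m \<le> h * g ((a, z), \<xi>)"
      using h \<xi> by (intro mult_left_mono gm[OF az]) auto
    ultimately show "gauge_pow4 a (dil (1 - \<sigma> * h) z) \<le> S - m * h"
      using \<xi>(3) by (simp add: f_def[of h, symmetric] mult.commute)
  qed
qed

lemma (in capacitary) growth_along_dilations:
  assumes S: "S > 0" and E: "compact E"
    and touch: "\<And>z. z \<in> E \<Longrightarrow> \<exists>a. (a, z) \<in> touching_pairs A E S"
    and cross: "\<And>a z. (a, z) \<in> touching_pairs A E S \<Longrightarrow> 0 < \<sigma> * gauge_pow4_deriv a z (dilation_field z)"
    and pos: "\<And>z. z \<in> A \<Longrightarrow> positive_near z"
  obtains M h0 where "M > 0" "h0 > 0"
    "\<And>z h. z \<in> E \<Longrightarrow> 0 < h \<Longrightarrow> h \<le> h0 \<Longrightarrow> dil (1 - \<sigma> * h) z \<in> U \<Longrightarrow> M * h \<le> v (dil (1 - \<sigma> * h) z)"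
proof -
  obtain m h0 where m: "m > 0" "h0 > 0"
    "\<And>a z h. (a, z) \<in> touching_pairs A E S \<Longrightarrow> 0 < h \<Longrightarrow> h \<le> h0 \<Longrightarrow>
      gauge_pow4 a (dil (1 - \<sigma> * h) z) \<le> S - m * h"
    using dilation_enters_balls[OF E cross] by blast
  have Z: "compact (fst ` touching_pairs A E S)"
    by (intro compact_continuous_image continuous_intros compact_touching_pairs E)
  obtain \<kappa> where \<kappa>: "\<kappa> > 0" "\<And>a z. a \<in> fst ` touching_pairs A E S \<Longrightarrow> z \<in> U \<Longrightarrow>
      gauge_pow4 a z < S \<Longrightarrow> \<kappa> * (S - gauge_pow4 a z) \<le> v z"
  proof (rule gauge_ball_growth[OF S Z _ pos])
    show "{z. gauge_pow4 a z < S} \<subseteq> A" if "a \<in> fst ` touching_pairs A E S" for a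
      using that unfolding touching_pairs_def by auto
  qed blast+
  show ?thesis
  proof (rule that[of "\<kappa> * m" h0])
    fix z h assume z: "z \<in> E" and h: "0 < h" "h \<le> h0" and U: "dil (1 - \<sigma> * h) z \<in> U"
    let ?w = "dil (1 - \<sigma> * h) z"
    obtain a where a: "(a, z) \<in> touching_pairs A E S" using touch[OF z] by blast
    have le: "gauge_pow4 a ?w \<le> S - m * h" by (rule m(3)[OF a h])
    moreover have "m * h > 0" using m h by simp
    ultimately have "\<kappa> * (S - gauge_pow4 a ?w) \<le> v ?w"
      using a U by (intro \<kappa>(2)) force+
    moreover have "\<kappa> * (m * h) \<le> \<kappa> * (S - gauge_pow4 a ?w)"
      using le \<kappa>(1) by (intro mult_left_mono) auto
    ultimately show "\<kappa> * m * h \<le> v ?w" by simp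
  qed (use \<kappa> m in auto)
qed

section \<open>Dilations and starshaped sets\<close>

lemma hball_eq_gauge:
  assumes "R > 0"
  shows "hball a R = {z. gauge_pow4 a z < R ^ 4}"
proof -
  have "hrho (hmul (hinv z) a) = root 4 (gauge_pow4 a z)" for z
  proof (cases a; cases z)
    fix a1 a2 a3 z1 z2 z3 assume [simp]: "a = (a1, a2, a3)" "z = (z1, z2, z3)"
    have sq: "(y - x)\<^sup>2 = (x - y) * (x - y)" for x y :: real
      by (simp add: power2_eq_square algebra_simps)
    have "(\<Sum>i\<in>UNIV. (- z1 $ i + a1 $ i)\<^sup>2 + (- z2 $ i + a2 $ i)\<^sup>2) = hor_sq a z"
      by (simp add: hor_sq_def hor_diff_def inner_prod_def inner_vec_def sum.distrib sq)
    moreover have "- z3 + a3 - 2 * (\<Sum>i\<in>UNIV. (- z1) $ i * a2 $ i - a1 $ i * (- z2) $ i) = - vert_diff a z"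
      by (simp add: vert_diff_def inner_vec_def sum_subtractf sum.distrib sum_negf algebra_simps)
    ultimately show ?thesis by (simp add: gauge_pow4_def)
  qed
  moreover have "root 4 x < R \<longleftrightarrow> x < R ^ 4" for x
    using real_root_less_iff[of 4 x "R ^ 4"] assms by (simp add: real_root_power_cancel)
  ultimately show ?thesis by (simp add: hball_def)
qed

lemma starshaped_defining_function:
  fixes \<Omega> :: "'n::finite heis set"
  assumes "strictly_starshaped \<Omega>" "z \<in> frontier \<Omega>"
  obtains V g D where "open V" "z \<in> V" "(g has_derivative (\<lambda>v. D \<bullet> v)) (at z)" "0 < D \<bullet> dilation_field z"
    "\<And>w. w \<in> V \<Longrightarrow> w \<in> \<Omega> \<longleftrightarrow> g w < 0" "\<And>w. w \<in> V \<Longrightarrow> w \<in> frontier \<Omega> \<longleftrightarrow> g w = (0::real)"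
proof -
  obtain V g where Vg: "C1_defining_fun \<Omega> z V g"
    using assms unfolding strictly_starshaped_def C1_boundary_def by blast
  then have V: "open V" "z \<in> V" "Ck_on 1 V g" "\<Omega> \<inter> V = {w\<in>V. g w < 0}" "frontier \<Omega> \<inter> V = {w\<in>V. g w = 0}"
    and nz: "\<not> GDERIV g z :> 0"
    by (auto simp: C1_defining_fun_def simp del: Ck_on.simps One_nat_def)
  let ?L = "frechet_derivative g (at z)"
  define D where "D = (\<Sum>b\<in>Basis. ?L b *\<^sub>R b)"
  have L: "(g has_derivative ?L) (at z)" by (rule Ck_on_1_differentiable[OF V(3,2)])
  have "?L v = D \<bullet> v" for v
  proof -
    have "?L v = ?L (\<Sum>b\<in>Basis. (v \<bullet> b) *\<^sub>R b)" by (simp add: euclidean_representation)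
    also have "\<dots> = (\<Sum>b\<in>Basis. (v \<bullet> b) * ?L b)"
      using has_derivative_linear[OF L] by (simp add: linear_sum linear_cmul)
    also have "\<dots> = D \<bullet> v" by (simp add: D_def inner_sum_left inner_commute[of v] mult.commute)
    finally show ?thesis .
  qed
  then have "?L = (\<lambda>v. D \<bullet> v)" by blast
  then have D: "(g has_derivative (\<lambda>v. D \<bullet> v)) (at z)" using L by simp
  then have G: "GDERIV g z :> D" by (simp add: gderiv_def inner_commute[of _ D])
  then have "D \<noteq> 0" using nz by blast
  have "exterior_unit_normal \<Omega> z (D /\<^sub>R norm D)"
    unfolding exterior_unit_normal_def using Vg G by blast
  then have "0 < (D /\<^sub>R norm D) \<bullet> dilation_field z"
    using assms unfolding strictly_starshaped_def by blast
  then have "0 < D \<bullet> dilation_field z" using \<open>D \<noteq> 0\<close> by (simp add: zero_less_mult_iff)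
  with that[of V g D] V D show ?thesis by blast
qed

lemma starshapedD:
  assumes "strictly_starshaped \<Omega>"
  shows "open \<Omega>" "bounded \<Omega>" "0 \<in> \<Omega>" "compact (closure \<Omega>)" "compact (frontier \<Omega>)"
  using assms by (auto simp: strictly_starshaped_def compact_frontier_bounded)

text \<open>
  The derivative of a defining function along the orbit is \<open>1 / r\<close> times its derivative in the direction
  of the dilation field, hence positive.  So the orbit can cross the boundary only outwards.
\<close>

lemma starshaped_crossing:
  fixes \<Omega> :: "'n::finite heis set"
  assumes \<Omega>: "strictly_starshaped \<Omega>" and r: "r > 0" and z: "dil r z \<in> frontier \<Omega>"
  obtains d where "d > 0" "\<And>s. r - d < s \<Longrightarrow> s < r \<Longrightarrow> dil s z \<in> \<Omega>"
    "\<And>s. r < s \<Longrightarrow> s < r + d \<Longrightarrow> dil s z \<notin> closure \<Omega>"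
proof -
  obtain V g D where V: "open V" "dil r z \<in> V" and D: "(g has_derivative (\<lambda>v. D \<bullet> v)) (at (dil r z))"
    and pos: "0 < D \<bullet> dilation_field (dil r z)"
    and g: "\<And>w. w \<in> V \<Longrightarrow> w \<in> \<Omega> \<longleftrightarrow> g w < 0" "\<And>w. w \<in> V \<Longrightarrow> w \<in> frontier \<Omega> \<longleftrightarrow> g w = 0"
    using starshaped_defining_function[OF \<Omega> z] by metis
  let ?l = "D \<bullet> (fst z, fst (snd z), 2 * r * snd (snd z))"
  have "D \<bullet> dilation_field (dil r z) = r * ?l"
    by (simp add: dilation_field_eq dil_def inner_prod_def power2_eq_square algebra_simps)
  then have l: "?l > 0" using pos r by (simp add: zero_less_mult_iff)
  have "((\<lambda>s. g (dil s z)) has_derivative (\<lambda>h. D \<bullet> (h *\<^sub>R (fst z, fst (snd z), 2 * r * snd (snd z))))) (at r)"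
    by (rule has_derivative_compose[OF has_derivative_dil D])
  then have DE: "((\<lambda>s. g (dil s z)) has_real_derivative ?l) (at r)"
    by (rule has_derivative_imp_has_field_derivative) (simp only: inner_scaleR_right mult.commute)
  have g0: "g (dil r z) = 0" using g(2) V(2) z by blast
  obtain d1 where d1: "d1 > 0" "\<And>h. 0 < h \<Longrightarrow> h < d1 \<Longrightarrow> 0 < g (dil (r + h) z)"
    using DERIV_pos_inc_right[OF DE l] g0 by auto
  obtain d2 where d2: "d2 > 0" "\<And>h. 0 < h \<Longrightarrow> h < d2 \<Longrightarrow> g (dil (r - h) z) < 0"
    using DERIV_pos_inc_left[OF DE l] g0 by auto
  have "continuous_on UNIV (\<lambda>s. dil s z)" by (intro continuous_intros)
  then have "open ((\<lambda>s. dil s z) -` V)" using V(1) by (simp add: continuous_on_open_vimage)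
  then obtain d3 where d3: "d3 > 0" "\<And>s. \<bar>s - r\<bar> < d3 \<Longrightarrow> dil s z \<in> V"
    using V(2) unfolding open_dist by (auto simp: dist_real_def)
  define d where "d = min d1 (min d2 d3)"
  have dd: "d \<le> d1" "d \<le> d2" "d \<le> d3" by (auto simp: d_def)
  show ?thesis
  proof (rule that[of d])
    show "d > 0" using d1 d2 d3 by (simp add: d_def)
    show "dil s z \<in> \<Omega>" if "r - d < s" "s < r" for s
      using d2(2)[of "r - s"] d3(2)[of s] g(1)[of "dil s z"] that by (simp add: d_def)
    show "dil s z \<notin> closure \<Omega>" if "r < s" "s < r + d" for s
    proof -
      have "g (dil s z) > 0" using d1(2)[of "s - r"] that dd by simp
      moreover have "dil s z \<in> V" using d3(2)[of s] that dd by simp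
      ultimately have "dil s z \<notin> \<Omega>" "dil s z \<notin> frontier \<Omega>" using g by (auto simp: not_less)
      then show ?thesis using closure_Un_frontier[of \<Omega>] by auto
    qed
  qed
qed

text \<open>
  Otherwise some later point of the orbit lies in \<open>\<Omega>\<close>, and at the last boundary point before it the
  orbit would cross the boundary inwards.
\<close>

lemma starshaped_dil_mem:
  fixes \<Omega> :: "'n::finite heis set"
  assumes \<Omega>: "strictly_starshaped \<Omega>" and z: "z \<in> closure \<Omega>" and r: "0 \<le> r" "r < 1"
  shows "dil r z \<in> \<Omega>"
proof (rule ccontr)
  assume out: "dil r z \<notin> \<Omega>"
  note op = starshapedD(1)[OF \<Omega>]
  have "dil 0 z = 0" by (simp add: dil_def zero_prod_def)
  then have r0: "r > 0" using r out starshapedD(3)[OF \<Omega>] by (cases "r = 0") auto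
  obtain r1 where r1: "r < r1" "r1 \<le> 1" "dil r1 z \<in> \<Omega>"
  proof (cases "z \<in> \<Omega>")
    case True
    then show ?thesis using that[of 1] r by simp
  next
    case False
    then have "dil 1 z \<in> frontier \<Omega>" using z op by (simp add: frontier_def interior_open)
    then obtain d where d: "d > 0" "\<And>s. 1 - d < s \<Longrightarrow> s < 1 \<Longrightarrow> dil s z \<in> \<Omega>"
      using starshaped_crossing[OF \<Omega>, of 1 z] by (metis zero_less_one)
    obtain s where "max r (1 - d) < s" "s < 1" using dense[of "max r (1 - d)" 1] r d(1) by auto
    then show ?thesis using that[of s] d(2)[of s] by simp
  qed
  define T where "T = {s\<in>{r..r1}. dil s z \<notin> \<Omega>}"
  have co: "continuous_on UNIV (\<lambda>s. dil s z)" by (intro continuous_intros)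
  then have opv: "open ((\<lambda>s. dil s z) -` \<Omega>)" using op by (simp add: continuous_on_open_vimage)
  have "T = {r..r1} \<inter> - ((\<lambda>s. dil s z) -` \<Omega>)" by (auto simp: T_def)
  then have "compact T" using opv by (simp add: compact_Int_closed closed_Compl)
  moreover have "r \<in> T" using out r1 by (simp add: T_def)
  ultimately obtain s where s: "s \<in> T" "\<And>t. t \<in> T \<Longrightarrow> t \<le> s"
    using compact_attains_sup[of T] by blast
  have sr: "r \<le> s" "s < r1" "dil s z \<notin> \<Omega>"
    using s(1) r1(3) by (auto simp: T_def less_le)
  have after: "dil t z \<in> \<Omega>" if "s < t" "t \<le> r1" for t
    using s(2)[of t] that sr by (force simp: T_def)
  have "dil s z \<in> closure \<Omega>"
  proof -
    have "s \<in> closure {s<..r1}" using sr by simp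
    then have "dil s z \<in> closure ((\<lambda>s. dil s z) ` {s<..r1})"
      using image_closure_subset[OF continuous_on_subset[OF co subset_UNIV] closed_closure closure_subset, of "{s<..r1}"] by blast
    also have "\<dots> \<subseteq> closure \<Omega>" using after by (intro closure_mono) auto
    finally show ?thesis .
  qed
  then have "dil s z \<in> frontier \<Omega>" using sr(3) op by (simp add: frontier_def interior_open)
  then obtain d where d: "d > 0" "\<And>t. s < t \<Longrightarrow> t < s + d \<Longrightarrow> dil t z \<notin> closure \<Omega>"
    using starshaped_crossing[OF \<Omega>, of s z] r0 sr(1) by (metis less_le_trans)
  obtain t where "s < t" "t < min r1 (s + d)" using dense[of s "min r1 (s + d)"] sr d(1) by auto
  then show False using after[of t] d(2)[of t] closure_subset[of \<Omega>] by auto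
qed

lemma dil_inverse: "r \<noteq> 0 \<Longrightarrow> dil (1 / r) (dil r z) = z" "r \<noteq> 0 \<Longrightarrow> dil r (dil (1 / r) z) = z"
  by (simp_all add: dil_dil)

lemma starshaped_dil_not_mem:
  assumes "strictly_starshaped \<Omega>" "z \<notin> \<Omega>" "r > 1"
  shows "dil r z \<notin> closure \<Omega>"
  using starshaped_dil_mem[OF assms(1), of "dil r z" "1 / r"] assms(2,3) by (auto simp: dil_inverse)

lemma norm_dil_ge:
  assumes "r \<ge> 1"
  shows "r * norm z \<le> norm (dil r z)"
proof -
  have "r * norm z = norm (r *\<^sub>R z)" using assms by simp
  also have "\<dots> \<le> norm (dil r z)"
  proof -
    have "\<bar>r * snd (snd z)\<bar> \<le> \<bar>r\<^sup>2 * snd (snd z)\<bar>"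
      using assms by (simp add: abs_mult power2_eq_square mult_right_mono)
    then have "(r * snd (snd z))\<^sup>2 \<le> (r\<^sup>2 * snd (snd z))\<^sup>2" by (simp only: abs_le_square_iff)
    then show ?thesis
      by (simp add: dil_def norm_prod_def)
  qed
  finally show ?thesis .
qed

lemma starshaped_exit:
  fixes \<Omega> :: "'n::finite heis set"
  assumes \<Omega>: "strictly_starshaped \<Omega>" and z: "z \<noteq> 0"
  obtains r where "r \<ge> 1" "dil r z \<notin> closure \<Omega>"
proof -
  obtain B where B: "\<And>w. w \<in> closure \<Omega> \<Longrightarrow> norm w \<le> B"
    using compact_imp_bounded[OF starshapedD(4)[OF \<Omega>]] unfolding bounded_iff by blast
  define r where "r = max 1 ((\<bar>B\<bar> + 1) / norm z)"
  have "r \<ge> 1" by (simp add: r_def)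
  have "\<bar>B\<bar> + 1 \<le> r * norm z" using z by (simp add: r_def pos_divide_le_eq[symmetric])
  also have "\<dots> \<le> norm (dil r z)" by (rule norm_dil_ge[OF \<open>r \<ge> 1\<close>])
  finally have "dil r z \<notin> closure \<Omega>" using B[of "dil r z"] by auto
  with that \<open>r \<ge> 1\<close> show ?thesis by blast
qed

lemma closed_dil_not_mem:
  fixes \<Omega> :: "'n::finite heis set"
  assumes "open \<Omega>"
  shows "closed {z. dil r z \<notin> \<Omega>}"
proof -
  have "continuous_on UNIV (\<lambda>z::'n heis. dil r z)" by (intro continuous_intros)
  then have "closed (- ((\<lambda>z. dil r z) -` \<Omega>))"
    using assms by (simp add: continuous_on_open_vimage closed_Compl)
  also have "- ((\<lambda>z. dil r z) -` \<Omega>) = {z. dil r z \<notin> \<Omega>}" by auto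
  finally show ?thesis .
qed

lemma dilation_segment_connected: "connected ((\<lambda>r. dil r z) ` {a..b})"
  by (intro connected_continuous_image continuous_intros connected_Icc)

lemma starshaped_boundary_hit:
  fixes \<Omega> :: "'n::finite heis set"
  assumes \<Omega>: "strictly_starshaped \<Omega>" and ab: "a \<le> b" and z: "dil a z \<in> \<Omega>" "dil b z \<notin> closure \<Omega>"
  obtains r where "a < r" "r < b" "dil r z \<in> frontier \<Omega>"
proof -
  have "(\<lambda>r. dil r z) ` {a..b} \<inter> \<Omega> \<noteq> {}" "(\<lambda>r. dil r z) ` {a..b} - \<Omega> \<noteq> {}"
    using ab z closure_subset[of \<Omega>] by force+
  then have "(\<lambda>r. dil r z) ` {a..b} \<inter> frontier \<Omega> \<noteq> {}"
    by (intro connected_Int_frontier dilation_segment_connected)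
  then obtain r where r: "a \<le> r" "r \<le> b" "dil r z \<in> frontier \<Omega>" by auto
  have "dil r z \<notin> \<Omega>" "dil r z \<in> closure \<Omega>"
    using r(3) starshapedD(1)[OF \<Omega>] by (auto simp: frontier_def interior_open)
  then have "r \<noteq> a" "r \<noteq> b" using z by auto
  with r have "a < r" "r < b" by auto
  with r(3) that show ?thesis by blast
qed

text \<open>
  At a touching point the half-space into which the gauge decreases lies in the half-space into which
  the defining function decreases, so the two differentials are positively proportional.  The
  proportionality is used only along the dilation field: perturb that field slightly into the
  first half-space.
\<close>

lemma touching_ball_crossing:
  fixes a z :: "'n::finite heis"
  assumes S: "S > 0" "gauge_pow4 a z = S" and V: "open V" "z \<in> V"
    and g: "(g has_derivative (\<lambda>v. D \<bullet> v)) (at z)" "g z = 0"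
    and inside: "\<And>w. w \<in> V \<Longrightarrow> gauge_pow4 a w < S \<Longrightarrow> g w < (0::real)"
    and Z: "D \<bullet> Z > 0"
  shows "gauge_pow4_deriv a z Z > 0"
proof (rule ccontr)
  assume neg: "\<not> ?thesis"
  let ?L = "gauge_pow4_deriv a z"
  have lin: "linear ?L" by (rule has_derivative_linear[OF has_derivative_gauge_pow4])
  let ?x = "fst (hor_diff a z)" and ?y = "snd (hor_diff a z)"
  \<comment> \<open>The direction of dilations centred at \<open>a\<close>; Euler's identity gives the derivative of \<open>N\<close>.\<close>
  define e where "e = (?x, ?y, 2 * vert_diff a z - 2 * (fst a \<bullet> ?y - fst (snd a) \<bullet> ?x))"
  have Le: "?L e = 4 * S"
    unfolding S(2)[symmetric]
    by (simp add: gauge_pow4_deriv_def e_def gauge_pow4_def hor_sq_def inner_prod_def power2_eq_square algebra_simps)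
  have half: "D \<bullet> v \<le> 0" if v: "?L v < 0" for v
  proof (rule ccontr)
    assume "\<not> D \<bullet> v \<le> 0"
    then have Dv: "D \<bullet> v > 0" by simp
    have line: "((\<lambda>s. z + s *\<^sub>R v) has_derivative (\<lambda>h. h *\<^sub>R v)) (at 0)"
      by (auto intro!: derivative_eq_intros)
    have "((\<lambda>s. g (z + s *\<^sub>R v)) has_derivative (\<lambda>h. D \<bullet> (h *\<^sub>R v))) (at 0)"
      by (rule has_derivative_compose[OF line]) (use g(1) in simp)
    then have dg: "((\<lambda>s. g (z + s *\<^sub>R v)) has_real_derivative D \<bullet> v) (at 0)"
      by (rule has_derivative_imp_has_field_derivative) (simp only: inner_scaleR_right mult.commute)
    have "((\<lambda>s. gauge_pow4 a (z + s *\<^sub>R v)) has_derivative (\<lambda>h. ?L (h *\<^sub>R v))) (at 0)"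
      by (rule has_derivative_compose[OF line]) (use has_derivative_gauge_pow4[of a z] in simp)
    then have dN: "((\<lambda>s. gauge_pow4 a (z + s *\<^sub>R v)) has_real_derivative ?L v) (at 0)"
      by (rule has_derivative_imp_has_field_derivative) (simp only: linear_cmul[OF lin] real_scaleR_def mult.commute)
    obtain d1 where d1: "d1 > 0" "\<And>h. 0 < h \<Longrightarrow> h < d1 \<Longrightarrow> 0 < g (z + h *\<^sub>R v)"
      using DERIV_pos_inc_right[OF dg Dv] g(2) by auto
    obtain d2 where d2: "d2 > 0" "\<And>h. 0 < h \<Longrightarrow> h < d2 \<Longrightarrow> gauge_pow4 a (z + h *\<^sub>R v) < S"
      using DERIV_neg_dec_right[OF dN v] S(2) by auto
    have "continuous_on UNIV (\<lambda>s. z + s *\<^sub>R v)" by (intro continuous_intros)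
    then have "open ((\<lambda>s. z + s *\<^sub>R v) -` V)" using V(1) by (simp add: continuous_on_open_vimage)
    moreover have "(0::real) \<in> (\<lambda>s. z + s *\<^sub>R v) -` V" using V(2) by simp
    ultimately obtain d3 where d3: "d3 > 0" "ball (0::real) d3 \<subseteq> (\<lambda>s. z + s *\<^sub>R v) -` V"
      unfolding open_contains_ball by blast
    define h where "h = min d1 (min d2 d3) / 2"
    have "0 < h" "h < d1" "h < d2" "h < d3" using d1(1) d2(1) d3(1) by (auto simp: h_def)
    moreover from this have "z + h *\<^sub>R v \<in> V" using d3(2) by (auto simp: subset_iff)
    ultimately show False using d1(2)[of h] inside[OF _ d2(2)[of h]] by fastforce
  qed
  have "D \<bullet> Z \<le> t * (D \<bullet> e)" if "t > 0" for t
  proof -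
    have "?L (Z - t *\<^sub>R e) = ?L Z - t * (4 * S)"
      by (simp only: linear_diff[OF lin] linear_cmul[OF lin] Le real_scaleR_def)
    then have "?L (Z - t *\<^sub>R e) < 0" using neg that S(1) mult_pos_pos[of t "4 * S"] by linarith
    from half[OF this] show ?thesis by (simp add: inner_diff_right)
  qed
  moreover have "\<exists>t>0. t * (D \<bullet> e) < D \<bullet> Z"
  proof (cases "D \<bullet> e \<le> 0")
    case True
    then have "1 * (D \<bullet> e) < D \<bullet> Z" using Z by linarith
    then show ?thesis by (intro exI[of _ 1]) auto
  next
    case False
    then show ?thesis using Z by (intro exI[of _ "D \<bullet> Z / (2 * (D \<bullet> e))"]) auto
  qed
  ultimately show False by (meson not_less)
qed

lemma interior_touching:
  fixes \<Omega> :: "'n::finite heis set"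
  assumes \<Omega>: "strictly_starshaped \<Omega>" and S: "S > 0" and az: "(a, z) \<in> touching_pairs \<Omega> (frontier \<Omega>) S"
  shows "0 < gauge_pow4_deriv a z (dilation_field z)"
proof -
  have z: "z \<in> frontier \<Omega>" and N: "gauge_pow4 a z = S" and sub: "{w. gauge_pow4 a w < S} \<subseteq> \<Omega>"
    using az by (auto simp: touching_pairs_def)
  obtain V g D where V: "open V" "z \<in> V" "(g has_derivative (\<lambda>v. D \<bullet> v)) (at z)" "0 < D \<bullet> dilation_field z"
    "\<And>w. w \<in> V \<Longrightarrow> w \<in> \<Omega> \<longleftrightarrow> g w < 0" "\<And>w. w \<in> V \<Longrightarrow> w \<in> frontier \<Omega> \<longleftrightarrow> g w = 0"
    using starshaped_defining_function[OF \<Omega> z] by metis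
  show ?thesis
  proof (rule touching_ball_crossing[OF S N V(1-3) _ _ V(4)])
    show "g z = 0" using V(6)[OF V(2)] z by simp
    show "g w < 0" if "w \<in> V" "gauge_pow4 a w < S" for w using V(5)[OF that(1)] that(2) sub by blast
  qed
qed

lemma exterior_touching:
  fixes \<Omega> :: "'n::finite heis set"
  assumes \<Omega>: "strictly_starshaped \<Omega>" and S: "S > 0"
    and az: "(a, z) \<in> touching_pairs (- closure \<Omega>) (frontier \<Omega>) S"
  shows "gauge_pow4_deriv a z (dilation_field z) < 0"
proof -
  have z: "z \<in> frontier \<Omega>" and N: "gauge_pow4 a z = S" and sub: "{w. gauge_pow4 a w < S} \<subseteq> - closure \<Omega>"
    using az by (auto simp: touching_pairs_def)
  obtain V g D where V: "open V" "z \<in> V" "(g has_derivative (\<lambda>v. D \<bullet> v)) (at z)" "0 < D \<bullet> dilation_field z"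
    "\<And>w. w \<in> V \<Longrightarrow> w \<in> \<Omega> \<longleftrightarrow> g w < 0" "\<And>w. w \<in> V \<Longrightarrow> w \<in> frontier \<Omega> \<longleftrightarrow> g w = 0"
    using starshaped_defining_function[OF \<Omega> z] by metis
  have "0 < gauge_pow4_deriv a z (- dilation_field z)"
  proof (rule touching_ball_crossing[OF S N V(1,2)])
    show "((\<lambda>w. - g w) has_derivative (\<lambda>v. - D \<bullet> v)) (at z)"
      using has_derivative_minus[OF V(3)] by simp
    show "- g z = 0" using V(6)[OF V(2)] z by simp
    show "- g w < 0" if "w \<in> V" "gauge_pow4 a w < S" for w
    proof -
      have "w \<notin> closure \<Omega>" using that(2) sub by blast
      then have "w \<notin> \<Omega>" "w \<notin> frontier \<Omega>" using closure_Un_frontier[of \<Omega>] by auto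
      then show ?thesis using V(5,6)[OF that(1)] by simp
    qed
    show "- D \<bullet> - dilation_field z > 0" using V(4) by simp
  qed
  then show ?thesis
    using linear_neg[OF has_derivative_linear[OF has_derivative_gauge_pow4[of a z]], of "dilation_field z"]
    by (simp only: neg_0_less_iff_less)
qed

lemma touching_pair_of_hball:
  fixes \<Omega> A :: "'n::finite heis set"
  assumes R: "R > 0" and sub: "hball a R \<subseteq> A" and A: "A \<inter> frontier \<Omega> = {}"
    and z: "closure (hball a R) \<inter> frontier \<Omega> = {z}"
  shows "(a, z) \<in> touching_pairs A (frontier \<Omega>) (R ^ 4)"
proof -
  have h: "hball a R = {z. gauge_pow4 a z < R ^ 4}" by (rule hball_eq_gauge[OF R])
  have "closure (hball a R) \<subseteq> {z. gauge_pow4 a z \<le> R ^ 4}"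
    unfolding h by (rule closure_minimal) (auto intro!: closed_Collect_le continuous_intros)
  then have "gauge_pow4 a z \<le> R ^ 4" "z \<in> frontier \<Omega>" using z by blast+
  moreover have "\<not> gauge_pow4 a z < R ^ 4" using h sub A \<open>z \<in> frontier \<Omega>\<close> by blast
  ultimately show ?thesis using sub h by (auto simp: touching_pairs_def)
qed

section \<open>Dilations of weak solutions\<close>

definition dil_coeff :: "real \<Rightarrow> 'n::finite heis \<Rightarrow> real" where
  "dil_coeff r j = (if j = (0, 0, 1) then r\<^sup>2 else r)"

lemma dil_eq_affine:
  fixes z :: "'n::finite heis"
  shows "dil r z = 0 + (\<Sum>j\<in>Basis. (dil_coeff r j * (z \<bullet> j)) *\<^sub>R j)"
proof (rule euclidean_eqI)
  fix b :: "'n heis" assume b: "b \<in> Basis"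
  have "(0 + (\<Sum>j\<in>Basis. (dil_coeff r j * (z \<bullet> j)) *\<^sub>R j)) \<bullet> b = dil_coeff r b * (z \<bullet> b)"
    using b by (simp add: inner_sum_left inner_Basis if_distrib cong: if_cong)
  moreover have "dil r z \<bullet> b = dil_coeff r b * (z \<bullet> b)"
  proof -
    from b consider i where "b = (axis i 1, 0, 0)" | i where "b = (0, axis i 1, 0)" | "b = (0, 0, 1)"
      by (auto simp: Basis_prod_def Basis_vec_def zero_prod_def)
    then show ?thesis
      by cases (auto simp: dil_coeff_def dil_def inner_prod_def inner_axis axis_eq_0_iff)
  qed
  ultimately show "dil r z \<bullet> b = (0 + (\<Sum>j\<in>Basis. (dil_coeff r j * (z \<bullet> j)) *\<^sub>R j)) \<bullet> b" by simp
qed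

lemma
  fixes r :: real
  assumes r: "r > 0"
  shows measurable_dil: "(dil r :: 'n::finite heis \<Rightarrow> 'n heis) \<in> lebesgue \<rightarrow>\<^sub>M lebesgue"
    and lebesgue_dil: "\<exists>J>0. (lebesgue :: 'n heis measure) = density (distr lebesgue lebesgue (dil r)) (\<lambda>_. ennreal J)"
proof -
  have c: "\<And>j :: 'n heis. j \<in> Basis \<Longrightarrow> dil_coeff r j \<noteq> 0" using r by (simp add: dil_coeff_def)
  have eq: "(\<lambda>x :: 'n heis. 0 + (\<Sum>j\<in>Basis. (dil_coeff r j * (x \<bullet> j)) *\<^sub>R j)) = dil r"
    by (simp only: dil_eq_affine[symmetric])
  show "(dil r :: 'n heis \<Rightarrow> 'n heis) \<in> lebesgue \<rightarrow>\<^sub>M lebesgue"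
    using lebesgue_affine_measurable[where c = "dil_coeff r" and t = 0, OF c] unfolding eq by simp
  have "(\<Prod>j\<in>(Basis :: 'n heis set). \<bar>dil_coeff r j\<bar>) > 0" using c by (intro prod_pos) simp
  then show "\<exists>J>0. (lebesgue :: 'n heis measure) = density (distr lebesgue lebesgue (dil r)) (\<lambda>_. ennreal J)"
    using lebesgue_affine_euclidean[where c = "dil_coeff r" and t = 0, OF c] unfolding eq by blast
qed

text \<open>
  The value of the Jacobian is immaterial: the equation is homogeneous, and the norms are only required
  to tend to \<open>0\<close> or to be finite.
\<close>

lemma dil_change_of_variables:
  fixes U :: "'n::finite heis set"
  assumes r: "r > 0" and U: "open U"
  defines "U' \<equiv> {z. dil r z \<in> U}"
  shows open_dil_vimage: "open U'"
    and measurable_dil_on: "dil r \<in> lebesgue_on U' \<rightarrow>\<^sub>M lebesgue_on U"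
    and AE_dil: "\<And>Q. AE z in lebesgue_on U. Q z \<Longrightarrow> AE z in lebesgue_on U'. Q (dil r z)"
    and integral_dil: "\<exists>J>0. (\<forall>f. f \<in> borel_measurable (lebesgue_on U) \<longrightarrow>
        (\<integral>\<^sup>+z. f z \<partial>lebesgue_on U) = ennreal J * (\<integral>\<^sup>+z. f (dil r z) \<partial>lebesgue_on U')) \<and>
      (\<forall>f::_ \<Rightarrow> real. f \<in> borel_measurable (lebesgue_on U) \<longrightarrow>
        (\<integral>z. f z \<partial>lebesgue_on U) = J * (\<integral>z. f (dil r z) \<partial>lebesgue_on U'))"
proof -
  have "U' = dil r -` U" by (auto simp: U'_def)
  moreover have "continuous_on UNIV (dil r :: 'n heis \<Rightarrow> 'n heis)" by (intro continuous_intros)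
  ultimately show oU': "open U'" using U by (simp add: continuous_on_open_vimage)
  have s: "U \<in> sets lebesgue" "U' \<in> sets lebesgue" using U oU' by auto
  note T[measurable] = measurable_dil[OF r, where 'n = 'n]
  show "dil r \<in> lebesgue_on U' \<rightarrow>\<^sub>M lebesgue_on U"
    by (rule measurable_restrict_space3[OF T]) (auto simp: U'_def)
  obtain J where J: "J > 0" "(lebesgue :: 'n heis measure) = density (distr lebesgue lebesgue (dil r)) (\<lambda>_. ennreal J)"
    using lebesgue_dil[OF r] by blast
  have ind: "indicator U (dil r z) = indicator U' z" for z by (simp add: U'_def indicator_def)
  show "AE z in lebesgue_on U'. Q (dil r z)" if Q: "AE z in lebesgue_on U. Q z" for Q
  proof -
    have "AE z in lebesgue. z \<in> U \<longrightarrow> Q z" using Q s by (simp add: AE_restrict_space_iff)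
    then have "AE z in density (distr lebesgue lebesgue (dil r)) (\<lambda>_. ennreal J). z \<in> U \<longrightarrow> Q z"
      by (simp only: J(2)[symmetric])
    then have "AE z in distr lebesgue lebesgue (dil r). z \<in> U \<longrightarrow> Q z"
      using J(1) by (subst (asm) AE_density) auto
    then have "AE z in lebesgue. dil r z \<in> U \<longrightarrow> Q (dil r z)" by (rule AE_distrD[OF T])
    then show ?thesis using s by (simp add: AE_restrict_space_iff U'_def)
  qed
  have nn: "(\<integral>\<^sup>+z. f z \<partial>lebesgue_on U) = ennreal J * (\<integral>\<^sup>+z. f (dil r z) \<partial>lebesgue_on U')"
    if f: "f \<in> borel_measurable (lebesgue_on U)" for f
  proof -
    have m: "(\<lambda>z. f z * indicator U z) \<in> borel_measurable lebesgue"
      using f s by (subst (asm) borel_measurable_restrict_space_iff_ennreal) auto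
    have "(\<integral>\<^sup>+z. f z \<partial>lebesgue_on U) = (\<integral>\<^sup>+z. f z * indicator U z \<partial>lebesgue)"
      using s by (intro nn_integral_restrict_space) auto
    also have "\<dots> = (\<integral>\<^sup>+z. f z * indicator U z \<partial>density (distr lebesgue lebesgue (dil r)) (\<lambda>_. ennreal J))"
      by (rule arg_cong[OF J(2), of "\<lambda>M. \<integral>\<^sup>+z. f z * indicator U z \<partial>M"])
    also have "\<dots> = ennreal J * (\<integral>\<^sup>+z. f z * indicator U z \<partial>distr lebesgue lebesgue (dil r))"
      using m by (simp add: nn_integral_density nn_integral_cmult)
    also have "(\<integral>\<^sup>+z. f z * indicator U z \<partial>distr lebesgue lebesgue (dil r)) = (\<integral>\<^sup>+z. f (dil r z) * indicator U' z \<partial>lebesgue)"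
      using m by (simp add: nn_integral_distr ind)
    also have "\<dots> = (\<integral>\<^sup>+z. f (dil r z) \<partial>lebesgue_on U')"
      using s by (intro nn_integral_restrict_space[symmetric]) auto
    finally show ?thesis .
  qed
  have int: "(\<integral>z. f z \<partial>lebesgue_on U) = J * (\<integral>z. f (dil r z) \<partial>lebesgue_on U')"
    if f: "f \<in> borel_measurable (lebesgue_on U)" for f :: "'n heis \<Rightarrow> real"
  proof -
    have m: "(\<lambda>z. indicator U z *\<^sub>R f z) \<in> borel_measurable lebesgue"
      using f s by (subst (asm) borel_measurable_restrict_space_iff) auto
    have "(\<integral>z. f z \<partial>lebesgue_on U) = (\<integral>z. indicator U z *\<^sub>R f z \<partial>lebesgue)"
      using s by (intro integral_restrict_space) auto
    also have "\<dots> = (\<integral>z. indicator U z *\<^sub>R f z \<partial>density (distr lebesgue lebesgue (dil r)) (\<lambda>_. ennreal J))"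
      by (rule arg_cong[OF J(2), of "\<lambda>M. \<integral>z. indicator U z *\<^sub>R f z \<partial>M"])
    also have "\<dots> = J * (\<integral>z. indicator U z *\<^sub>R f z \<partial>distr lebesgue lebesgue (dil r))"
      using m J(1) by (subst integral_density) auto
    also have "(\<integral>z. indicator U z *\<^sub>R f z \<partial>distr lebesgue lebesgue (dil r)) = (\<integral>z. indicator U' z *\<^sub>R f (dil r z) \<partial>lebesgue)"
      using m by (subst integral_distr[OF T]) (auto simp: ind)
    also have "\<dots> = (\<integral>z. f (dil r z) \<partial>lebesgue_on U')"
      using s by (intro integral_restrict_space[symmetric]) auto
    finally show ?thesis .
  qed
  show "\<exists>J>0. (\<forall>f. f \<in> borel_measurable (lebesgue_on U) \<longrightarrow>
        (\<integral>\<^sup>+z. f z \<partial>lebesgue_on U) = ennreal J * (\<integral>\<^sup>+z. f (dil r z) \<partial>lebesgue_on U')) \<and>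
      (\<forall>f::_ \<Rightarrow> real. f \<in> borel_measurable (lebesgue_on U) \<longrightarrow>
        (\<integral>z. f z \<partial>lebesgue_on U) = J * (\<integral>z. f (dil r z) \<partial>lebesgue_on U'))"
    using J(1) nn int by blast
qed

lemma
  fixes f :: "'n::finite heis \<Rightarrow> real"
  assumes f: "Ck_on 1 U f"
  shows Ck_on_1_dil: "Ck_on 1 {z. dil r z \<in> U} (\<lambda>z. f (dil r z))"
    and hgrad_dil: "dil r z \<in> U \<Longrightarrow> hgrad (\<lambda>z. f (dil r z)) z = r *\<^sub>R hgrad f (dil r z)"
proof -
  have bl: "bounded_linear (dil r :: 'n heis \<Rightarrow> 'n heis)"
    unfolding dil_def real_scaleR_def[symmetric]
    by (intro bounded_linear_Pair bounded_linear_compose[OF bounded_linear_scaleR_right] bounded_linear_fst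
        bounded_linear_snd bounded_linear_compose[OF bounded_linear_fst] bounded_linear_compose[OF bounded_linear_snd])
  have D: "((\<lambda>z. f (dil r z)) has_derivative (\<lambda>v. frechet_derivative f (at (dil r z)) (dil r v))) (at z)"
    if "z \<in> {z. dil r z \<in> U}" for z
    using has_derivative_compose[OF bounded_linear_imp_has_derivative[OF bl] Ck_on_1_differentiable[OF f]] that by simp
  have c: "continuous_on {z. dil r z \<in> U} (\<lambda>z. frechet_derivative f (at (dil r z)) (dil r v))" for v
    by (rule continuous_on_compose2[OF Ck_on_1_continuous_derivative[OF f continuous_on_const]])
      (auto intro!: continuous_intros)
  show "Ck_on 1 {z. dil r z \<in> U} (\<lambda>z. f (dil r z))" by (rule Ck_on_1I[OF D c])
  assume z: "dil r z \<in> U"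
  have X: "dil r (Xvec i z) = r *\<^sub>R Xvec i (dil r z)" and Y: "dil r (Yvec i z) = r *\<^sub>R Yvec i (dil r z)" for i
    by (cases z; simp add: dil_def power2_eq_square)+
  have lin: "linear (frechet_derivative f (at (dil r z)))"
    by (rule has_derivative_linear[OF Ck_on_1_differentiable[OF f z]])
  have "z \<in> {z. dil r z \<in> U}" using z by simp
  from hgrad_eq_horizontal_part[OF D[OF this]]
  show "hgrad (\<lambda>z. f (dil r z)) z = r *\<^sub>R hgrad f (dil r z)"
    unfolding hgrad_horizontal_part_frechet horizontal_part_def X Y linear_cmul[OF lin]
    by (simp add: vec_eq_iff)
qed

lemma sobolev_approx_dil:
  fixes U :: "'n::finite heis set"
  assumes r: "r > 0" and U: "open U" and a: "sobolev_approx p U F f G" and p: "p > 0"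
  shows "sobolev_approx p {z. dil r z \<in> U} (\<lambda>k z. F k (dil r z)) (\<lambda>z. f (dil r z)) (\<lambda>z. r *\<^sub>R G (dil r z))"
proof -
  let ?U = "{z. dil r z \<in> U}"
  note T = measurable_dil_on[OF r U]
  obtain J where J: "J > 0" "\<And>f. f \<in> borel_measurable (lebesgue_on U) \<Longrightarrow>
        (\<integral>\<^sup>+z. f z \<partial>lebesgue_on U) = ennreal J * (\<integral>\<^sup>+z. f (dil r z) \<partial>lebesgue_on ?U)"
    using integral_dil[OF r U] by metis
  have inv: "(\<integral>\<^sup>+z. f (dil r z) \<partial>lebesgue_on ?U) = ennreal (1 / J) * (\<integral>\<^sup>+z. f z \<partial>lebesgue_on U)"
    if "f \<in> borel_measurable (lebesgue_on U)" for f
    unfolding J(2)[OF that] using J(1) by (simp add: mult.assoc[symmetric] flip: ennreal_mult)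
  have a': "f \<in> borel_measurable (lebesgue_on U)" "G \<in> borel_measurable (lebesgue_on U)"
     "\<And>k. Ck_on 1 U (F k)" "integrable (lebesgue_on U) (\<lambda>z. norm (G z) powr p)"
     "\<And>k. integrable (lebesgue_on U) (\<lambda>z. norm (hgrad (F k) z - G z) powr p)"
     "(\<lambda>k. \<integral>\<^sup>+z. norm (hgrad (F k) z - G z) powr p \<partial>lebesgue_on U) \<longlonglongrightarrow> 0"
     "AE z in lebesgue_on U. (\<lambda>k. F k z) \<longlonglongrightarrow> f z"
    using a unfolding sobolev_approx_def by blast+
  note [measurable] = a'(1,2) measurable_hgrad[OF U a'(3)]
  have nn: "(\<integral>\<^sup>+z. norm (r *\<^sub>R H (dil r z)) powr p \<partial>lebesgue_on ?U)
      = ennreal (r powr p / J) * (\<integral>\<^sup>+z. norm (H z) powr p \<partial>lebesgue_on U)"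
    if [measurable]: "H \<in> borel_measurable (lebesgue_on U)" for H :: "'n heis \<Rightarrow> (real ^ 'n) \<times> (real ^ 'n)"
  proof -
    have "(\<integral>\<^sup>+z. norm (r *\<^sub>R H (dil r z)) powr p \<partial>lebesgue_on ?U)
        = (\<integral>\<^sup>+z. (\<lambda>w. ennreal (r powr p) * ennreal (norm (H w) powr p)) (dil r z) \<partial>lebesgue_on ?U)"
      using r by (simp add: powr_mult ennreal_mult)
    also have "\<dots> = ennreal (1 / J) * (\<integral>\<^sup>+w. ennreal (r powr p) * ennreal (norm (H w) powr p) \<partial>lebesgue_on U)"
      by (rule inv) measurable
    also have "\<dots> = ennreal (1 / J) * (ennreal (r powr p) * (\<integral>\<^sup>+w. norm (H w) powr p \<partial>lebesgue_on U))"
      by (subst nn_integral_cmult) auto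
    also have "\<dots> = ennreal (r powr p / J) * (\<integral>\<^sup>+w. norm (H w) powr p \<partial>lebesgue_on U)"
      using J(1) by (simp add: mult.assoc[symmetric] flip: ennreal_mult)
    finally show ?thesis .
  qed
  have int: "integrable (lebesgue_on ?U) (\<lambda>z. norm (r *\<^sub>R H (dil r z)) powr p)"
    if [measurable]: "H \<in> borel_measurable (lebesgue_on U)" and i: "integrable (lebesgue_on U) (\<lambda>z. norm (H z) powr p)"
    for H :: "'n heis \<Rightarrow> (real ^ 'n) \<times> (real ^ 'n)"
  proof (rule integrableI_bounded)
    show "(\<lambda>z. norm (r *\<^sub>R H (dil r z)) powr p) \<in> borel_measurable (lebesgue_on ?U)"
      using measurable_compose[OF T that(1)] by measurable
    show "(\<integral>\<^sup>+z. norm (norm (r *\<^sub>R H (dil r z)) powr p) \<partial>lebesgue_on ?U) < \<infinity>"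
      using nn[OF that(1)] i by (simp add: integrable_iff_bounded ennreal_mult_less_top)
  qed
  have eq: "hgrad (\<lambda>z. F k (dil r z)) z - r *\<^sub>R G (dil r z) = r *\<^sub>R (hgrad (F k) (dil r z) - G (dil r z))"
    if "z \<in> ?U" for k z
    using hgrad_dil[OF a'(3)[of k], of r z] that by (simp add: scaleR_diff_right)
  have mdiff: "(\<lambda>z. hgrad (F k) z - G z) \<in> borel_measurable (lebesgue_on U)" for k by measurable
  have "integrable (lebesgue_on ?U) (\<lambda>z. norm (hgrad (\<lambda>z. F k (dil r z)) z - r *\<^sub>R G (dil r z)) powr p)" for k
    using int[OF mdiff a'(5), of k]
    by (subst Bochner_Integration.integrable_cong[OF refl,
          where g = "\<lambda>z. norm (r *\<^sub>R (hgrad (F k) (dil r z) - G (dil r z))) powr p"]) (auto simp: eq)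
  moreover have "(\<lambda>k. \<integral>\<^sup>+z. norm (hgrad (\<lambda>z. F k (dil r z)) z - r *\<^sub>R G (dil r z)) powr p \<partial>lebesgue_on ?U) \<longlonglongrightarrow> 0"
  proof -
    have "(\<integral>\<^sup>+z. norm (hgrad (\<lambda>z. F k (dil r z)) z - r *\<^sub>R G (dil r z)) powr p \<partial>lebesgue_on ?U)
        = ennreal (r powr p / J) * (\<integral>\<^sup>+z. norm (hgrad (F k) z - G z) powr p \<partial>lebesgue_on U)" for k
      unfolding nn[OF mdiff, symmetric] by (rule nn_integral_cong) (simp add: eq)
    moreover have "(\<lambda>k. ennreal (r powr p / J) * (\<integral>\<^sup>+z. norm (hgrad (F k) z - G z) powr p \<partial>lebesgue_on U)) \<longlonglongrightarrow> ennreal (r powr p / J) * 0"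
      by (intro ennreal_tendsto_cmult a'(6)) simp
    ultimately show ?thesis by simp
  qed
  moreover have "integrable (lebesgue_on ?U) (\<lambda>z. norm (r *\<^sub>R G (dil r z)) powr p)" by (rule int[OF a'(2,4)])
  moreover have "(\<lambda>z. f (dil r z)) \<in> borel_measurable (lebesgue_on ?U)" by (rule measurable_compose[OF T a'(1)])
  moreover have "(\<lambda>z. r *\<^sub>R G (dil r z)) \<in> borel_measurable (lebesgue_on ?U)"
    by (intro borel_measurable_scaleR measurable_const measurable_compose[OF T a'(2)]) auto
  moreover have "AE z in lebesgue_on ?U. (\<lambda>k. F k (dil r z)) \<longlonglongrightarrow> f (dil r z)" by (rule AE_dil[OF r U a'(7)])
  ultimately show ?thesis
    using Ck_on_1_dil[OF a'(3)] unfolding sobolev_approx_def by blast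
qed

lemma C1_0_dil:
  fixes U :: "'n::finite heis set"
  assumes r: "r > 0" and U: "open U" and \<phi>: "\<phi> \<in> C1_0 {z. dil r z \<in> U}"
  shows "(\<lambda>z. \<phi> (dil (1 / r) z)) \<in> C1_0 U"
proof -
  let ?U = "{z. dil r z \<in> U}"
  obtain K where K: "compact K" "K \<subseteq> ?U" "\<And>z. z \<notin> K \<Longrightarrow> \<phi> z = 0" using C1_0E[OF \<phi>] by metis
  have r0: "r \<noteq> 0" using r by simp
  have C: "Ck_on 1 U (\<lambda>z. \<phi> (dil (1 / r) z))"
    by (rule Ck_on_subset[OF Ck_on_1_dil[OF C1_0_Ck_on_UNIV[OF open_dil_vimage[OF r U] \<phi>]]]) simp
  have "compact (dil r ` K)" by (intro compact_continuous_image continuous_intros K)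
  moreover have "dil r ` K \<subseteq> U" using K(2) by auto
  moreover have 0: "\<phi> (dil (1 / r) z) = 0" if "z \<notin> dil r ` K" for z
    using that dil_inverse(2)[OF r0, of z] by (intro K(3)) (metis imageI)
  ultimately have "(\<lambda>z. if z \<in> U then \<phi> (dil (1 / r) z) else 0) \<in> C1_0 U"
    by (intro C1_0_restrictI[OF U _ _ C]) auto
  moreover have "(\<lambda>z. if z \<in> U then \<phi> (dil (1 / r) z) else 0) = (\<lambda>z. \<phi> (dil (1 / r) z))"
  proof
    fix z show "(if z \<in> U then \<phi> (dil (1 / r) z) else 0) = \<phi> (dil (1 / r) z)"
    proof (cases "z \<in> U")
      case False
      then have "z \<notin> dil r ` K" using \<open>dil r ` K \<subseteq> U\<close> by blast
      from 0[OF this] show ?thesis by simp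
    qed simp
  qed
  ultimately show ?thesis by simp
qed

lemma weak_subsolution_dil:
  fixes U :: "'n::finite heis set"
  assumes r: "r > 0" and U: "open U" and G: "G \<in> borel_measurable (lebesgue_on U)"
    and sub: "weak_subsolution p U G"
  shows "weak_subsolution p {z. dil r z \<in> U} (\<lambda>z. r *\<^sub>R G (dil r z))"
  unfolding weak_subsolution_def
proof (intro ballI impI)
  let ?U = "{z. dil r z \<in> U}"
  fix \<phi> assume \<phi>: "\<phi> \<in> C1_0 ?U" "\<forall>z. 0 \<le> \<phi> z"
  define \<psi> where "\<psi> z = \<phi> (dil (1 / r) z)" for z
  have \<psi>: "\<psi> \<in> C1_0 U" unfolding \<psi>_def by (rule C1_0_dil[OF r U \<phi>(1)])
  have C\<psi>: "Ck_on 1 U \<psi>" using \<psi> by (simp add: C1_0_def)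
  have r0: "r \<noteq> 0" using r by simp
  have "\<phi> = (\<lambda>z. \<psi> (dil r z))" by (rule ext) (simp only: \<psi>_def dil_inverse(1)[OF r0])
  then have h: "hgrad \<phi> z = r *\<^sub>R hgrad \<psi> (dil r z)" if "z \<in> ?U" for z
    using hgrad_dil[OF C\<psi>, of r z] that by simp
  define f where "f w = p_flux p (G w) \<bullet> hgrad \<psi> w" for w
  have f: "f \<in> borel_measurable (lebesgue_on U)"
    using G measurable_hgrad[OF U C\<psi>] unfolding f_def p_flux_def by measurable
  obtain J where J: "J > 0" "\<And>f::_ \<Rightarrow> real. f \<in> borel_measurable (lebesgue_on U) \<Longrightarrow>
        (\<integral>z. f z \<partial>lebesgue_on U) = J * (\<integral>z. f (dil r z) \<partial>lebesgue_on ?U)"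
    using integral_dil[OF r U] by metis
  have "(\<integral>z. p_flux p (r *\<^sub>R G (dil r z)) \<bullet> hgrad \<phi> z \<partial>lebesgue_on ?U)
      = (\<integral>z. r powr (p - 1) * r * f (dil r z) \<partial>lebesgue_on ?U)"
    using r by (intro Bochner_Integration.integral_cong) (auto simp: h p_flux_scale f_def)
  also have "\<dots> = r powr (p - 1) * r * (\<integral>z. f (dil r z) \<partial>lebesgue_on ?U)" by simp
  also have "\<dots> \<le> 0"
  proof -
    have "J * (\<integral>z. f (dil r z) \<partial>lebesgue_on ?U) \<le> 0"
    proof -
      have "\<forall>z. 0 \<le> \<psi> z" using \<phi>(2) unfolding \<psi>_def by blast
      then have "(\<integral>z. f z \<partial>lebesgue_on U) \<le> 0"
        using sub \<psi> unfolding weak_subsolution_def f_def by blast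
      then show ?thesis by (simp only: J(2)[OF f])
    qed
    then have "(\<integral>z. f (dil r z) \<partial>lebesgue_on ?U) \<le> 0" using J(1) by (simp add: mult_le_0_iff)
    then show ?thesis using r by (intro mult_nonneg_nonpos) auto
  qed
  finally show "(\<integral>z. p_flux p (r *\<^sub>R G (dil r z)) \<bullet> hgrad \<phi> z \<partial>lebesgue_on ?U) \<le> 0" .
qed

section \<open>Approximation of weak solutions\<close>

lemma hsob_pow_ge:
  "(\<integral>\<^sup>+z. \<bar>f z\<bar> powr p \<partial>lebesgue_on U) \<le> hsob_pow p U f G"
  "(\<integral>\<^sup>+z. norm (G z) powr p \<partial>lebesgue_on U) \<le> hsob_pow p U f G"
  unfolding hsob_pow_def by (intro nn_integral_mono ennreal_leI; simp)+

text \<open>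
  On a bounded set \<open>L\<^sup>p\<close> convergence implies \<open>L\<^sup>1\<close> convergence, and so almost everywhere convergence of a
  subsequence.  Finitely many terms, whose distance to the limit may be infinite, are dropped.
\<close>

lemma sobolev_approx_subsequence:
  fixes U :: "'n::finite heis set"
  assumes p: "p > 1" and U: "open U" "bounded U"
    and [measurable]: "f \<in> borel_measurable (lebesgue_on U)" "G \<in> borel_measurable (lebesgue_on U)"
    and F: "\<And>k. Ck_on 1 U (F k)" and Gp: "integrable (lebesgue_on U) (\<lambda>z. norm (G z) powr p)"
    and lim: "(\<lambda>k. hsob_pow p U (\<lambda>z. F k z - f z) (\<lambda>z. hgrad (F k) z - G z)) \<longlonglongrightarrow> 0"
  obtains r :: "nat \<Rightarrow> nat" where "sobolev_approx p U (\<lambda>k. F (r k)) f G"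
proof -
  let ?M = "lebesgue_on U"
  interpret finite_measure ?M by (rule finite_measure_lebesgue_on_bounded[OF U])
  let ?h = "\<lambda>k. hsob_pow p U (\<lambda>z. F k z - f z) (\<lambda>z. hgrad (F k) z - G z)"
  have [measurable]: "F k \<in> borel_measurable ?M" "hgrad (F k) \<in> borel_measurable ?M" for k
    using U(1) by (auto intro!: measurable_hgrad F continuous_imp_measurable_on_sets_lebesgue[OF Ck_on_1_continuous[OF F]]
        simp del: Ck_on.simps One_nat_def)
  have "\<forall>\<^sub>F k in sequentially. ?h k < 1" using lim by (intro order_tendstoD) auto
  then obtain k0 where k0: "\<And>k. k \<ge> k0 \<Longrightarrow> ?h k < 1" by (auto simp: eventually_sequentially)
  define F' where "F' k = F (k0 + k)" for k
  have lim': "(\<lambda>k. ?h (k0 + k)) \<longlonglongrightarrow> 0" using LIMSEQ_ignore_initial_segment[OF lim, of k0] by (simp add: add.commute)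
  have fin: "?h (k0 + k) < \<infinity>" for k
    using less_trans[OF k0[of "k0 + k"], of \<infinity>] by simp
  have lf: "(\<lambda>k. \<integral>\<^sup>+z. \<bar>F' k z - f z\<bar> powr p \<partial>?M) \<longlonglongrightarrow> 0"
    by (rule tendsto_sandwich[OF _ _ tendsto_const lim']) (auto simp: F'_def hsob_pow_ge(1) intro!: always_eventually)
  have lG: "(\<lambda>k. \<integral>\<^sup>+z. norm (hgrad (F' k) z - G z) powr p \<partial>?M) \<longlonglongrightarrow> 0"
    by (rule tendsto_sandwich[OF _ _ tendsto_const lim'])
      (auto simp: F'_def intro!: always_eventually hsob_pow_ge(2))
  have iG: "integrable ?M (\<lambda>z. norm (hgrad (F' k) z - G z) powr p)" for k
    using le_less_trans[OF hsob_pow_ge(2) fin[of k]] by (intro integrableI_bounded) (auto simp: F'_def)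
  have i_f: "integrable ?M (\<lambda>z. \<bar>F' k z - f z\<bar> powr p)" for k
    using le_less_trans[OF hsob_pow_ge(1) fin[of k]] by (intro integrableI_bounded) (auto simp: F'_def)
  have i1: "integrable ?M (\<lambda>z. F' k z - f z)" for k
  proof (rule Bochner_Integration.integrable_bound[where f = "\<lambda>z. 1 + \<bar>F' k z - f z\<bar> powr p"])
    show "integrable ?M (\<lambda>z. 1 + \<bar>F' k z - f z\<bar> powr p)" using i_f by simp
    show "AE z in ?M. norm (F' k z - f z) \<le> norm (1 + \<bar>F' k z - f z\<bar> powr p)"
      using powr_split_bound[of 1 "\<bar>F' k _ - f _\<bar>" 1 p] p by auto
  qed (simp add: F'_def)
  have "(\<lambda>k. \<integral>\<^sup>+z. 1 powr (p - 1) * \<bar>F' k z - f z\<bar> \<partial>?M) \<longlonglongrightarrow> 0"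
    by (rule weighted_nn_integral_tendsto_0[OF p _ _ _ _ _ lf])
      (use emeasure_finite[of U] in \<open>auto simp: F'_def emeasure_eq_measure\<close>)
  then have "(\<lambda>k. enn2real (\<integral>\<^sup>+z. \<bar>F' k z - f z\<bar> \<partial>?M)) \<longlonglongrightarrow> enn2real 0"
    by (intro tendsto_enn2real) auto
  then have "(\<lambda>k. \<integral>z. norm (F' k z - f z) \<partial>?M) \<longlonglongrightarrow> 0"
    by (subst integral_eq_nn_integral) (auto simp: F'_def)
  then obtain r :: "nat \<Rightarrow> nat" where r: "strict_mono r" "AE z in ?M. (\<lambda>k. F' (r k) z - f z) \<longlonglongrightarrow> 0"
    using tendsto_L1_AE_subseq[of ?M "\<lambda>k z. F' k z - f z", OF i1] by blast
  have ae: "AE z in ?M. (\<lambda>k. F' (r k) z) \<longlonglongrightarrow> f z"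
    using r(2) by eventually_elim (simp add: LIM_zero_iff)
  have "(\<lambda>k. \<integral>\<^sup>+z. norm (hgrad (F' (r k)) z - G z) powr p \<partial>?M) \<longlonglongrightarrow> 0"
    using LIMSEQ_subseq_LIMSEQ[OF lG r(1)] by (simp add: o_def)
  then have "sobolev_approx p U (\<lambda>k. F' (r k)) f G"
    unfolding sobolev_approx_def using ae iG Gp F by (auto simp: F'_def simp del: Ck_on.simps One_nat_def)
  then show ?thesis using that[of "\<lambda>k. k0 + r k"] by (simp add: F'_def)
qed

lemma HW_gradient_integrable:
  fixes U :: "'n::finite heis set"
  assumes p: "p > 0" and U: "open U" and H: "HW p U f G"
  shows "G \<in> borel_measurable (lebesgue_on U)" "integrable (lebesgue_on U) (\<lambda>z. norm (G z) powr p)"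
proof -
  let ?M = "lebesgue_on U"
  show [measurable]: "G \<in> borel_measurable ?M" using H by (simp add: HW_def hsob_completion_def)
  obtain F where F: "\<And>k::nat. Ck_on 1 U (F k)" "\<And>k. hsob_pow p U (F k) (hgrad (F k)) < \<infinity>"
    "(\<lambda>k. hsob_pow p U (\<lambda>z. F k z - f z) (\<lambda>z. hgrad (F k) z - G z)) \<longlonglongrightarrow> 0"
    using H unfolding HW_def hsob_completion_def by blast
  have "\<forall>\<^sub>F k in sequentially. hsob_pow p U (\<lambda>z. F k z - f z) (\<lambda>z. hgrad (F k) z - G z) < 1"
    using F(3) by (intro order_tendstoD) auto
  then obtain k where k: "hsob_pow p U (\<lambda>z. F k z - f z) (\<lambda>z. hgrad (F k) z - G z) < 1"
    by (auto simp: eventually_sequentially)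
  have [measurable]: "hgrad (F k) \<in> borel_measurable ?M" by (rule measurable_hgrad[OF U F(1)])
  have "(\<integral>\<^sup>+z. norm (G z) powr p \<partial>?M) \<le> (\<integral>\<^sup>+z. ennreal (2 powr p) *
      (ennreal (norm (hgrad (F k) z) powr p) + ennreal (norm (hgrad (F k) z - G z) powr p)) \<partial>?M)"
  proof (rule nn_integral_mono)
    fix z
    have "norm (G z) powr p \<le> 2 powr p * (norm (hgrad (F k) z) powr p + norm (G z - hgrad (F k) z) powr p)"
      using norm_add_powr_le[OF p, of "hgrad (F k) z" "G z - hgrad (F k) z"] by simp
    then have "ennreal (norm (G z) powr p) \<le> ennreal (2 powr p * (norm (hgrad (F k) z) powr p + norm (hgrad (F k) z - G z) powr p))"
      by (intro ennreal_leI) (simp add: norm_minus_commute)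
    then show "ennreal (norm (G z) powr p) \<le> ennreal (2 powr p) *
      (ennreal (norm (hgrad (F k) z) powr p) + ennreal (norm (hgrad (F k) z - G z) powr p))"
      by (simp add: ennreal_mult ennreal_plus)
  qed
  also have "\<dots> = ennreal (2 powr p) * ((\<integral>\<^sup>+z. norm (hgrad (F k) z) powr p \<partial>?M)
      + (\<integral>\<^sup>+z. norm (hgrad (F k) z - G z) powr p \<partial>?M))"
    by (subst nn_integral_cmult, measurable, subst nn_integral_add, measurable)
  also have "\<dots> < \<infinity>"
    using le_less_trans[OF hsob_pow_ge(2) F(2)[of k]]
      less_trans[OF le_less_trans[OF hsob_pow_ge(2) k], of \<infinity>]
    by (simp add: ennreal_mult_less_top)
  finally show "integrable ?M (\<lambda>z. norm (G z) powr p)" by (intro integrableI_bounded) auto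
qed

text \<open>
  The weak equation is a sum of integrals, one for each index.  Every summand is integrable, being
  bounded by a multiple of \<open>|G|\<^sup>p\<^sup>-\<^sup>1\<close>, so they can be collected.
\<close>

lemma weakly_p_harmonic_test:
  fixes U :: "'n::finite heis set"
  assumes p: "p > 1" and U: "open U" "bounded U" and H: "weakly_p_harmonic p U f G" and \<phi>: "\<phi> \<in> C1_0 U"
  shows "(\<integral>z. p_flux p (G z) \<bullet> hgrad \<phi> z \<partial>lebesgue_on U) = 0"
proof -
  let ?M = "lebesgue_on U"
  interpret finite_measure ?M by (rule finite_measure_lebesgue_on_bounded[OF U])
  have HW: "HW p U f G" using H by (simp add: weakly_p_harmonic_def)
  have p0: "p > 0" using p by simp
  note G = HW_gradient_integrable[OF p0 U(1) HW]
  note [measurable] = G(1) measurable_hgrad[OF U(1), of \<phi>]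
  have [measurable]: "hgrad \<phi> \<in> borel_measurable ?M"
    using \<phi> by (intro measurable_hgrad U) (simp add: C1_0_def)
  obtain B where B: "B > 0" "\<And>z. norm (hgrad \<phi> z) \<le> B" using C1_0_bounded[OF U(1) \<phi>] by metis
  define t where "t i z = norm (G z) powr (p - 2) * (fst (G z) $ i * Xder i \<phi> z + snd (G z) $ i * Yder i \<phi> z)" for i z
  have sum: "(\<Sum>i\<in>UNIV. t i z) = p_flux p (G z) \<bullet> hgrad \<phi> z" for z
    by (simp add: t_def p_flux_def inner_prod_def inner_vec_def hgrad_def sum.distrib sum_distrib_left distrib_left mult.assoc)
  have int: "integrable ?M (t i)" for i
  proof (rule Bochner_Integration.integrable_bound)
    show "integrable ?M (\<lambda>z. norm (G z) powr (p - 1) * (2 * B))"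
      using B(1) G(2) by (intro integrable_weighted[OF p]) auto
    show "t i \<in> borel_measurable ?M"
    proof -
      have "t i = (\<lambda>z. norm (G z) powr (p - 2) * (fst (G z) $ i * fst (hgrad \<phi> z) $ i + snd (G z) $ i * snd (hgrad \<phi> z) $ i))"
        by (simp add: t_def hgrad_nth fun_eq_iff)
      also have "\<dots> \<in> borel_measurable ?M"
      proof -
        have c: "(\<lambda>v. fst v $ i) \<in> borel_measurable borel" "(\<lambda>v. snd v $ i) \<in> borel_measurable borel"
          for i :: 'n and v :: "(real ^ 'n) \<times> (real ^ 'n)"
          by (intro borel_measurable_continuous_onI continuous_intros)+
        have "(\<lambda>z. fst (H z) $ i) \<in> borel_measurable ?M" "(\<lambda>z. snd (H z) $ i) \<in> borel_measurable ?M"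
          if "H \<in> borel_measurable ?M" for H :: "'n heis \<Rightarrow> (real ^ 'n) \<times> (real ^ 'n)"
          using measurable_compose[OF that c(1)] measurable_compose[OF that c(2)] by auto
        note [measurable] = this[OF G(1)] this[OF \<open>hgrad \<phi> \<in> borel_measurable ?M\<close>]
        show ?thesis by measurable
      qed
      finally show ?thesis .
    qed
    have "norm (t i z) \<le> norm (G z) powr (p - 1) * (2 * B)" for z
    proof -
      have f: "\<bar>fst v $ i\<bar> \<le> norm v" "\<bar>snd v $ i\<bar> \<le> norm v" for v :: "(real ^ 'n) \<times> (real ^ 'n)"
        using component_le_norm_cart[of "fst v" i] norm_fst_le[of "fst v" "snd v"]
          component_le_norm_cart[of "snd v" i] norm_snd_le[of "snd v" "fst v"] by auto
      have h: "\<bar>fst (hgrad \<phi> z) $ i\<bar> \<le> B" "\<bar>snd (hgrad \<phi> z) $ i\<bar> \<le> B"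
        using f[of "hgrad \<phi> z"] B(2)[of z] by linarith+
      have X: "\<bar>fst (G z) $ i * Xder i \<phi> z\<bar> \<le> norm (G z) * B"
        unfolding abs_mult hgrad_nth(1)[symmetric] by (intro mult_mono f h) auto
      have Y: "\<bar>snd (G z) $ i * Yder i \<phi> z\<bar> \<le> norm (G z) * B"
        unfolding abs_mult hgrad_nth(2)[symmetric] by (intro mult_mono f h) auto
      have "norm (t i z) \<le> norm (G z) powr (p - 2) * (norm (G z) * (2 * B))"
      proof -
        have "\<bar>fst (G z) $ i * Xder i \<phi> z + snd (G z) $ i * Yder i \<phi> z\<bar> \<le> norm (G z) * (2 * B)"
          using X Y by (auto simp: abs_le_iff)
        then show ?thesis
          unfolding t_def real_norm_def abs_mult[of "norm (G z) powr (p - 2)"] by (intro mult_mono) auto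
      qed
      also have "\<dots> = norm (G z) powr (p - 1) * (2 * B)"
        by (simp only: mult.assoc[symmetric] powr_minus_two_mult[OF norm_ge_zero])
      finally show ?thesis .
    qed
    then show "AE z in ?M. norm (t i z) \<le> norm (norm (G z) powr (p - 1) * (2 * B))"
      using B(1) by (auto simp: abs_mult)
  qed
  have "(\<Sum>i\<in>UNIV. integral\<^sup>L ?M (t i)) = 0"
    using H \<phi> unfolding weakly_p_harmonic_def t_def[abs_def] by blast
  then show ?thesis using int by (simp add: Bochner_Integration.integral_sum[symmetric] sum)
qed

section \<open>The two one-sided problems\<close>

text \<open>
  The data of the Dirichlet problem, with an approximating sequence \<open>\<theta> + \<phi>\<^sub>k\<close>, where \<open>\<phi>\<^sub>k\<close> has
  compact support in the ring.
\<close>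

locale starshaped_ring =
  fixes p :: real and \<Omega>1 \<Omega>2 U :: "'n::finite heis set" and u :: "'n heis \<Rightarrow> real"
    and G :: "'n heis \<Rightarrow> (real ^ 'n) \<times> (real ^ 'n)" and \<theta> :: "'n heis \<Rightarrow> real"
    and \<phi> :: "nat \<Rightarrow> 'n heis \<Rightarrow> real"
  assumes p: "p > 1"
    and star1: "strictly_starshaped \<Omega>1" and star2: "strictly_starshaped \<Omega>2"
    and compact_inside: "closure \<Omega>1 \<subseteq> \<Omega>2" and ring: "U = \<Omega>2 - closure \<Omega>1"
    and cont: "continuous_on U u"
    and \<theta>: "continuous_on \<Omega>2 \<theta>" "compact_support_in \<Omega>2 \<theta>" "\<And>z. z \<in> closure \<Omega>1 \<Longrightarrow> \<theta> z = 1"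
    and \<phi>: "\<And>k. \<phi> k \<in> C1_0 U"
    and approx: "sobolev_approx p U (\<lambda>k z. \<theta> z + \<phi> k z) u G"
    and test: "\<And>\<psi>. \<psi> \<in> C1_0 U \<Longrightarrow> (\<integral>z. p_flux p (G z) \<bullet> hgrad \<psi> z \<partial>lebesgue_on U) = 0"
begin

abbreviation F :: "nat \<Rightarrow> 'n heis \<Rightarrow> real" where "F k z \<equiv> \<theta> z + \<phi> k z"

lemma open_ring: "open U" and bounded_ring: "bounded U" and ring_subset: "U \<subseteq> \<Omega>2"
proof -
  show "U \<subseteq> \<Omega>2" by (auto simp: ring)
  then show "bounded U" by (rule bounded_subset[OF starshapedD(2)[OF star2]])
  show "open U" unfolding ring by (intro open_Diff starshapedD(1)[OF star2] closed_closure)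
qed

lemma sub: "weak_subsolution p U G" and super: "weak_supersolution p U G"
  using test by (simp_all add: weak_subsolution_def weak_supersolution_def)

lemma zero_sub: "weak_subsolution p U (\<lambda>z. 0)" and zero_super: "weak_supersolution p U (\<lambda>z. 0)"
  by (simp_all add: weak_subsolution_def weak_supersolution_def)

lemma const_approx: "sobolev_approx p U (\<lambda>k z. c) (\<lambda>z. c) (\<lambda>z. 0)"
  using sobolev_approx_smooth[OF open_ring bounded_ring Ck_on_1_const[of UNIV c]] p
  by (simp add: hgrad_const[abs_def])

text \<open>
  Off a compact subset of the ring each approximant either vanishes or is close to \<open>1\<close>, and in a
  compact subset of \<open>\<Omega>\<^sub>2\<close>, respectively away from \<open>\<Omega>\<^sub>1\<close>, only one of the two occurs.
\<close>

lemma boundary_values: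
  assumes K1: "closed K1" "K1 \<inter> closure \<Omega>1 = {}" and K2: "compact K2" "K2 \<subseteq> \<Omega>2" and e: "e > 0"
  obtains C where "compact C" "C \<subseteq> U"
    "\<And>z. z \<in> U - C \<Longrightarrow> F k z = 0 \<and> z \<notin> K2 \<or> \<bar>F k z - 1\<bar> < e \<and> z \<notin> K1"
proof -
  obtain K where K: "compact K" "K \<subseteq> U" "\<And>z. z \<notin> K \<Longrightarrow> \<phi> k z = 0" using C1_0E[OF \<phi>] by metis
  define L where "L = closure {z. \<theta> z \<noteq> 0}"
  have L: "compact L" "L \<subseteq> \<Omega>2" using \<theta>(2) by (auto simp: L_def compact_support_in_def)
  have L0: "\<theta> z = 0" if zL: "z \<notin> L" for z
  proof (rule ccontr)
    assume "\<theta> z \<noteq> 0"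
    then have "z \<in> {z. \<theta> z \<noteq> 0}" by (rule CollectI)
    then have "z \<in> L" unfolding L_def by (rule subsetD[OF closure_subset])
    with zL show False by (rule notE)
  qed
  define W where "W = (\<Omega>2 \<inter> \<theta> -` {1 - e<..<1 + e}) - K1"
  have "open (\<Omega>2 \<inter> \<theta> -` {1 - e<..<1 + e})"
    by (rule continuous_open_preimage[OF \<theta>(1) starshapedD(1)[OF star2] open_greaterThanLessThan])
  then have W: "open W" unfolding W_def using K1(1) by (intro open_Diff)
  have "closure \<Omega>1 \<subseteq> W"
  proof
    fix z assume z: "z \<in> closure \<Omega>1"
    then have "z \<in> \<Omega>2" "\<theta> z = 1" "z \<notin> K1" using compact_inside \<theta>(3) K1(2) by auto
    then show "z \<in> W" using e by (simp add: W_def)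
  qed
  show ?thesis
  proof (rule that[of "K \<union> ((L \<union> K2) \<inter> - W)"])
    show "compact (K \<union> ((L \<union> K2) \<inter> - W))"
      using W by (intro compact_Un K compact_Int_closed L K2) (simp add: closed_Compl)
    show "K \<union> ((L \<union> K2) \<inter> - W) \<subseteq> U"
      using K(2) L(2) K2(2) \<open>closure \<Omega>1 \<subseteq> W\<close> by (auto simp: ring)
    fix z assume z: "z \<in> U - (K \<union> ((L \<union> K2) \<inter> - W))"
    then have \<phi>0: "\<phi> k z = 0" using K(3) by blast
    show "F k z = 0 \<and> z \<notin> K2 \<or> \<bar>F k z - 1\<bar> < e \<and> z \<notin> K1"
    proof (cases "z \<in> W")
      case True
      then show ?thesis using \<phi>0 by (auto simp: W_def)
    next
      case False
      then have "z \<notin> L" "z \<notin> K2" using z by auto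
      then show ?thesis using \<phi>0 L0[of z] by simp
    qed
  qed
qed

lemma u_le_1: "z \<in> U \<Longrightarrow> u z \<le> 1"
proof (rule field_le_epsilon)
  fix e :: real assume z: "z \<in> U" and e: "e > 0"
  have "u z - 1 \<le> e \<or> (1::real) = 0 \<or> (1::real) = 0"
  proof (rule comparison_with_cutoffs[OF p open_ring bounded_ring approx const_approx[of 1] cont _ sub zero_super cutoff_one cutoff_one])
    fix k
    obtain C where C: "compact C" "C \<subseteq> U"
      "\<And>z. z \<in> U - C \<Longrightarrow> F k z = 0 \<and> z \<notin> {} \<or> \<bar>F k z - 1\<bar> < e \<and> z \<notin> {}"
      
  proof (rule boundary_values[of "{}" "{}" e k])
  qed (use e in auto)
    have "F k z - 1 \<le> e" if "z \<in> U - C" for z using C(3)[OF that] e by auto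
    with C show "\<exists>C. compact C \<and> C \<subseteq> U \<and> (\<forall>z\<in>U - C. F k z - 1 \<le> e \<or> (1::real) = 0 \<or> (1::real) = 0)"
      by blast
  qed (use z in auto)
  then show "u z \<le> 1 + e" by simp
qed

lemma u_ge_0: "z \<in> U \<Longrightarrow> 0 \<le> u z"
proof (rule field_le_epsilon)
  fix e :: real assume z: "z \<in> U" and e: "e > 0"
  have "0 - u z \<le> e \<or> (1::real) = 0 \<or> (1::real) = 0"
  proof (rule comparison_with_cutoffs[OF p open_ring bounded_ring const_approx[of 0] approx _ cont zero_sub super cutoff_one cutoff_one])
    fix k
    obtain C where C: "compact C" "C \<subseteq> U"
      "\<And>z. z \<in> U - C \<Longrightarrow> F k z = 0 \<and> z \<notin> {} \<or> \<bar>F k z - 1\<bar> < e \<and> z \<notin> {}"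
      
  proof (rule boundary_values[of "{}" "{}" e k])
  qed (use e in auto)
    have "0 - F k z \<le> e" if "z \<in> U - C" for z using C(3)[OF that] e by auto
    with C show "\<exists>C. compact C \<and> C \<subseteq> U \<and> (\<forall>z\<in>U - C. 0 - F k z \<le> e \<or> (1::real) = 0 \<or> (1::real) = 0)"
      by blast
  qed (use z in auto)
  then show "0 \<le> u z + e" by simp
qed

sublocale inner: capacitary p \<Omega>2 U u G F
proof
  show "\<exists>C. compact C \<and> C \<subseteq> U \<and> (\<forall>z\<in>U \<inter> K - C. F k z > 1 - e)" if K: "compact K" "K \<subseteq> \<Omega>2" "e > 0" for k K e
  proof -
    obtain C where C: "compact C" "C \<subseteq> U" "\<And>z. z \<in> U - C \<Longrightarrow> F k z = 0 \<and> z \<notin> K \<or> \<bar>F k z - 1\<bar> < e \<and> z \<notin> {}"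
      using boundary_values[of "{}" K e k] K by auto
    have "F k z > 1 - e" if "z \<in> U \<inter> K - C" for z using C(3)[of z] that by auto
    with C show ?thesis by blast
  qed
qed (use p starshapedD(1)[OF star2] open_ring bounded_ring ring_subset cont u_ge_0 u_le_1 approx super in auto)

lemma one_minus_approx: "sobolev_approx p U (\<lambda>k z. 1 - F k z) (\<lambda>z. 1 - u z) (\<lambda>z. - G z)"
proof -
  have a: "u \<in> borel_measurable (lebesgue_on U)" "G \<in> borel_measurable (lebesgue_on U)"
     "\<And>k. Ck_on 1 U (F k)" "integrable (lebesgue_on U) (\<lambda>z. norm (G z) powr p)"
     "\<And>k. integrable (lebesgue_on U) (\<lambda>z. norm (hgrad (F k) z - G z) powr p)"
     "(\<lambda>k. \<integral>\<^sup>+z. norm (hgrad (F k) z - G z) powr p \<partial>lebesgue_on U) \<longlonglongrightarrow> 0"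
     "AE z in lebesgue_on U. (\<lambda>k. F k z) \<longlonglongrightarrow> u z"
    using approx unfolding sobolev_approx_def by blast+
  have D: "((\<lambda>t. 1 - t) has_real_derivative - 1) (at t)" for t :: real
    by (auto intro!: derivative_eq_intros)
  have C: "Ck_on 1 U (\<lambda>z. 1 - F k z)" for k
    by (rule Ck_on_1_compose[OF a(3), where h = "\<lambda>t. 1 - t" and h' = "\<lambda>t. - 1"]) (use D in auto)
  have h: "hgrad (\<lambda>z. 1 - F k z) z = - hgrad (F k) z" if "z \<in> U" for k z
    using hgrad_compose[OF a(3)[of k], where h = "\<lambda>t. 1 - t" and h' = "\<lambda>t. - 1" and z = z] D that by simp
  have n: "norm (hgrad (\<lambda>z. 1 - F k z) z - - G z) = norm (hgrad (F k) z - G z)" if "z \<in> U" for k z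
    using norm_minus_cancel[of "hgrad (F k) z - G z"] by (simp add: h[OF that] add.commute)
  have sp: "z \<in> U" if "z \<in> space (lebesgue_on U)" for z using that by (simp add: space_restrict_space)
  have "integrable (lebesgue_on U) (\<lambda>z. norm (hgrad (\<lambda>z. 1 - F k z) z - - G z) powr p)" for k
    by (rule Bochner_Integration.integrable_cong[THEN iffD2, OF refl _ a(5)[of k]]) (simp only: n[OF sp])
  moreover have "(\<integral>\<^sup>+z. norm (hgrad (\<lambda>z. 1 - F k z) z - - G z) powr p \<partial>lebesgue_on U)
      = (\<integral>\<^sup>+z. norm (hgrad (F k) z - G z) powr p \<partial>lebesgue_on U)" for k
    by (rule nn_integral_cong) (simp only: n[OF sp])
  moreover have "AE z in lebesgue_on U. (\<lambda>k. 1 - F k z) \<longlonglongrightarrow> 1 - u z"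
    using a(7) by eventually_elim (intro tendsto_intros)
  moreover have "(\<lambda>z. 1 - u z) \<in> borel_measurable (lebesgue_on U)" using a(1) by measurable
  moreover have "(\<lambda>z. - G z) \<in> borel_measurable (lebesgue_on U)" using a(2) by measurable
  moreover have "integrable (lebesgue_on U) (\<lambda>z. norm (- G z) powr p)" using a(4) by simp
  ultimately show ?thesis
    using a(6) C unfolding sobolev_approx_def by presburger
qed

sublocale outer: capacitary p "- closure \<Omega>1" U "\<lambda>z. 1 - u z" "\<lambda>z. - G z" "\<lambda>k z. 1 - F k z"
proof
  show "\<exists>C. compact C \<and> C \<subseteq> U \<and> (\<forall>z\<in>U \<inter> K - C. 1 - F k z > 1 - e)"
    if K: "compact K" "K \<subseteq> - closure \<Omega>1" "e > 0" for k K e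
  proof -
    obtain C where C: "compact C" "C \<subseteq> U" "\<And>z. z \<in> U - C \<Longrightarrow> F k z = 0 \<and> z \<notin> {} \<or> \<bar>F k z - 1\<bar> < e \<and> z \<notin> K"
    proof (rule boundary_values[of K "{}" e k])
    qed (use K compact_imp_closed in auto)
    have "1 - F k z > 1 - e" if "z \<in> U \<inter> K - C" for z using C(3)[of z] that K(3) by auto
    with C show ?thesis by blast
  qed
  show "weak_supersolution p U (\<lambda>z. - G z)"
    using test by (simp add: weak_supersolution_def p_flux_minus)
qed (use p open_ring bounded_ring cont u_ge_0 u_le_1 one_minus_approx in \<open>auto simp: ring intro!: continuous_intros\<close>)

text \<open>
  Dilation orbits join every point of \<open>\<Omega>\<^sub>2\<close> to \<open>\<Omega>\<^sub>1\<close> inside \<open>\<Omega>\<^sub>2\<close>, and every point outside the closure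
  of \<open>\<Omega>\<^sub>1\<close> to the complement of \<open>\<Omega>\<^sub>2\<close> outside the closure of \<open>\<Omega>\<^sub>1\<close>.
\<close>

lemma inner_positive: "z \<in> \<Omega>2 \<Longrightarrow> inner.positive_near z"
proof (rule inner.positive_near_connected[where C = "(\<lambda>r. dil r z) ` {0..1}" and ?z0.0 = 0])
  assume z: "z \<in> \<Omega>2"
  show "connected ((\<lambda>r. dil r z) ` {0..1})" by (rule dilation_segment_connected)
  show "(\<lambda>r. dil r z) ` {0..1} \<subseteq> \<Omega>2"
  proof (rule image_subsetI)
    fix r :: real assume "r \<in> {0..1}"
    then show "dil r z \<in> \<Omega>2"
      using z starshaped_dil_mem[OF star2, of z r] closure_subset[of \<Omega>2] by (cases "r = 1") auto
  qed
  have "dil 0 z = 0" by (simp add: dil_def zero_prod_def)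
  then show "0 \<in> (\<lambda>r. dil r z) ` {0..1}" by (metis atLeastAtMost_iff image_eqI order_refl zero_le_one)
  show "z \<in> (\<lambda>r. dil r z) ` {0..1}" by (rule image_eqI[of _ _ 1]) auto
  have "\<Omega>1 \<inter> U = {}" using closure_subset[of \<Omega>1] by (auto simp: ring)
  then show "inner.positive_near 0"
    unfolding inner.positive_near_def using starshapedD(1,3)[OF star1]
    by (intro exI[of _ 1] conjI exI[of _ \<Omega>1]) auto
qed

lemma outer_positive: "z \<in> - closure \<Omega>1 \<Longrightarrow> outer.positive_near z"
proof -
  assume z: "z \<in> - closure \<Omega>1"
  then have "z \<noteq> 0" using starshapedD(3)[OF star1] closure_subset by blast
  then obtain R where R: "R \<ge> 1" "dil R z \<notin> closure \<Omega>2" using starshaped_exit[OF star2] by blast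
  show ?thesis
  proof (rule outer.positive_near_connected[where C = "(\<lambda>r. dil r z) ` {1..R}" and ?z0.0 = "dil R z"])
    show "connected ((\<lambda>r. dil r z) ` {1..R})" by (rule dilation_segment_connected)
    show "(\<lambda>r. dil r z) ` {1..R} \<subseteq> - closure \<Omega>1"
    proof (rule image_subsetI)
      fix r :: real assume r: "r \<in> {1..R}"
      have "z \<notin> \<Omega>1" using z closure_subset by blast
      then show "dil r z \<in> - closure \<Omega>1"
        using z r starshaped_dil_not_mem[OF star1, of z r] by (cases "r = 1") auto
    qed
    show "dil R z \<in> (\<lambda>r. dil r z) ` {1..R}" using R(1) by auto
    show "z \<in> (\<lambda>r. dil r z) ` {1..R}" using R(1) by (intro image_eqI[of _ _ 1]) auto
    have "- closure \<Omega>2 \<inter> U = {}" using closure_subset[of \<Omega>2] by (auto simp: ring)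
    then show "outer.positive_near (dil R z)"
      unfolding outer.positive_near_def using R(2)
      by (intro exI[of _ 1] conjI exI[of _ "- closure \<Omega>2"]) auto
  qed
qed

section \<open>Linear growth along dilations\<close>

text \<open>
  Let \<open>z\<^sub>0 = \<delta>\<^sub>q z\<close> be the point where the orbit of \<open>z\<close> leaves \<open>\<Omega>\<^sub>2\<close>, so \<open>q > r\<close> and \<open>z = \<delta>\<^sub>1\<^sub>-\<^sub>h z\<^sub>0\<close> with
  \<open>h = 1 - 1 / q \<ge> (r - 1) / 2\<close>.  For small \<open>h\<close> use the ball that touches at \<open>z\<^sub>0\<close>; all other \<open>z\<close> lie in
  a compact subset of \<open>\<Omega>\<^sub>2\<close>.
\<close>

lemma inner_growth:
  assumes "uniform_interior_hball \<Omega>2"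
  obtains m where "m > 0" "\<And>r z. 1 < r \<Longrightarrow> r < 2 \<Longrightarrow> z \<in> U \<Longrightarrow> dil r z \<in> \<Omega>2 \<Longrightarrow> m * (r - 1) \<le> u z"
proof -
  let ?E = "frontier \<Omega>2"
  have disj: "\<Omega>2 \<inter> ?E = {}" using starshapedD(1)[OF star2] by (auto simp: frontier_def interior_open)
  obtain R where R: "R > 0" "\<And>z. z \<in> ?E \<Longrightarrow> \<exists>a\<in>\<Omega>2. hball a R \<subseteq> \<Omega>2 \<and> closure (hball a R) \<inter> ?E = {z}"
    using assms unfolding uniform_interior_hball_def by blast
  have S: "R ^ 4 > 0" using R(1) by simp
  have touch: "\<exists>a. (a, z) \<in> touching_pairs \<Omega>2 ?E (R ^ 4)" if "z \<in> ?E" for z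
    using R(2)[OF that] touching_pair_of_hball[OF R(1) _ disj] by blast
  have cross: "0 < 1 * gauge_pow4_deriv a z (dilation_field z)" if "(a, z) \<in> touching_pairs \<Omega>2 ?E (R ^ 4)" for a z
    using interior_touching[OF star2 S that] by simp
  obtain M h0 where M: "M > 0" "h0 > 0"
    "\<And>z h. z \<in> ?E \<Longrightarrow> 0 < h \<Longrightarrow> h \<le> h0 \<Longrightarrow> dil (1 - 1 * h) z \<in> U \<Longrightarrow> M * h \<le> u (dil (1 - 1 * h) z)"
    using inner.growth_along_dilations[OF S starshapedD(5)[OF star2] touch cross inner_positive] by metis
  define h1 where "h1 = min h0 (1 / 2)"
  have h1: "0 < h1" "h1 \<le> h0" "h1 < 1" using M(2) by (auto simp: h1_def)
  let ?K = "dil (1 - h1) ` closure \<Omega>2"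
  have K: "compact ?K" by (intro compact_continuous_image continuous_intros starshapedD(4)[OF star2])
  have "inner.positive_near z" if "z \<in> ?K" for z
  proof (rule inner_positive)
    show "z \<in> \<Omega>2" using that starshaped_dil_mem[OF star2, of _ "1 - h1"] h1 by auto
  qed
  then obtain c where c: "c > 0" "\<And>z. z \<in> ?K \<inter> U \<Longrightarrow> c \<le> u z"
    using inner.lower_bound_on_compact[OF K] by metis
  define m where "m = min (M / 2) c"
  show ?thesis
  proof (rule that[of m])
    show "m > 0" using M c by (simp add: m_def)
    fix r z assume r: "1 < r" "r < 2" and z: "z \<in> U" "dil r z \<in> \<Omega>2"
    have r0: "r \<noteq> 0" using r by simp
    have "z \<noteq> 0" using z(1) starshapedD(3)[OF star1] closure_subset[of \<Omega>1] by (auto simp: ring)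
    then have "dil r z \<noteq> 0" using dil_inverse(1)[OF r0, of z] by (auto simp: dil_def zero_prod_def)
    then obtain b where b: "b \<ge> 1" "dil b (dil r z) \<notin> closure \<Omega>2" using starshaped_exit[OF star2] by blast
    then obtain t where t: "1 < t" "dil t (dil r z) \<in> ?E"
      using starshaped_boundary_hit[OF star2, of 1 b "dil r z"] z(2) by auto
    define q where "q = t * r"
    have "r < q" using t(1) r mult_strict_right_mono[of 1 t r] by (simp add: q_def)
    then have q: "r < q" "1 < q" using r by auto
    then have q0: "q \<noteq> 0" by simp
    define z0 where "z0 = dil q z"
    have z0: "z0 \<in> ?E" using t(2) by (simp add: z0_def q_def dil_dil)
    have zz: "z = dil (1 / q) z0" unfolding z0_def dil_inverse(1)[OF q0] ..
    define h where "h = 1 - 1 / q"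
    have "1 / q < 1 / r" using q r by (simp add: frac_less2)
    moreover have "0 \<le> (r - 1) * (2 - r)" using r by simp
    then have "(r - 1) / 2 \<le> 1 - 1 / r" using r by (simp add: field_simps)
    ultimately have h: "(r - 1) / 2 \<le> h" "0 < h" "h < 1" using q r by (auto simp: h_def)
    show "m * (r - 1) \<le> u z"
    proof (cases "h \<le> h1")
      case True
      have "M * h \<le> u (dil (1 - 1 * h) z0)"
        using True h1 h z(1) zz by (intro M(3) z0) (auto simp: h_def)
      then have "M * h \<le> u z" by (simp add: h_def zz[symmetric])
      moreover have "m * (r - 1) \<le> M / 2 * (r - 1)" using r by (intro mult_right_mono) (auto simp: m_def)
      moreover have "M * ((r - 1) / 2) \<le> M * h" using h M(1) by (intro mult_left_mono) auto
      ultimately show ?thesis by simp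
    next
      case False
      have "z = dil (1 - h1) (dil ((1 - h) / (1 - h1)) z0)" using h1 zz by (simp add: dil_dil h_def)
      moreover have "dil ((1 - h) / (1 - h1)) z0 \<in> \<Omega>2"
        using z0 False h h1 by (intro starshaped_dil_mem[OF star2]) (auto simp: frontier_def)
      ultimately have "z \<in> ?K" using closure_subset[of \<Omega>2] by blast
      then have "c \<le> u z" using c(2) z(1) by blast
      moreover have "m * (r - 1) \<le> c * 1" using r c by (intro mult_mono) (auto simp: m_def)
      ultimately show ?thesis by simp
    qed
  qed
qed

text \<open>
  The mirror image: now \<open>z = \<delta>\<^sub>q z\<^sub>0 = \<delta>\<^sub>1\<^sub>+\<^sub>h z\<^sub>0\<close>, where \<open>z\<^sub>0\<close> is the point at which the orbit leaves
  \<open>\<Omega>\<^sub>1\<close>.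
\<close>

lemma outer_growth:
  assumes "uniform_exterior_hball \<Omega>1"
  obtains m where "m > 0"
    "\<And>r z. 1 < r \<Longrightarrow> r < 2 \<Longrightarrow> z \<in> U \<Longrightarrow> dil (1 / r) z \<notin> closure \<Omega>1 \<Longrightarrow> m * (r - 1) \<le> 1 - u z"
proof -
  let ?E = "frontier \<Omega>1" and ?A = "- closure \<Omega>1"
  have disj: "?A \<inter> ?E = {}" by (auto simp: frontier_def)
  obtain R where R: "R > 0" "\<And>z. z \<in> ?E \<Longrightarrow> \<exists>a\<in>?A. hball a R \<subseteq> ?A \<and> closure (hball a R) \<inter> ?E = {z}"
    using assms unfolding uniform_exterior_hball_def by blast
  have S: "R ^ 4 > 0" using R(1) by simp
  have touch: "\<exists>a. (a, z) \<in> touching_pairs ?A ?E (R ^ 4)" if "z \<in> ?E" for z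
    using R(2)[OF that] touching_pair_of_hball[OF R(1) _ disj] by blast
  have cross: "0 < - 1 * gauge_pow4_deriv a z (dilation_field z)" if "(a, z) \<in> touching_pairs ?A ?E (R ^ 4)" for a z
    using exterior_touching[OF star1 S that] by simp
  obtain M h0 where M: "M > 0" "h0 > 0"
    "\<And>z h. z \<in> ?E \<Longrightarrow> 0 < h \<Longrightarrow> h \<le> h0 \<Longrightarrow> dil (1 - - 1 * h) z \<in> U \<Longrightarrow> M * h \<le> 1 - u (dil (1 - - 1 * h) z)"
    using outer.growth_along_dilations[OF S starshapedD(5)[OF star1] touch cross outer_positive] by metis
  let ?K = "closure U \<inter> {z. dil (1 / (1 + h0)) z \<notin> \<Omega>1}"
  have "closed {z. dil (1 / (1 + h0)) z \<notin> \<Omega>1}"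
    by (rule closed_dil_not_mem[OF starshapedD(1)[OF star1]])
  then have K: "compact ?K" using bounded_ring by (intro compact_Int_closed) auto
  have "outer.positive_near z" if "z \<in> ?K" for z
  proof (rule outer_positive)
    show "z \<in> ?A" using that starshaped_dil_mem[OF star1, of z "1 / (1 + h0)"] M(2) by auto
  qed
  then obtain c where c: "c > 0" "\<And>z. z \<in> ?K \<inter> U \<Longrightarrow> c \<le> 1 - u z"
    using outer.lower_bound_on_compact[OF K] by metis
  define m where "m = min M c"
  show ?thesis
  proof (rule that[of m])
    show "m > 0" using M c by (simp add: m_def)
    fix r z assume r: "1 < r" "r < 2" and z: "z \<in> U" "dil (1 / r) z \<notin> closure \<Omega>1"
    have "dil 0 (dil (1 / r) z) = 0" by (simp add: dil_def zero_prod_def)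
    then obtain t where t: "0 < t" "t < 1" "dil t (dil (1 / r) z) \<in> ?E"
      using starshaped_boundary_hit[OF star1, of 0 1 "dil (1 / r) z"] z(2) starshapedD(3)[OF star1] by auto
    define q where "q = r / t"
    have "r < q" using t r by (simp add: q_def less_divide_eq)
    then have q: "r < q" "1 < q" using r by auto
    then have q0: "q \<noteq> 0" by simp
    define z0 where "z0 = dil (1 / q) z"
    have z0: "z0 \<in> ?E" using t(3) by (simp add: z0_def q_def dil_dil)
    have zz: "z = dil q z0" unfolding z0_def dil_inverse(2)[OF q0] ..
    define h where "h = q - 1"
    have h: "r - 1 \<le> h" "0 < h" using q by (auto simp: h_def)
    show "m * (r - 1) \<le> 1 - u z"
    proof (cases "h \<le> h0")
      case True
      have "M * h \<le> 1 - u (dil (1 - - 1 * h) z0)"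
        using True h z(1) zz by (intro M(3) z0) (auto simp: h_def)
      then have "M * h \<le> 1 - u z" by (simp add: h_def zz[symmetric])
      moreover have "m * (r - 1) \<le> M * h" using r h M(1) by (intro mult_mono) (auto simp: m_def)
      ultimately show ?thesis by simp
    next
      case False
      have "dil (1 / (1 + h0)) z \<notin> \<Omega>1"
      proof
        assume "dil (1 / (1 + h0)) z \<in> \<Omega>1"
        then have "dil ((1 + h0) / q) (dil (1 / (1 + h0)) z) \<in> \<Omega>1"
          using False M(2) q closure_subset[of \<Omega>1]
          by (intro starshaped_dil_mem[OF star1]) (auto simp: h_def)
        then have "z0 \<in> \<Omega>1" using M(2) by (simp add: z0_def dil_dil)
        then show False using z0 starshapedD(1)[OF star1] by (simp add: frontier_def interior_open)
      qed
      then have "z \<in> ?K" using z(1) closure_subset[of U] by blast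
      then have "c \<le> 1 - u z" using c(2) z(1) by blast
      moreover have "m * (r - 1) \<le> c * 1" using r c by (intro mult_mono) (auto simp: m_def)
      ultimately show ?thesis by simp
    qed
  qed
qed

section \<open>Comparison of the solution with its dilations\<close>

text \<open>
  The functions \<open>u \<circ> \<delta>\<^sub>r\<close> and \<open>u\<close> are compared in \<open>V = \<delta>\<^sub>1\<^sub>/\<^sub>r \<Omega>\<^sub>2 - closure \<Omega>\<^sub>1\<close>, where both are \<open>p\<close>-harmonic.
  On the outer part of the boundary only the first has a boundary value attained by its approximants, on
  the inner part only the second.  But the two hypotheses give \<open>u \<ge> m\<close> and \<open>u \<circ> \<delta>\<^sub>r \<le> 1 - m\<close>
  in all of \<open>V\<close>.  So where \<open>u \<circ> \<delta>\<^sub>r - u\<close> exceeds \<open>e - m\<close>, the first function is at least \<open>e\<close> and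
  the second at most \<open>1 - e\<close>, and cutting off the values of the first near \<open>0\<close> and of the second near
  \<open>1\<close> gives test functions of compact support.
\<close>

lemma dilation_comparison:
  assumes r: "1 < r" and m: "m > 0"
    and low: "\<And>z. z \<in> U \<Longrightarrow> dil r z \<in> \<Omega>2 \<Longrightarrow> m \<le> u z"
    and up: "\<And>z. z \<in> U \<Longrightarrow> dil (1 / r) z \<notin> closure \<Omega>1 \<Longrightarrow> m \<le> 1 - u z"
    and z: "z \<in> U" "dil r z \<in> \<Omega>2"
  shows "u (dil r z) \<le> u z - m"
proof -
  have r0: "r > 0" "r \<noteq> 0" using r by auto
  define V where "V = {z. dil r z \<in> \<Omega>2} - closure \<Omega>1"
  have VU: "V \<subseteq> U" and VdU: "V \<subseteq> {z. dil r z \<in> U}"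
  proof -
    show "V \<subseteq> U"
    proof
      fix z assume z: "z \<in> V"
      then have "dil (1 / r) (dil r z) \<in> \<Omega>2"
        using r closure_subset[of \<Omega>2] by (intro starshaped_dil_mem[OF star2]) (auto simp: V_def)
      then show "z \<in> U" using z by (simp add: dil_inverse(1)[OF r0(2)] ring V_def)
    qed
    show "V \<subseteq> {z. dil r z \<in> U}"
    proof
      fix z assume z: "z \<in> V"
      then have "z \<notin> \<Omega>1" using closure_subset by (auto simp: V_def)
      then have "dil r z \<notin> closure \<Omega>1" by (rule starshaped_dil_not_mem[OF star1 _ r])
      then show "z \<in> {z. dil r z \<in> U}" using z by (simp add: V_def ring)
    qed
  qed
  have oV: "open V"
    unfolding V_def using open_dil_vimage[OF r0(1) starshapedD(1)[OF star2]] by (intro open_Diff) auto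
  have bV: "bounded V" using bounded_ring VU by (rule bounded_subset)
  have zV: "z \<in> V" using z by (simp add: V_def ring)
  have oU': "open {z. dil r z \<in> U}" by (rule open_dil_vimage[OF r0(1) open_ring])
  have Gm: "G \<in> borel_measurable (lebesgue_on U)" using approx by (simp add: sobolev_approx_def)
  have a1: "sobolev_approx p V (\<lambda>k z. F k (dil r z)) (\<lambda>z. u (dil r z)) (\<lambda>z. r *\<^sub>R G (dil r z))"
    using p by (intro sobolev_approx_subset[OF sobolev_approx_dil[OF r0(1) open_ring approx] oV oU' VdU]) simp
  have a2: "sobolev_approx p V F u G" by (rule sobolev_approx_subset[OF approx oV open_ring VU])
  have c1: "continuous_on V (\<lambda>z. u (dil r z))"
    by (rule continuous_on_compose2[OF cont]) (use VdU in \<open>auto intro!: continuous_intros\<close>)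
  have c2: "continuous_on V u" by (rule continuous_on_subset[OF cont VU])
  have s1: "weak_subsolution p V (\<lambda>z. r *\<^sub>R G (dil r z))"
    by (rule weak_subsolution_subset[OF weak_subsolution_dil[OF r0(1) open_ring Gm sub] oV VdU oU'])
  have s2: "weak_supersolution p V G" by (rule weak_supersolution_subset[OF super oV VU open_ring])
  have lowV: "m \<le> u w" if "w \<in> V" for w using low[of w] VU that by (auto simp: V_def)
  have upV: "u (dil r w) \<le> 1 - m" if w: "w \<in> V" for w
    using up[of "dil r w"] VdU w by (auto simp: V_def dil_inverse(1)[OF r0(2)])
  have "u (dil r z) - u z \<le> e - m" if e: "0 < e" "e < 1" for e
  proof -
    let ?\<eta>1 = "plateau (e / 2) 3 (e / 2)" and ?\<eta>2 = "plateau (- 2) (1 - e / 2) (e / 2)"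
    have e2: "e / 2 > 0" using e by simp
    note pl = plateau_props[OF e2]
    have range: "e \<le> u (dil r w) \<and> u (dil r w) \<le> 1 \<and> 0 \<le> u w \<and> u w \<le> 1 - e"
      if "w \<in> V" "e - m < u (dil r w) - u w" for w
      using that lowV[of w] upV[of w] m by linarith
    have "u (dil r z) - u z \<le> e - m \<or> ?\<eta>1 (u (dil r z)) = 0 \<or> ?\<eta>2 (u z) = 0"
    proof (rule comparison_with_cutoffs[OF p oV bV a1 a2 c1 c2 s1 s2 cutoff_plateau[OF e2] cutoff_plateau[OF e2] _ _ zV])
      fix w assume w: "w \<in> V" "e - m < u (dil r w) - u w"
      show "plateau_deriv (e / 2) 3 (e / 2) (u (dil r w)) = 0 \<and> plateau_deriv (- 2) (1 - e / 2) (e / 2) (u w) = 0"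
        using range[OF w] e by (intro conjI pl(3)) auto
    next
      fix k
      let ?K1 = "{w. dil (1 / r) w \<notin> \<Omega>1}" and ?K2 = "dil (1 / r) ` closure \<Omega>2"
      have "closed ?K1" by (rule closed_dil_not_mem[OF starshapedD(1)[OF star1]])
      moreover have "?K1 \<inter> closure \<Omega>1 = {}" using starshaped_dil_mem[OF star1, of _ "1 / r"] r by auto
      ultimately obtain C1 where C1: "compact C1" "C1 \<subseteq> U"
        "\<And>z. z \<in> U - C1 \<Longrightarrow> F k z = 0 \<and> z \<notin> {} \<or> \<bar>F k z - 1\<bar> < e / 2 \<and> z \<notin> ?K1"
        using boundary_values[of ?K1 "{}" "e / 2" k] e2 by (metis compact_empty empty_subsetI)
      have "compact ?K2" by (intro compact_continuous_image continuous_intros starshapedD(4)[OF star2])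
      moreover have "?K2 \<subseteq> \<Omega>2" using starshaped_dil_mem[OF star2, of _ "1 / r"] r by auto
      ultimately obtain C2 where C2: "compact C2" "C2 \<subseteq> U"
        "\<And>z. z \<in> U - C2 \<Longrightarrow> F k z = 0 \<and> z \<notin> ?K2 \<or> \<bar>F k z - 1\<bar> < e / 2 \<and> z \<notin> {}"
        using boundary_values[of "{}" ?K2 "e / 2" k] e2 by (metis closed_empty Int_empty_left)
      show "\<exists>C. compact C \<and> C \<subseteq> V \<and>
          (\<forall>w\<in>V - C. F k (dil r w) - F k w \<le> e - m \<or> ?\<eta>1 (F k (dil r w)) = 0 \<or> ?\<eta>2 (F k w) = 0)"
      proof (intro exI conjI ballI)
        have "compact (dil (1 / r) ` C1)" by (intro compact_continuous_image continuous_intros C1)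
        then show "compact (C2 \<inter> dil (1 / r) ` C1)" using C2(1) by (rule compact_Int[rotated])
        show "C2 \<inter> dil (1 / r) ` C1 \<subseteq> V"
        proof
          fix w assume w: "w \<in> C2 \<inter> dil (1 / r) ` C1"
          then obtain y where y: "y \<in> C1" "w = dil (1 / r) y" by blast
          then have "dil r w \<in> \<Omega>2" using C1(2) ring_subset by (auto simp: dil_inverse(2)[OF r0(2)])
          moreover have "w \<notin> closure \<Omega>1" using w C2(2) by (auto simp: ring)
          ultimately show "w \<in> V" by (simp add: V_def)
        qed
        fix w assume w: "w \<in> V - C2 \<inter> dil (1 / r) ` C1"
        have inv: "w = dil (1 / r) (dil r w)" by (simp only: dil_inverse(1)[OF r0(2)])
        show "F k (dil r w) - F k w \<le> e - m \<or> ?\<eta>1 (F k (dil r w)) = 0 \<or> ?\<eta>2 (F k w) = 0"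
        proof (cases "w \<in> C2")
          case False
          have "w \<in> ?K2" using w inv closure_subset[of \<Omega>2] unfolding V_def by blast
          moreover have "w \<in> U - C2" using w VU False by blast
          ultimately have "\<bar>F k w - 1\<bar> < e / 2" using C2(3)[of w] by blast
          then have "F k w > 1 - e / 2" by linarith
          then show ?thesis using pl(1)[of "F k w"] by simp
        next
          case True
          then have "dil r w \<notin> C1" using w inv by blast
          moreover have "dil r w \<in> U" using w VdU by blast
          moreover have "dil (1 / r) (dil r w) \<notin> \<Omega>1"
            using w closure_subset[of \<Omega>1] unfolding inv[symmetric] V_def by blast
          ultimately have "F k (dil r w) = 0" using C1(3)[of "dil r w"] by blast
          then show ?thesis using pl(1)[of 0] e2 by simp
        qed
      qed
    qed
    moreover have "?\<eta>1 (u (dil r z)) = 1 \<and> ?\<eta>2 (u z) = 1" if "e - m < u (dil r z) - u z"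
      using range[OF zV that] e by (intro conjI pl(2)) auto
    ultimately show ?thesis by fastforce
  qed
  then have "u (dil r z) - u z + m \<le> e" if "0 < e" "e < 1" for e using that by fastforce
  then have "u (dil r z) - u z + m \<le> 0" by (metis dense_ge_bounded zero_less_one)
  then show ?thesis by simp
qed

text \<open>
  If the derivative of \<open>u(\<delta>\<^sub>r z) + m r\<close> at \<open>r = 1\<close> were positive, the comparison would fail for \<open>r\<close> slightly
  larger than \<open>1\<close>.
\<close>

lemma gradient_bound:
  assumes "uniform_exterior_hball \<Omega>1" "uniform_interior_hball \<Omega>2"
  shows "\<exists>M>0. \<forall>z\<in>U. \<forall>D. GDERIV u z :> D \<longrightarrow> D \<bullet> dilation_field z < - M"
proof -
  obtain m1 where m1: "m1 > 0" "\<And>r z. 1 < r \<Longrightarrow> r < 2 \<Longrightarrow> z \<in> U \<Longrightarrow> dil r z \<in> \<Omega>2 \<Longrightarrow> m1 * (r - 1) \<le> u z"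
    using inner_growth[OF assms(2)] by metis
  obtain m2 where m2: "m2 > 0"
    "\<And>r z. 1 < r \<Longrightarrow> r < 2 \<Longrightarrow> z \<in> U \<Longrightarrow> dil (1 / r) z \<notin> closure \<Omega>1 \<Longrightarrow> m2 * (r - 1) \<le> 1 - u z"
    using outer_growth[OF assms(1)] by metis
  define m where "m = min m1 m2"
  have m: "m > 0" using m1 m2 by (simp add: m_def)
  have le: "u (dil r z) \<le> u z - m * (r - 1)" if r: "1 < r" "r < 2" and z: "z \<in> U" "dil r z \<in> \<Omega>2" for r z
  proof (rule dilation_comparison[OF r(1) _ _ _ z])
    show "m * (r - 1) > 0" using m r by simp
    have "m * (r - 1) \<le> m1 * (r - 1)" "m * (r - 1) \<le> m2 * (r - 1)"
      using r by (intro mult_right_mono; simp add: m_def)+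
    then show "m * (r - 1) \<le> u w" if "w \<in> U" "dil r w \<in> \<Omega>2" for w
      using m1(2)[OF r that] by linarith
    show "m * (r - 1) \<le> 1 - u w" if "w \<in> U" "dil (1 / r) w \<notin> closure \<Omega>1" for w
      using m2(2)[OF r that] \<open>m * (r - 1) \<le> m2 * (r - 1)\<close> by linarith
  qed
  have "D \<bullet> dilation_field z \<le> - m" if z: "z \<in> U" and D: "GDERIV u z :> D" for z D
  proof (rule ccontr)
    assume "\<not> ?thesis"
    then have pos: "D \<bullet> dilation_field z + m > 0" by simp
    have du: "(u has_derivative (\<lambda>h. D \<bullet> h)) (at (dil 1 z))"
      using D by (simp add: gderiv_def inner_commute[of _ D])
    have "((\<lambda>r. u (dil r z)) has_derivative (\<lambda>h. D \<bullet> (h *\<^sub>R (fst z, fst (snd z), 2 * 1 * snd (snd z))))) (at 1)"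
      by (rule has_derivative_compose[OF has_derivative_dil du])
    then have "((\<lambda>r. u (dil r z)) has_real_derivative D \<bullet> dilation_field z) (at 1)"
      by (rule has_derivative_imp_has_field_derivative) (simp only: inner_scaleR_right dilation_field_eq mult_1_right)
    then have "((\<lambda>r. u (dil r z) + m * r) has_real_derivative D \<bullet> dilation_field z + m) (at 1)"
      by (auto intro!: derivative_eq_intros)
    from DERIV_pos_inc_right[OF this pos] obtain d where d: "d > 0"
      "\<And>h. 0 < h \<Longrightarrow> h < d \<Longrightarrow> u z + m < u (dil (1 + h) z) + m * (1 + h)" by auto
    have "open ((\<lambda>r. dil r z) -` \<Omega>2)"
      using starshapedD(1)[OF star2] continuous_on_open_vimage[of UNIV "\<lambda>r. dil r z"]
      by (auto intro!: continuous_intros)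
    moreover have "1 \<in> (\<lambda>r. dil r z) -` \<Omega>2" using z ring_subset by auto
    ultimately obtain d' where d': "d' > 0" "ball 1 d' \<subseteq> (\<lambda>r. dil r z) -` \<Omega>2"
      unfolding open_contains_ball by blast
    define h where "h = min (min d d') 1 / 2"
    have h: "0 < h" "h < d" "h < d'" "h < 1" using d(1) d'(1) by (auto simp: h_def)
    have "1 + h \<in> ball 1 d'" using h by (simp add: dist_real_def)
    then have "dil (1 + h) z \<in> \<Omega>2" using d'(2) by blast
    then have "u (dil (1 + h) z) \<le> u z - m * ((1 + h) - 1)" using h by (intro le z) auto
    then show False using d(2)[OF h(1,2)] by (simp add: algebra_simps)
  qed
  then have "\<forall>z\<in>U. \<forall>D. GDERIV u z :> D \<longrightarrow> D \<bullet> dilation_field z < - (m / 2)" using m by fastforce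
  then show ?thesis using m half_gt_zero by blast
qed

end

theorem theorem3p2:
  fixes p :: real
    and \<Omega>1 \<Omega>2 :: "'n::finite heis set"
    and u :: "'n heis \<Rightarrow> real"
  assumes "p > 1"
    and "open \<Omega>1" and "bounded \<Omega>1" and "C1_boundary \<Omega>1" and "strictly_starshaped \<Omega>1"
    and "open \<Omega>2" and "bounded \<Omega>2" and "C1_boundary \<Omega>2" and "strictly_starshaped \<Omega>2"
    and "compact (closure \<Omega>1)" and "closure \<Omega>1 \<subseteq> \<Omega>2"
    and "uniform_exterior_hball \<Omega>1"
    and "uniform_interior_hball \<Omega>2"
    and "weak_solution p \<Omega>1 \<Omega>2 u"
  shows "\<exists>M>0. \<forall>z\<in>\<Omega>2 - closure \<Omega>1. \<forall>D. GDERIV u z :> D \<longrightarrow> D \<bullet> dilation_field z < - M"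
proof -
  let ?U = "\<Omega>2 - closure \<Omega>1"
  have U: "open ?U" "bounded ?U"
    by (intro open_Diff assms closed_closure, rule bounded_subset[OF assms(7)], blast)
  obtain G \<theta> where cont: "continuous_on ?U u" and harm: "weakly_p_harmonic p ?U u G"
    and \<theta>: "\<forall>k. Ck_on k \<Omega>2 \<theta>" "compact_support_in \<Omega>2 \<theta>" "\<forall>z\<in>closure \<Omega>1. \<theta> z = 1"
    and H: "HW0 p ?U (\<lambda>z. u z - \<theta> z) (\<lambda>z. G z - hgrad \<theta> z)"
    using assms(14) unfolding weak_solution_def by blast
  obtain \<phi> where \<phi>: "\<And>k::nat. \<phi> k \<in> C1_0 ?U"
    and lim: "(\<lambda>k. hsob_pow p ?U (\<lambda>z. \<phi> k z - (u z - \<theta> z)) (\<lambda>z. hgrad (\<phi> k) z - (G z - hgrad \<theta> z))) \<longlonglongrightarrow> 0"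
    using H unfolding HW0_def hsob_completion_def by blast
  have p0: "p > 0" using assms(1) by simp
  have HW: "HW p ?U u G" using harm by (simp add: weakly_p_harmonic_def)
  have C\<theta>: "Ck_on 1 ?U \<theta>" using Ck_on_subset[of 1 \<Omega>2 \<theta> ?U] \<theta>(1) by blast
  have C\<phi>: "Ck_on 1 ?U (\<phi> k)" for k using \<phi>[of k] by (simp add: C1_0_def)
  have mu: "u \<in> borel_measurable (lebesgue_on ?U)"
    using cont U by (intro continuous_imp_measurable_on_sets_lebesgue) auto
  have "hsob_pow p ?U (\<lambda>z. \<phi> k z - (u z - \<theta> z)) (\<lambda>z. hgrad (\<phi> k) z - (G z - hgrad \<theta> z)) =
      hsob_pow p ?U (\<lambda>z. \<theta> z + \<phi> k z - u z) (\<lambda>z. hgrad (\<lambda>z. \<theta> z + \<phi> k z) z - G z)" for k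
  proof -
    have "hgrad (\<lambda>z. \<theta> z + \<phi> k z) z = hgrad \<theta> z + hgrad (\<phi> k) z" if "z \<in> ?U" for z
      by (rule hgrad_add[OF Ck_on_1_differentiableD[OF C\<theta> that] Ck_on_1_differentiableD[OF C\<phi> that]])
    then show ?thesis
      unfolding hsob_pow_def by (intro nn_integral_cong) (simp add: algebra_simps)
  qed
  with lim have lim': "(\<lambda>k. hsob_pow p ?U (\<lambda>z. \<theta> z + \<phi> k z - u z) (\<lambda>z. hgrad (\<lambda>z. \<theta> z + \<phi> k z) z - G z)) \<longlonglongrightarrow> 0"
    by simp
  obtain r :: "nat \<Rightarrow> nat" where r: "sobolev_approx p ?U (\<lambda>k z. \<theta> z + \<phi> (r k) z) u G"
    using sobolev_approx_subsequence[OF assms(1) U mu HW_gradient_integrable(1)[OF p0 U(1) HW]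
        Ck_on_1_add[OF C\<theta> C\<phi>] HW_gradient_integrable(2)[OF p0 U(1) HW] lim'] by blast
  interpret starshaped_ring p \<Omega>1 \<Omega>2 ?U u G \<theta> "\<lambda>k. \<phi> (r k)"
  proof
    show "continuous_on \<Omega>2 \<theta>" using \<theta>(1) Ck_on_1_continuous by blast
    show "(\<integral>z. p_flux p (G z) \<bullet> hgrad \<psi> z \<partial>lebesgue_on ?U) = 0" if "\<psi> \<in> C1_0 ?U" for \<psi>
      by (rule weakly_p_harmonic_test[OF assms(1) U harm that])
  qed (use assms cont \<theta> \<phi> r in auto)
  show ?thesis by (rule gradient_bound[OF assms(12,13)])
qed

end
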